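(* Let $V$ be a universe of $\mathsf{ZFA}$ whose atoms form a set $A$, and assume the Principle of Dependent Choice $\mathsf{DC}$ holds in $V$. Let $\mathcal{G}$ be a group of permutations of $A$, let $\mathcal{F}$ be a normal filter of subgroups of $\mathcal{G}$, and let $\mathsf{HS}$ be the permutation model obtained from $\mathcal{G}$ and $\mathcal{F}$. Then the following are equivalent: (1) The essential subfilter of $\mathcal{F}$ is shift complete. (2) $\mathsf{HS}\models\mathsf{DC}$.
   Context: $\mathsf{ZFA}$ is $\mathsf{ZF}$ modified to allow atoms; the atoms are assumed to form a set $A$. Every permutation $\pi$ of $A$ extends recursively to the whole universe $V$ by $\pi(x)=\{\pi(y): y\in x\}$. Let $\mathcal{G}$ be a group of permutations of $A$. A filter of subgroups of $\mathcal{G}$ is a non-empty set $\mathcal{F}$ of subgroups of $\mathcal{G}$ closed under supergroups (that are subgroups of $\mathcal{G}$) and finite intersections. It is normal if $\pi H\pi^{-1}\in\mathcal{F}$ for all $H\in\mathcal{F}$ and $\pi\in\mathcal{G}$. For a set or atom $x$, $\mathrm{sym}(x)=\{\pi\in\mathcal{G}:\pi(x)=x\}$. Given a normal filter $\mathcal{F}$, $x$ is symmetric if $\mathrm{sym}(x)\in\mathcal{F}$, and hereditarily symmetric if $x$ and every element of the transitive closure of $x$ are symmetric. $\mathsf{HS}$ is the class of hereditarily symmetric objects; it is a transitive model of $\mathsf{ZFA}$, called the permutation model obtained from $\mathcal{G}$ and $\mathcal{F}$. The essential subfilter of $\mathcal{F}$ is the filter of subgroups of $\mathcal{G}$ generated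 by $\{\mathrm{sym}(x):x\in\mathsf{HS}\}$; it is again a normal filter of subgroups of $\mathcal{G}$. A normal filter $\mathcal{E}$ of subgroups of $\mathcal{G}$ is shift complete if for every decreasing (with respect to inclusion) sequence $\langle H_n:n\in\omega\rangle$ of elements of $\mathcal{E}$ there are $\pi_n\in\mathcal{G}$ ($n\in\omega$) such that, setting $\sigma_n=\pi_{n-1}\circ\dots\circ\pi_0$ (with $\sigma_0=\mathrm{id}$) and $K_n=\sigma_nH_n\sigma_n^{-1}$, one has $\pi_n\in K_n$ for every $n\in\omega$ and $\bigcap_{n\in\omega}K_n\in\mathcal{E}$. $\mathsf{DC}$ is the statement: every (non-empty) tree without maximal nodes has an infinite chain. Equivalently, if $R$ is a binary relation on a non-empty set $X$ such that for every $x\in X$ there is $y\in X$ with $x\mathrel{R}y$, then there is a sequence $\langle x_n:n\in\omega\rangle$ in $X$ with $x_n\mathrel{R}x_{n+1}$ for all $n$. *)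

theory Defs
  imports Main
begin

text \<open>
  The universe V of ZFA is an arbitrary first-order structure satisfying the ZFA axioms, with
  separation and replacement as schemas over first-order formulas with parameters. (Schemas over
  arbitrary HOL predicates would make AC, hence DC, true in V, since HOL has choice.)
  Groups, filters and sequences are elements of V; V need not be well-founded from outside.
\<close>

record 'v universe =
  carrier :: "'v set"
  mem :: "'v \<Rightarrow> 'v \<Rightarrow> bool"
  atom :: "'v \<Rightarrow> bool"

datatype fm = FMem nat nat | FEq nat nat | FAtom nat | FNeg fm | FConj fm fm | FEx nat fm

primrec sat :: "'v universe \<Rightarrow> (nat \<Rightarrow> 'v) \<Rightarrow> fm \<Rightarrow> bool" where
  "sat V s (FMem i j) \<longleftrightarrow> mem V (s i) (s j)"
| "sat V s (FEq i j) \<longleftrightarrow> s i = s j"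
| "sat V s (FAtom i) \<longleftrightarrow> atom V (s i)"
| "sat V s (FNeg p) \<longleftrightarrow> \<not> sat V s p"
| "sat V s (FConj p q) \<longleftrightarrow> sat V s p \<and> sat V s q"
| "sat V s (FEx i p) \<longleftrightarrow> (\<exists>x\<in>carrier V. sat V (s(i := x)) p)"

definition elts :: "'v universe \<Rightarrow> 'v \<Rightarrow> 'v set" where
  "elts V x = {y \<in> carrier V. mem V y x}"

definition is_set :: "'v universe \<Rightarrow> 'v \<Rightarrow> bool" where
  "is_set V x \<longleftrightarrow> x \<in> carrier V \<and> \<not> atom V x"

definition codes :: "'v universe \<Rightarrow> 'v \<Rightarrow> 'v set \<Rightarrow> bool" where
  "codes V x S \<longleftrightarrow> is_set V x \<and> elts V x = S"

definition is_inductive :: "'v universe \<Rightarrow> 'v \<Rightarrow> bool" where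
  "is_inductive V w \<longleftrightarrow> is_set V w \<and> (\<exists>z\<in>elts V w. codes V z {}) \<and>
     (\<forall>x\<in>elts V w. \<exists>y\<in>elts V w. codes V y (insert x (elts V x)))"

definition ZFA :: "'v universe \<Rightarrow> bool" where
  "ZFA V \<longleftrightarrow>
    \<comment> \<open>atoms\<close>
    (\<forall>a\<in>carrier V. atom V a \<longrightarrow> elts V a = {}) \<and>
    (\<exists>A. codes V A {a \<in> carrier V. atom V a}) \<and>
    \<comment> \<open>extensionality\<close>
    (\<forall>x y. is_set V x \<and> is_set V y \<and> elts V x = elts V y \<longrightarrow> x = y) \<and>
    \<comment> \<open>foundation\<close>
    (\<forall>x\<in>carrier V. elts V x \<noteq> {} \<longrightarrow> (\<exists>y\<in>elts V x. elts V y \<inter> elts V x = {})) \<and>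
    \<comment> \<open>pairing\<close>
    (\<forall>x\<in>carrier V. \<forall>y\<in>carrier V. \<exists>z. codes V z {x, y}) \<and>
    \<comment> \<open>union\<close>
    (\<forall>x\<in>carrier V. \<exists>z. codes V z (\<Union>y\<in>elts V x. elts V y)) \<and>
    \<comment> \<open>power set\<close>
    (\<forall>x\<in>carrier V. \<exists>z. codes V z {y. is_set V y \<and> elts V y \<subseteq> elts V x}) \<and>
    \<comment> \<open>infinity\<close>
    (\<exists>w. is_inductive V w) \<and>
    \<comment> \<open>separation schema\<close>
    (\<forall>p s. \<forall>x\<in>carrier V. range s \<subseteq> carrier V \<longrightarrow>
      (\<exists>z. codes V z {y \<in> elts V x. sat V (s(0 := y)) p})) \<and>
    \<comment> \<open>replacement schema\<close>
    (\<forall>p s. \<forall>x\<in>carrier V. range s \<subseteq> carrier V \<and>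
      (\<forall>u\<in>elts V x. \<exists>!v. v \<in> carrier V \<and> sat V (s(0 := u, 1 := v)) p) \<longrightarrow>
      (\<exists>z. codes V z {v \<in> carrier V. \<exists>u\<in>elts V x. sat V (s(0 := u, 1 := v)) p}))"

text \<open>Kuratowski pairs.\<close>

definition is_pair :: "'v universe \<Rightarrow> 'v \<Rightarrow> 'v \<Rightarrow> 'v \<Rightarrow> bool" where
  "is_pair V p x y \<longleftrightarrow> (\<exists>a b. codes V a {x} \<and> codes V b {x, y} \<and> codes V p {a, b})"

definition rel :: "'v universe \<Rightarrow> 'v \<Rightarrow> 'v \<Rightarrow> 'v \<Rightarrow> bool" where
  "rel V f x y \<longleftrightarrow> (\<exists>p\<in>elts V f. is_pair V p x y)"

definition is_relation :: "'v universe \<Rightarrow> 'v \<Rightarrow> 'v \<Rightarrow> 'v \<Rightarrow> bool" where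
  "is_relation V f X Y \<longleftrightarrow> is_set V f \<and>
     (\<forall>p\<in>elts V f. \<exists>x\<in>elts V X. \<exists>y\<in>elts V Y. is_pair V p x y)"

definition is_function :: "'v universe \<Rightarrow> 'v \<Rightarrow> 'v \<Rightarrow> 'v \<Rightarrow> bool" where
  "is_function V f X Y \<longleftrightarrow> is_relation V f X Y \<and> (\<forall>x\<in>elts V X. \<exists>!y. rel V f x y)"

definition is_omega :: "'v universe \<Rightarrow> 'v \<Rightarrow> bool" where
  "is_omega V w \<longleftrightarrow> is_inductive V w \<and>
     (\<forall>v. is_inductive V v \<longrightarrow> elts V w \<subseteq> elts V v)"

text \<open>
  Dependent choice, with all quantifiers ranging over the carrier, so that the same definition
  expresses DC in V and in a submodel of V.
\<close>

definition DC :: "'v universe \<Rightarrow> bool" where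
  "DC V \<longleftrightarrow> (\<forall>X R. is_set V X \<and> elts V X \<noteq> {} \<and> is_relation V R X X \<and>
       (\<forall>x\<in>elts V X. \<exists>y\<in>elts V X. rel V R x y) \<longrightarrow>
     (\<exists>w s. is_omega V w \<and> is_function V s w X \<and>
       (\<forall>n\<in>elts V w. \<forall>m\<in>elts V w. codes V m (insert n (elts V n)) \<longrightarrow>
         (\<forall>x y. rel V s n x \<and> rel V s m y \<longrightarrow> rel V R x y))))"

text \<open>
  The operations below are only used for a universe of ZFA, where the sets they describe exist.
\<close>

definition the_set :: "'v universe \<Rightarrow> 'v set \<Rightarrow> 'v" where
  "the_set V S = (THE x. codes V x S)"

definition app :: "'v universe \<Rightarrow> 'v \<Rightarrow> 'v \<Rightarrow> 'v" where
  "app V f x = (THE y. rel V f x y)"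

definition omega :: "'v universe \<Rightarrow> 'v" where
  "omega V = (THE w. is_omega V w)"

definition zero :: "'v universe \<Rightarrow> 'v" where
  "zero V = the_set V {}"

definition succ :: "'v universe \<Rightarrow> 'v \<Rightarrow> 'v" where
  "succ V n = the_set V (insert n (elts V n))"

definition atoms :: "'v universe \<Rightarrow> 'v" where
  "atoms V = the_set V {a \<in> carrier V. atom V a}"

definition is_perm :: "'v universe \<Rightarrow> 'v \<Rightarrow> bool" where
  "is_perm V p \<longleftrightarrow> is_function V p (atoms V) (atoms V) \<and>
     (\<forall>y\<in>elts V (atoms V). \<exists>!x. rel V p x y)"

definition perm_id :: "'v universe \<Rightarrow> 'v" where
  "perm_id V = the_set V {r. \<exists>a\<in>elts V (atoms V). is_pair V r a a}"

definition perm_comp :: "'v universe \<Rightarrow> 'v \<Rightarrow> 'v \<Rightarrow> 'v" where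
  "perm_comp V p q = the_set V {r. \<exists>x y z. rel V q x y \<and> rel V p y z \<and> is_pair V r x z}"

definition perm_inv :: "'v universe \<Rightarrow> 'v \<Rightarrow> 'v" where
  "perm_inv V p = the_set V {r. \<exists>x y. rel V p x y \<and> is_pair V r y x}"

definition perm_group :: "'v universe \<Rightarrow> 'v \<Rightarrow> bool" where
  "perm_group V G \<longleftrightarrow> is_set V G \<and> (\<forall>p\<in>elts V G. is_perm V p) \<and> perm_id V \<in> elts V G \<and>
     (\<forall>p\<in>elts V G. \<forall>q\<in>elts V G. perm_comp V p q \<in> elts V G) \<and>
     (\<forall>p\<in>elts V G. perm_inv V p \<in> elts V G)"

definition perm_subgroup :: "'v universe \<Rightarrow> 'v \<Rightarrow> 'v \<Rightarrow> bool" where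
  "perm_subgroup V H G \<longleftrightarrow> perm_group V H \<and> elts V H \<subseteq> elts V G"

definition conjugate :: "'v universe \<Rightarrow> 'v \<Rightarrow> 'v \<Rightarrow> 'v" where
  "conjugate V p H = the_set V ((\<lambda>h. perm_comp V (perm_comp V p h) (perm_inv V p)) ` elts V H)"

text \<open>
  Binary intersections suffice, by induction inside V; the empty intersection G belongs to the
  filter by non-emptiness and closure under supergroups.
\<close>

definition subgroup_filter :: "'v universe \<Rightarrow> 'v \<Rightarrow> 'v \<Rightarrow> bool" where
  "subgroup_filter V G F \<longleftrightarrow> is_set V F \<and> elts V F \<noteq> {} \<and>
     (\<forall>H\<in>elts V F. perm_subgroup V H G) \<and>
     (\<forall>H\<in>elts V F. \<forall>K. perm_subgroup V K G \<and> elts V H \<subseteq> elts V K \<longrightarrow> K \<in> elts V F) \<and>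
     (\<forall>H\<in>elts V F. \<forall>K\<in>elts V F. the_set V (elts V H \<inter> elts V K) \<in> elts V F)"

definition normal_filter :: "'v universe \<Rightarrow> 'v \<Rightarrow> 'v \<Rightarrow> bool" where
  "normal_filter V G F \<longleftrightarrow> subgroup_filter V G F \<and>
     (\<forall>H\<in>elts V F. \<forall>p\<in>elts V G. conjugate V p H \<in> elts V F)"

text \<open>
  The recursion \<open>p(x) = {p(y) : y \<in> x}\<close> is carried out inside V, through approximations: functions
  in V whose domain is closed under elements and which satisfy the recursion equation there.
\<close>

definition action_approx :: "'v universe \<Rightarrow> 'v \<Rightarrow> 'v \<Rightarrow> bool" where
  "action_approx V p f \<longleftrightarrow> is_set V f \<and>
     (\<forall>r\<in>elts V f. \<exists>x y. is_pair V r x y) \<and>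
     (\<forall>x y z. rel V f x y \<and> rel V f x z \<longrightarrow> y = z) \<and>
     (\<forall>x y. rel V f x y \<longrightarrow>
        (if atom V x then rel V p x y
         else (\<forall>u\<in>elts V x. \<exists>v. rel V f u v) \<and> codes V y {v. \<exists>u\<in>elts V x. rel V f u v}))"

definition act :: "'v universe \<Rightarrow> 'v \<Rightarrow> 'v \<Rightarrow> 'v" where
  "act V p x = (THE y. \<exists>f. action_approx V p f \<and> rel V f x y)"

definition sym_of :: "'v universe \<Rightarrow> 'v \<Rightarrow> 'v \<Rightarrow> 'v" where
  "sym_of V G x = the_set V {p \<in> elts V G. act V p x = x}"

definition symmetric :: "'v universe \<Rightarrow> 'v \<Rightarrow> 'v \<Rightarrow> 'v \<Rightarrow> bool" where
  "symmetric V G F x \<longleftrightarrow> sym_of V G x \<in> elts V F"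

definition transitive_set :: "'v universe \<Rightarrow> 'v \<Rightarrow> bool" where
  "transitive_set V t \<longleftrightarrow> is_set V t \<and> (\<forall>y\<in>elts V t. elts V y \<subseteq> elts V t)"

definition transitive_closure :: "'v universe \<Rightarrow> 'v \<Rightarrow> 'v" where
  "transitive_closure V x = the_set V
     {y \<in> carrier V. \<forall>t. transitive_set V t \<and> elts V x \<subseteq> elts V t \<longrightarrow> y \<in> elts V t}"

definition HS :: "'v universe \<Rightarrow> 'v \<Rightarrow> 'v \<Rightarrow> 'v set" where
  "HS V G F = {x \<in> carrier V. symmetric V G F x \<and>
     (\<forall>y\<in>elts V (transitive_closure V x). symmetric V G F y)}"

definition permutation_model :: "'v universe \<Rightarrow> 'v \<Rightarrow> 'v \<Rightarrow> 'v universe" where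
  "permutation_model V G F = V\<lparr>carrier := HS V G F\<rparr>"

text \<open>The least filter of subgroups of G containing every \<open>sym(x)\<close> with \<open>x\<close> in HS.\<close>

definition essential_subfilter :: "'v universe \<Rightarrow> 'v \<Rightarrow> 'v \<Rightarrow> 'v" where
  "essential_subfilter V G F = the_set V {H \<in> carrier V.
     \<forall>D. subgroup_filter V G D \<and> (\<forall>x\<in>HS V G F. sym_of V G x \<in> elts V D) \<longrightarrow> H \<in> elts V D}"

text \<open>
  The sequence of the \<open>\<sigma>\<^sub>n = \<pi>\<^sub>n\<^sub>-\<^sub>1 \<circ> \<dots> \<circ> \<pi>\<^sub>0\<close> is the element \<open>q\<close> of V determined by recursion from
  the sequence \<open>p\<close> of the \<open>\<pi>\<^sub>n\<close>.
\<close>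

definition shift_complete :: "'v universe \<Rightarrow> 'v \<Rightarrow> 'v \<Rightarrow> bool" where
  "shift_complete V G E \<longleftrightarrow>
    (\<forall>h. is_function V h (omega V) E \<and>
        (\<forall>n\<in>elts V (omega V). \<forall>m\<in>elts V n. elts V (app V h n) \<subseteq> elts V (app V h m)) \<longrightarrow>
      (\<exists>p q. is_function V p (omega V) G \<and> is_function V q (omega V) G \<and>
        app V q (zero V) = perm_id V \<and>
        (\<forall>n\<in>elts V (omega V). app V q (succ V n) = perm_comp V (app V p n) (app V q n)) \<and>
        (\<forall>n\<in>elts V (omega V).
           app V p n \<in> elts V (conjugate V (app V q n) (app V h n))) \<and>
        the_set V (\<Inter>n\<in>elts V (omega V). elts V (conjugate V (app V q n) (app V h n)))
          \<in> elts V E))"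

end

theory Submission
  imports Defs
begin

text \<open>
  From left to right, choose a chain \<open>x\<^sub>n\<close> for a relation \<open>R\<close> of the permutation model
  in \<open>V\<close>, and apply shift completeness to the stabilizers \<open>H\<^sub>n\<close> of \<open>R\<close> and
  \<open>x\<^sub>0, \<dots>, x\<^sub>n\<close>. The sequence of the \<open>\<sigma>\<^sub>n x\<^sub>n\<close> is again a chain, because
  \<open>\<pi>\<^sub>n\<close> fixes \<open>\<sigma>\<^sub>n x\<^sub>n\<close>, and it is fixed by the intersection of the \<open>K\<^sub>n\<close>.
  Conversely, choose \<open>x\<^sub>n\<close> in the model whose stabilizer is contained in \<open>H\<^sub>n\<close>. The
  tree of the images of the finite sequences \<open>(x\<^sub>0, \<dots>, x\<^sub>n)\<close> under the stabilizer of
  \<open>x\<^sub>0\<close> lies in the model, so it has a branch \<open>u\<close> there. Choosing \<open>\<sigma>\<^sub>n\<close> that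
  maps \<open>x\<^sub>i\<close> to \<open>u\<^sub>i\<close> for \<open>i \<le> n\<close> gives the conjugating elements; the stabilizer
  of \<open>u\<close> lies in every \<open>K\<^sub>n\<close>.

  As separation and replacement hold only for first-order formulas, every class used has to be
  shown definable. The predicate \<open>D K P\<close> says that \<open>P\<close>, a predicate on assignments, is
  definable with parameters from \<open>K\<close>, and \<open>DT K t\<close> says so for a total term \<open>t\<close>.
  Variables are de Bruijn indices: below a quantifier the bound variable is \<open>s 0\<close> and the others
  are shifted, so that definability follows the syntax of the HOL formula. Definable operations commute
  with automorphisms of \<open>V\<close> fixing the parameters, which yields all the symmetry facts.
\<close>

section \<open>Definability\<close>

text \<open>The \<omega> of \<open>V\<close> may contain nonstandard numbers, so finite sequences,
  inductions and choices all have to be made inside \<open>V\<close>; induction along the naturals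
  of HOL would not reach every index. Terms given by \<open>THE\<close> can leave the carrier, hence
  the total variants \<open>ap\<close>, \<open>ac\<close> and \<open>rec\<close>.

  The chain chosen in \<open>V\<close> need not lie in the permutation model, but each of its finite
  initial segments does; both directions work with these segments. In the converse direction the
  tree is generated by the stabilizer of x_0 and not by all of \<open>G\<close>: its branches then
  start with x_0, so \<sigma>_0 can be the identity. Put \<pi>_n = \<sigma>_{n+1} \<sigma>_n^{-1}.
  Both \<sigma>_n and \<sigma>_{n+1} map x_n to u_n, so \<sigma>_n^{-1} \<sigma>_{n+1} fixes x_n and
  lies in H_n; conjugating by \<sigma>_n gives \<pi>_n in K_n.

  The x_n are picked from a proper class, which calls for collection, proved by Scott's trick,
  before countable choice applies. Countable choice in \<open>V\<close> comes from the same tree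
  argument as the branch in the model, applied to the whole carrier.\<close>

primrec fm_vars :: "fm \<Rightarrow> nat set" where
  "fm_vars (FMem i j) = {i, j}"
| "fm_vars (FEq i j) = {i, j}"
| "fm_vars (FAtom i) = {i}"
| "fm_vars (FNeg p) = fm_vars p"
| "fm_vars (FConj p q) = fm_vars p \<union> fm_vars q"
| "fm_vars (FEx i p) = fm_vars p"

lemma finite_fm_vars: "finite (fm_vars p)"
  by (induction p) auto

lemma sat_cong: "(\<And>i. i \<in> fm_vars p \<Longrightarrow> s i = s' i) \<Longrightarrow> sat V s p = sat V s' p"
proof (induction p arbitrary: s s')
  case (FEx i p)
  have "sat V (s(i := x)) p = sat V (s'(i := x)) p" for x
    by (rule FEx.IH) (use FEx.prems in auto)
  then show ?case by simp
next
  case (FConj p q)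
  have "sat V s p = sat V s' p" by (rule FConj.IH) (use FConj.prems in auto)
  moreover have "sat V s q = sat V s' q" by (rule FConj.IH) (use FConj.prems in auto)
  ultimately show ?case by simp
next
  case (FNeg p)
  have "sat V s p = sat V s' p" by (rule FNeg.IH) (use FNeg.prems in auto)
  then show ?case by simp
qed auto

text \<open>Renaming may identify variables, so the bound variable is chosen fresh.\<close>

primrec fm_rename :: "fm \<Rightarrow> (nat \<Rightarrow> nat) \<Rightarrow> fm" where
  "fm_rename (FMem i j) f = FMem (f i) (f j)"
| "fm_rename (FEq i j) f = FEq (f i) (f j)"
| "fm_rename (FAtom i) f = FAtom (f i)"
| "fm_rename (FNeg p) f = FNeg (fm_rename p f)"
| "fm_rename (FConj p q) f = FConj (fm_rename p f) (fm_rename q f)"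
| "fm_rename (FEx i p) f =
    FEx (Suc (\<Sum>j\<in>fm_vars p. f j)) (fm_rename p (f(i := Suc (\<Sum>j\<in>fm_vars p. f j))))"

lemma sat_fm_rename: "sat V s (fm_rename p f) = sat V (\<lambda>n. s (f n)) p"
proof (induction p arbitrary: s f)
  case (FEx i p)
  define k where "k = Suc (\<Sum>j\<in>fm_vars p. f j)"
  have "sat V (\<lambda>n. (s(k := x)) ((f(i := k)) n)) p = sat V ((\<lambda>n. s (f n))(i := x)) p" for x
  proof (rule sat_cong)
    fix j assume "j \<in> fm_vars p"
    \<comment> \<open>\<open>f j\<close> is one of the summands, hence at most their sum and below
      \<open>k\<close>.\<close>
    then have "f j \<noteq> k"
      using member_le_sum[of j "fm_vars p" f] finite_fm_vars unfolding k_def by fastforce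
    then show "(s(k := x)) ((f(i := k)) j) = ((\<lambda>n. s (f n))(i := x)) j" by auto
  qed
  then show ?case using FEx.IH by (simp add: k_def[symmetric])
qed auto

section \<open>Predicates and terms definable over a structure\<close>

locale fo_structure =
  fixes V :: "'v universe"
begin

abbreviation C :: "'v set" where "C \<equiv> carrier V"

abbreviation E :: "'v \<Rightarrow> 'v set" where "E \<equiv> elts V"

definition assignment :: "(nat \<Rightarrow> 'v) \<Rightarrow> bool" where
  "assignment s \<longleftrightarrow> (\<forall>n. s n \<in> C)"

lemma assignment_in: "assignment s \<Longrightarrow> s n \<in> C"
  by (simp add: assignment_def)

lemma assignment_Suc: "assignment s \<Longrightarrow> assignment (\<lambda>n. s (Suc n))"
  by (simp add: assignment_def)

lemma assignment_case_nat: "assignment s \<Longrightarrow> x \<in> C \<Longrightarrow> assignment (case_nat x s)"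
  by (auto simp: assignment_def split: nat.splits)

text \<open>
  Index 0 of the environment is a scratch register for the next quantifier; the other even indices
  hold the variables and the odd ones the parameters.
\<close>

definition environment :: "'v \<Rightarrow> (nat \<Rightarrow> 'v) \<Rightarrow> (nat \<Rightarrow> 'v) \<Rightarrow> nat \<Rightarrow> 'v" where
  "environment j c s i = (if i = 0 then j else if even i then s (i div 2 - 1) else c (i div 2))"

text \<open>
  Parameters are taken from \<open>K\<close>, with the empty set always allowed so that \<open>K\<close> may be empty.
\<close>

definition parameters :: "'v set \<Rightarrow> (nat \<Rightarrow> 'v) \<Rightarrow> bool" where
  "parameters K c \<longleftrightarrow> (\<forall>n. c n \<in> C \<and> (c n \<in> K \<or> codes V (c n) {}))"

text \<open>The scratch value \<open>j\<close> is arbitrary, so the truth of the formula does not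
  depend on it; this leaves index 0 free to be bound in \<open>D_ex\<close>.\<close>

definition D :: "'v set \<Rightarrow> ((nat \<Rightarrow> 'v) \<Rightarrow> bool) \<Rightarrow> bool" where
  "D K P \<longleftrightarrow> (\<exists>p c. parameters K c \<and>
     (\<forall>s j. assignment s \<longrightarrow> j \<in> C \<longrightarrow> (P s \<longleftrightarrow> sat V (environment j c s) p)))"

text \<open>In the graph the value is variable 0 and the arguments are shifted by one. Staying in
  the carrier is part of the notion, because substituting a term amounts to quantifying over its
  value.\<close>

definition DT :: "'v set \<Rightarrow> ((nat \<Rightarrow> 'v) \<Rightarrow> 'v) \<Rightarrow> bool" where
  "DT K t \<longleftrightarrow> (\<forall>s. assignment s \<longrightarrow> t s \<in> C) \<and> D K (\<lambda>s. s 0 = t (\<lambda>n. s (Suc n)))"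

lemma D_cong: "(\<And>s. assignment s \<Longrightarrow> P s = Q s) \<Longrightarrow> D K Q \<Longrightarrow> D K P"
  unfolding D_def by fastforce

lemma D_mono:
  assumes "D K P" "K \<subseteq> L" shows "D L P"
proof -
  have "parameters L c" if "parameters K c" for c
    using that assms(2) unfolding parameters_def by blast
  then show ?thesis using assms(1) unfolding D_def by blast
qed

lemma DT_mono: "DT K t \<Longrightarrow> K \<subseteq> L \<Longrightarrow> DT L t"
  unfolding DT_def using D_mono by blast

lemma D_rename:
  assumes "D K P" shows "D K (\<lambda>s. P (\<lambda>n. s (f n)))"
proof -
  obtain p c where c: "parameters K c"
    and p: "\<And>s j. assignment s \<Longrightarrow> j \<in> C \<Longrightarrow> P s \<longleftrightarrow> sat V (environment j c s) p"
    using assms unfolding D_def by blast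
  define g where "g i = (if i \<noteq> 0 \<and> even i then 2 * f (i div 2 - 1) + 2 else i)" for i
  have g: "environment j c s (g i) = environment j c (\<lambda>n. s (f n)) i" for i j s
    unfolding environment_def g_def by auto
  have "P (\<lambda>n. s (f n)) \<longleftrightarrow> sat V (environment j c s) (fm_rename p g)"
    if "assignment s" "j \<in> C" for s j
    using p[of "\<lambda>n. s (f n)" j] that by (simp add: sat_fm_rename g assignment_def)
  then show ?thesis unfolding D_def using c by blast
qed

lemma D_not: "D K P \<Longrightarrow> D K (\<lambda>s. \<not> P s)"
proof -
  assume "D K P"
  then obtain p c where "parameters K c"
    and "\<forall>s j. assignment s \<longrightarrow> j \<in> C \<longrightarrow> (P s \<longleftrightarrow> sat V (environment j c s) p)"
    unfolding D_def by blast
  then show ?thesis unfolding D_def by (intro exI[of _ "FNeg p"] exI[of _ c]) auto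
qed

lemma D_conj:
  assumes "D K P" "D K Q" shows "D K (\<lambda>s. P s \<and> Q s)"
proof -
  obtain p c where c: "parameters K c"
    and p: "\<And>s j. assignment s \<Longrightarrow> j \<in> C \<Longrightarrow> P s \<longleftrightarrow> sat V (environment j c s) p"
    using assms(1) unfolding D_def by blast
  obtain q d where d: "parameters K d"
    and q: "\<And>s j. assignment s \<Longrightarrow> j \<in> C \<Longrightarrow> Q s \<longleftrightarrow> sat V (environment j d s) q"
    using assms(2) unfolding D_def by blast
  \<comment> \<open>The two parameter sequences are interleaved. Parameter \<open>k\<close> sits at
    index \<open>2 * k + 1\<close> before, and afterwards at \<open>4 * k + 1\<close> or
    \<open>4 * k + 3\<close> according to its origin.\<close>
  define e where "e n = (if even n then c (n div 2) else d (n div 2))" for n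
  define f where "f i = (if even i then i else 4 * (i div 2) + 1)" for i :: nat
  define g where "g i = (if even i then i else 4 * (i div 2) + 3)" for i :: nat
  have f: "environment j e s (f i) = environment j c s i" for i j s
    unfolding environment_def f_def e_def by (auto elim!: oddE)
  have g: "environment j e s (g i) = environment j d s i" for i j s
  proof (cases "even i")
    case False
    have "(4 * (i div 2) + 3) div 2 = 2 * (i div 2) + 1" by presburger
    moreover have "odd (4 * (i div 2) + 3)" by simp
    ultimately show ?thesis using False unfolding environment_def g_def e_def
      by (auto simp: odd_pos)
  qed (auto simp: environment_def g_def)
  have "P s \<and> Q s \<longleftrightarrow> sat V (environment j e s) (FConj (fm_rename p f) (fm_rename q g))"
    if "assignment s" "j \<in> C" for s j
    using p[OF that] q[OF that] by (simp add: sat_fm_rename f g)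
  moreover have "parameters K e" using c d unfolding parameters_def e_def by simp
  ultimately show ?thesis unfolding D_def by blast
qed

lemma D_ex:
  assumes "D K (\<lambda>s. Q (\<lambda>n. s (Suc n)) (s 0))" shows "D K (\<lambda>s. \<exists>x\<in>C. Q s x)"
proof -
  obtain p c where c: "parameters K c"
    and p: "\<And>s j. assignment s \<Longrightarrow> j \<in> C \<Longrightarrow>
      Q (\<lambda>n. s (Suc n)) (s 0) \<longleftrightarrow> sat V (environment j c s) p"
    using assms unfolding D_def by blast
  \<comment> \<open>Index 2, the newest variable of \<open>p\<close>, must read the bound index 0,
    and the later variables move down by one place. Subtraction is truncated, so index 0 also reads
    the bound value, which is harmless for a scratch register.\<close>
  define f where "f i = (if even i then i - 2 else i)" for i :: nat
  have f: "((environment j c s)(0 := x)) (f i) = environment x c (case_nat x s) i" for i j s x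
  proof -
    consider "i = 0" | "i = 2" | k where "i = 2 * k + 4" | k where "i = 2 * k + 1"
    proof (cases "even i")
      case True then obtain k where k: "i = 2 * k" by blast
      consider "k = 0" | "k = 1" | l where "k = l + 2" by (metis One_nat_def add_2_eq_Suc' not0_implies_Suc)
      then show thesis using that k by cases auto
    next
      case False then show thesis using that by (auto elim!: oddE)
    qed
    then show ?thesis by cases (auto simp: environment_def f_def)
  qed
  have "(\<exists>x\<in>C. Q s x) \<longleftrightarrow> sat V (environment j c s) (FEx 0 (fm_rename p f))"
    if "assignment s" "j \<in> C" for s j
    using p[of "case_nat x s" x for x] assignment_case_nat[OF that(1)]
    by (simp add: sat_fm_rename f del: fun_upd_apply)
  then show ?thesis unfolding D_def using c by blast
qed

lemma D_disj:
  assumes "D K P" "D K Q" shows "D K (\<lambda>s. P s \<or> Q s)"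
proof -
  have "D K (\<lambda>s. \<not> (\<not> P s \<and> \<not> Q s))" by (intro D_not D_conj assms)
  then show ?thesis by simp
qed

lemma D_imp:
  assumes "D K P" "D K Q" shows "D K (\<lambda>s. P s \<longrightarrow> Q s)"
proof -
  have "D K (\<lambda>s. \<not> P s \<or> Q s)" by (intro D_not D_disj assms)
  then show ?thesis by (simp only: imp_conv_disj)
qed

lemma D_iff:
  assumes "D K P" "D K Q" shows "D K (\<lambda>s. P s \<longleftrightarrow> Q s)"
proof -
  have "D K (\<lambda>s. (P s \<longrightarrow> Q s) \<and> (Q s \<longrightarrow> P s))" by (intro D_imp D_conj assms)
  then show ?thesis by (simp only: iff_conv_conj_imp)
qed

lemma D_all:
  assumes "D K (\<lambda>s. Q (\<lambda>n. s (Suc n)) (s 0))" shows "D K (\<lambda>s. \<forall>x\<in>C. Q s x)"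
proof -
  have "D K (\<lambda>s. \<not> (\<exists>x\<in>C. \<not> Q s x))" by (intro D_not D_ex assms)
  then show ?thesis by simp
qed

lemma D_if:
  assumes "D K P" "D K Q" "D K R" shows "D K (\<lambda>s. if P s then Q s else R s)"
  using D_conj[OF D_imp[OF assms(1,2)] D_imp[OF D_not[OF assms(1)] assms(3)]]
  by (rule D_cong[rotated]) simp

end

locale inhabited = fo_structure V for V :: "'v universe" +
  assumes empty_exists: "\<exists>z. codes V z {}"
begin

definition emptyset :: 'v where "emptyset = (SOME z. codes V z {})"

lemma codes_emptyset: "codes V emptyset {}"
  unfolding emptyset_def using someI_ex[OF empty_exists] .

lemma emptyset_in [simp]: "emptyset \<in> C"
  using codes_emptyset by (simp add: codes_def is_set_def)

lemma parameters_const: "k = emptyset \<or> (k \<in> C \<and> k \<in> K) \<Longrightarrow> parameters K (\<lambda>_. k)"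
  using codes_emptyset by (auto simp: parameters_def)

lemma D_formula: "(\<And>s. assignment s \<Longrightarrow> P s \<longleftrightarrow> sat V s p) \<Longrightarrow> D K P"
  unfolding D_def
  by (intro exI[of _ "fm_rename p (\<lambda>n. 2 * n + 2)"] exI[of _ "\<lambda>_. emptyset"])
    (simp add: parameters_const sat_fm_rename environment_def)

lemma D_True: "D K (\<lambda>s. True)"
  by (rule D_formula[of _ "FEq 0 0"]) simp

lemma D_False: "D K (\<lambda>s. False)"
  by (rule D_formula[of _ "FNeg (FEq 0 0)"]) simp

lemma DT_var: "DT K (\<lambda>s. s n)"
  unfolding DT_def by (auto intro: D_formula[of _ "FEq 0 (Suc n)"] simp: assignment_in)

lemma DT_param:
  assumes "k \<in> K" "k \<in> C" shows "DT K (\<lambda>s. k)"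
proof -
  have "D K (\<lambda>s. s 0 = k)"
    unfolding D_def using parameters_const[of k K] assms
    by (intro exI[of _ "FEq 2 1"] exI[of _ "\<lambda>_. k"]) (auto simp: environment_def)
  then show ?thesis using assms by (simp add: DT_def)
qed

text \<open>Substitution is expressed by quantifying over the value of the term, which is possible
  because its graph is definable and its value lies in the carrier.\<close>

lemma D_subst:
  assumes t: "DT K t" and Q: "D K (\<lambda>s. Q (\<lambda>n. s (Suc n)) (s 0))"
  shows "D K (\<lambda>s. Q s (t s))"
proof (rule D_cong)
  show "D K (\<lambda>s. \<exists>x\<in>C. x = t s \<and> Q s x)"
    by (rule D_ex) (use assms D_conj[of K "\<lambda>s. s 0 = t (\<lambda>n. s (Suc n))"] in \<open>simp add: DT_def\<close>)
  show "Q s (t s) \<longleftrightarrow> (\<exists>x\<in>C. x = t s \<and> Q s x)" if "assignment s" for s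
    using t that by (auto simp: DT_def)
qed

lemma DT_in: "DT K t \<Longrightarrow> assignment s \<Longrightarrow> t s \<in> C"
  by (simp add: DT_def)

lemma DT_rename: "DT K t \<Longrightarrow> DT K (\<lambda>s. t (\<lambda>n. s (f n)))"
  unfolding DT_def
  using D_rename[of K "\<lambda>s. s 0 = t (\<lambda>n. s (Suc n))" "case_nat 0 (\<lambda>n. Suc (f n))"]
  by (auto simp: assignment_def)

lemma DT_shift: "DT K t \<Longrightarrow> DT K (\<lambda>s. t (\<lambda>n. s (Suc n)))"
  by (rule DT_rename)

lemma D_subst1:
  assumes "DT K t" "D L (\<lambda>s. P (s 0))" "L \<subseteq> K" shows "D K (\<lambda>s. P (t s))"
  by (rule D_subst[of K t "\<lambda>s. P"]) (use assms D_mono in auto)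

lemma D_subst2:
  assumes t: "DT K t" and u: "DT K u" and P: "D L (\<lambda>s. P (s 0) (s 1))" and L: "L \<subseteq> K"
  shows "D K (\<lambda>s. P (t s) (u s))"
proof (rule D_subst[OF t], rule D_subst[OF DT_shift[OF u]])
  show "D K (\<lambda>s. P (s (Suc 0)) (s 0))"
    using D_rename[OF D_mono[OF P L], of "\<lambda>n. if n = 0 then 1 else 0"] by simp
qed

lemma D_subst3:
  assumes t: "DT K t" and u: "DT K u" and v: "DT K v"
    and P: "D L (\<lambda>s. P (s 0) (s 1) (s 2))" and L: "L \<subseteq> K"
  shows "D K (\<lambda>s. P (t s) (u s) (v s))"
proof (rule D_subst[OF t], rule D_subst[OF DT_shift[OF u]], rule D_subst[OF DT_shift[OF DT_shift[OF v]]])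
  show "D K (\<lambda>s. P (s (Suc (Suc 0))) (s (Suc 0)) (s 0))"
    using D_rename[OF D_mono[OF P L], of "\<lambda>n. if n = 0 then 2 else if n = 1 then 1 else 0"]
    by (simp add: numeral_2_eq_2)
qed

lemma D_subst4:
  assumes t: "DT K t" and u: "DT K u" and v: "DT K v" and w: "DT K w"
    and P: "D L (\<lambda>s. P (s 0) (s 1) (s 2) (s 3))" and L: "L \<subseteq> K"
  shows "D K (\<lambda>s. P (t s) (u s) (v s) (w s))"
proof (rule D_subst[OF t], rule D_subst[OF DT_shift[OF u]], rule D_subst[OF DT_shift[OF DT_shift[OF v]]],
    rule D_subst[OF DT_shift[OF DT_shift[OF DT_shift[OF w]]]])
  show "D K (\<lambda>s. P (s (Suc (Suc (Suc 0)))) (s (Suc (Suc 0))) (s (Suc 0)) (s 0))"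
    using D_rename[OF D_mono[OF P L],
        of "\<lambda>n. if n = 0 then 3 else if n = 1 then 2 else if n = 2 then 1 else 0"]
    by (simp add: numeral_2_eq_2 numeral_3_eq_3)
qed

lemma DT_I:
  assumes "\<And>s. assignment s \<Longrightarrow> t s \<in> C"
    and "\<And>s y. assignment s \<Longrightarrow> y \<in> C \<Longrightarrow> y = t s \<longleftrightarrow> Q s y"
    and "D K (\<lambda>s. Q (\<lambda>n. s (Suc n)) (s 0))"
  shows "DT K t"
  unfolding DT_def using assms
  by (auto intro!: D_cong[OF _ assms(3)] simp: assignment_Suc assignment_in)

lemma DT_subst1:
  assumes t: "DT K t" and f: "DT L (\<lambda>s. f (s 0))" and L: "L \<subseteq> K" shows "DT K (\<lambda>s. f (t s))"
proof -
  have "D L (\<lambda>s. s 0 = f (s 1))" using f by (simp add: DT_def)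
  from D_subst2[OF DT_var[of K 0] DT_shift[OF t] this L]
  moreover have "f x \<in> C" if "x \<in> C" for x
    using DT_in[OF f, of "\<lambda>_. x"] that by (simp add: assignment_def)
  ultimately show ?thesis unfolding DT_def using DT_in[OF t] by auto
qed

lemma DT_subst2:
  assumes t: "DT K t" and u: "DT K u" and f: "DT L (\<lambda>s. f (s 0) (s 1))" and L: "L \<subseteq> K"
  shows "DT K (\<lambda>s. f (t s) (u s))"
proof -
  have "D L (\<lambda>s. s 0 = f (s 1) (s 2))" using f by (simp add: DT_def numeral_2_eq_2)
  from D_subst3[OF DT_var[of K 0] DT_shift[OF t] DT_shift[OF u] this L]
  moreover have "f x y \<in> C" if "x \<in> C" "y \<in> C" for x y
    using DT_in[OF f, of "case_nat x (\<lambda>_. y)"] that by (simp add: assignment_def split: nat.splits)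
  ultimately show ?thesis unfolding DT_def using DT_in[OF t] DT_in[OF u] by auto
qed

lemma DT_subst3:
  assumes t: "DT K t" and u: "DT K u" and v: "DT K v" and f: "DT L (\<lambda>s. f (s 0) (s 1) (s 2))" and L: "L \<subseteq> K"
  shows "DT K (\<lambda>s. f (t s) (u s) (v s))"
proof -
  have "D L (\<lambda>s. s 0 = f (s 1) (s 2) (s 3))" using f by (simp add: DT_def numeral_2_eq_2 numeral_3_eq_3)
  from D_subst4[OF DT_var[of K 0] DT_shift[OF t] DT_shift[OF u] DT_shift[OF v] this L]
  moreover have "f x y z \<in> C" if "x \<in> C" "y \<in> C" "z \<in> C" for x y z
    using DT_in[OF f, of "case_nat x (case_nat y (\<lambda>_. z))"] that
    by (simp add: assignment_def numeral_2_eq_2 split: nat.splits)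
  ultimately show ?thesis unfolding DT_def using DT_in[OF t] DT_in[OF u] DT_in[OF v] by auto
qed

lemma D_mem: "DT K t \<Longrightarrow> DT K u \<Longrightarrow> D K (\<lambda>s. mem V (t s) (u s))"
  by (rule D_subst2[of _ _ _ "{}" "mem V"]) (auto intro: D_formula[of _ "FMem 0 1"])

lemma D_eq: "DT K t \<Longrightarrow> DT K u \<Longrightarrow> D K (\<lambda>s. t s = u s)"
  by (rule D_subst2[of _ _ _ "{}" "(=)"]) (auto intro: D_formula[of _ "FEq 0 1"])

lemma D_atom: "DT K t \<Longrightarrow> D K (\<lambda>s. atom V (t s))"
  by (rule D_subst1[of _ _ "{}" "atom V"]) (auto intro: D_formula[of _ "FAtom 0"])

lemma D_carrier: "DT K t \<Longrightarrow> D K (\<lambda>s. t s \<in> C)"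
  by (rule D_cong[OF _ D_True]) (simp add: DT_in)

lemma D_elts: "DT K t \<Longrightarrow> DT K u \<Longrightarrow> D K (\<lambda>s. t s \<in> E (u s))"
  using D_conj[OF D_carrier D_mem] by (simp add: elts_def)

lemma D_is_set: "DT K t \<Longrightarrow> D K (\<lambda>s. is_set V (t s))"
  unfolding is_set_def by (intro D_conj D_not D_carrier D_atom)

lemma D_bex:
  assumes "DT K t" "D K (\<lambda>s. Q (\<lambda>n. s (Suc n)) (s 0))" shows "D K (\<lambda>s. \<exists>x\<in>E (t s). Q s x)"
proof -
  have "D K (\<lambda>s. \<exists>x\<in>C. x \<in> E (t s) \<and> Q s x)"
    by (intro D_ex D_conj D_elts DT_var DT_shift assms)
  then show ?thesis by (rule D_cong[rotated]) (auto simp: elts_def)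
qed

lemma D_ball:
  assumes "DT K t" "D K (\<lambda>s. Q (\<lambda>n. s (Suc n)) (s 0))" shows "D K (\<lambda>s. \<forall>x\<in>E (t s). Q s x)"
proof -
  have "D K (\<lambda>s. \<not> (\<exists>x\<in>E (t s). \<not> Q s x))" by (intro D_not D_bex assms)
  then show ?thesis by simp
qed

text \<open>Bridges the definitions of the theorem, which quantify over the whole HOL type, and
  formulas, whose quantifiers range over the carrier. The first premise makes the two agree.\<close>

lemma D_ex_unbounded:
  assumes "\<And>s x. assignment s \<Longrightarrow> Q s x \<Longrightarrow> x \<in> C" "D K (\<lambda>s. Q (\<lambda>n. s (Suc n)) (s 0))"
  shows "D K (\<lambda>s. \<exists>x. Q s x)"
  using D_ex[OF assms(2)] by (rule D_cong[rotated]) (use assms(1) in blast)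

lemma D_all_unbounded:
  assumes "\<And>s x. assignment s \<Longrightarrow> x \<notin> C \<Longrightarrow> Q s x" "D K (\<lambda>s. Q (\<lambda>n. s (Suc n)) (s 0))"
  shows "D K (\<lambda>s. \<forall>x. Q s x)"
  using D_all[OF assms(2)] by (rule D_cong[rotated]) (use assms(1) in blast)

lemma D_ex1_unbounded:
  assumes "\<And>s x. assignment s \<Longrightarrow> Q s x \<Longrightarrow> x \<in> C" "D K (\<lambda>s. Q (\<lambda>n. s (Suc n)) (s 0))"
  shows "D K (\<lambda>s. \<exists>!x. Q s x)"
proof -
  have "D K (\<lambda>s. Q (\<lambda>n. s (Suc (Suc n))) (s 0))"
    using D_rename[OF assms(2), of "case_nat 0 (\<lambda>n. Suc (Suc n))"] by simp
  then have "D K (\<lambda>s. \<exists>x\<in>C. Q s x \<and> (\<forall>y\<in>C. Q s y \<longrightarrow> y = x))"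
    by (intro D_ex D_conj D_all D_imp D_eq DT_var assms(2)) simp_all
  then show ?thesis by (rule D_cong[rotated]) (use assms(1) in blast)
qed

lemma D_codes:
  assumes "DT K t" "\<And>s y. assignment s \<Longrightarrow> Q s y \<Longrightarrow> y \<in> C" "D K (\<lambda>s. Q (\<lambda>n. s (Suc n)) (s 0))"
  shows "D K (\<lambda>s. codes V (t s) {y. Q s y})"
proof -
  have "D K (\<lambda>s. is_set V (t s) \<and> (\<forall>y\<in>C. y \<in> E (t s) \<longleftrightarrow> Q s y))"
    by (intro D_conj D_is_set D_all D_iff D_elts DT_var DT_shift assms)
  then show ?thesis
    by (rule D_cong[rotated]) (use assms(2) in \<open>auto simp: codes_def elts_def\<close>)
qed

lemmas D_intros = D_not D_conj D_disj D_imp D_iff D_if D_ex D_all D_mem D_eq D_atom D_carrier D_elts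
  D_is_set D_bex D_ball DT_var

section \<open>Automorphisms and the invariance of definable predicates\<close>

definition automorphism :: "('v \<Rightarrow> 'v) \<Rightarrow> bool" where
  "automorphism f \<longleftrightarrow> bij_betw f C C \<and>
     (\<forall>x\<in>C. \<forall>y\<in>C. mem V (f x) (f y) \<longleftrightarrow> mem V x y) \<and> (\<forall>x\<in>C. atom V (f x) \<longleftrightarrow> atom V x)"

lemma automorphism_in: "automorphism f \<Longrightarrow> x \<in> C \<Longrightarrow> f x \<in> C"
  by (auto simp: automorphism_def bij_betw_def)

lemma sat_automorphism:
  assumes f: "automorphism f"
  shows "assignment s \<Longrightarrow> sat V (\<lambda>n. f (s n)) p \<longleftrightarrow> sat V s p"
proof (induction p arbitrary: s)
  case (FEx i p)
  have upd: "(\<lambda>n. f (s n))(i := f x) = (\<lambda>n. f ((s(i := x)) n))" for x by auto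
  have step: "sat V ((\<lambda>n. f (s n))(i := f x)) p \<longleftrightarrow> sat V (s(i := x)) p" if "x \<in> C" for x
    unfolding upd by (rule FEx.IH) (use FEx.prems that in \<open>simp add: assignment_def\<close>)
  have "sat V (\<lambda>n. f (s n)) (FEx i p) \<longleftrightarrow> (\<exists>x\<in>f ` C. sat V ((\<lambda>n. f (s n))(i := x)) p)"
    using f by (simp add: automorphism_def bij_betw_def)
  also have "\<dots> \<longleftrightarrow> (\<exists>x\<in>C. sat V (s(i := x)) p)"
    using step by (simp del: fun_upd_apply)
  finally show ?case by simp
qed (use f in \<open>auto simp: automorphism_def assignment_def bij_betw_def inj_on_def\<close>)

lemma D_automorphism:
  assumes f: "automorphism f" and K: "\<And>k. k \<in> K \<Longrightarrow> f k = k" and e: "f emptyset = emptyset"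
    and ext: "\<And>z. codes V z {} \<Longrightarrow> z = emptyset"
    and P: "D K P" and s: "assignment s"
  shows "P (\<lambda>n. f (s n)) \<longleftrightarrow> P s"
proof -
  obtain p c where c: "parameters K c"
    and p: "\<And>s j. assignment s \<Longrightarrow> j \<in> C \<Longrightarrow> P s \<longleftrightarrow> sat V (environment j c s) p"
    using P unfolding D_def by blast
  have fc: "f (c n) = c n" for n using c K e ext unfolding parameters_def by metis
  have "(\<lambda>i. f (environment j c s i)) = environment (f j) c (\<lambda>n. f (s n))" for j
    by (auto simp: environment_def fc)
  moreover have "assignment (environment j c s)" if "j \<in> C" for j
    using that s c by (simp add: assignment_def environment_def parameters_def)
  moreover have "assignment (\<lambda>n. f (s n))" using s f by (simp add: assignment_def automorphism_in)
  ultimately show ?thesis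
    using p[OF s emptyset_in] p[of "\<lambda>n. f (s n)" "f emptyset"] sat_automorphism[OF f]
    by (metis automorphism_in emptyset_in f)
qed

end

section \<open>Elementary set theory\<close>

locale zfa = fo_structure V for V :: "'v universe" +
  assumes ZFA: "ZFA V"
begin

definition coded :: "'v set \<Rightarrow> bool" where
  "coded S \<longleftrightarrow> (\<exists>z. codes V z S)"

abbreviation Set :: "'v set \<Rightarrow> 'v" where "Set S \<equiv> the_set V S"

lemma is_set_ext: "is_set V x \<Longrightarrow> is_set V y \<Longrightarrow> E x = E y \<Longrightarrow> x = y"
  using ZFA unfolding ZFA_def by blast

lemma codes_unique: "codes V x S \<Longrightarrow> codes V y S \<Longrightarrow> x = y"
  unfolding codes_def using is_set_ext by blast

lemma the_set_eq: "codes V x S \<Longrightarrow> Set S = x"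
  unfolding the_set_def using codes_unique by blast

lemma codes_the_set: "coded S \<Longrightarrow> codes V (Set S) S"
  unfolding coded_def using the_set_eq by auto

lemma elts_the_set: "coded S \<Longrightarrow> E (Set S) = S"
  using codes_the_set by (simp add: codes_def)

lemma is_set_the_set: "coded S \<Longrightarrow> is_set V (Set S)"
  using codes_the_set by (simp add: codes_def)

lemma is_set_in: "is_set V x \<Longrightarrow> x \<in> C"
  by (simp add: is_set_def)

lemma the_set_in: "coded S \<Longrightarrow> Set S \<in> C"
  using is_set_the_set is_set_in by blast

lemma elts_in: "x \<in> E y \<Longrightarrow> x \<in> C"
  by (simp add: elts_def)

lemma coded_in: "coded S \<Longrightarrow> x \<in> S \<Longrightarrow> x \<in> C"
  unfolding coded_def codes_def using elts_in by blast

lemma codes_iff: "coded S \<Longrightarrow> codes V x S \<longleftrightarrow> x = Set S"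
  using codes_the_set the_set_eq by auto

lemma atom_elts: "a \<in> C \<Longrightarrow> atom V a \<Longrightarrow> E a = {}"
  using ZFA unfolding ZFA_def by blast

lemma separation_schema: "x \<in> C \<Longrightarrow> range s \<subseteq> C \<Longrightarrow> coded {y \<in> E x. sat V (s(0 := y)) p}"
  using ZFA unfolding ZFA_def coded_def by blast

lemma inductive_exists: "\<exists>w. is_inductive V w"
  using ZFA unfolding ZFA_def by blast

lemma carrier_nonempty: "\<exists>x. x \<in> C"
  using inductive_exists by (auto simp: is_inductive_def is_set_def)

lemma coded_empty: "coded {}"
proof -
  obtain x where "x \<in> C" using carrier_nonempty by blast
  then show ?thesis using separation_schema[of x "\<lambda>_. x" "FNeg (FEq 0 0)"] by auto
qed

end

sublocale zfa \<subseteq> inhabited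
  using coded_empty by unfold_locales (simp add: coded_def)

context zfa
begin

lemma the_set_empty: "Set {} = emptyset"
  using the_set_eq codes_emptyset by blast

lemma elts_empty [simp]: "E emptyset = {}"
  using codes_emptyset by (simp add: codes_def)

lemma zero_eq [simp]: "zero V = emptyset"
  by (simp add: zero_def the_set_empty)

lemma separation:
  assumes "D K (\<lambda>s. P (s 0))" "x \<in> C" shows "coded {y \<in> E x. P y}"
proof -
  obtain p c where c: "parameters K c"
    and p: "\<And>s j. assignment s \<Longrightarrow> j \<in> C \<Longrightarrow> P (s 0) \<longleftrightarrow> sat V (environment j c s) p"
    using assms(1) unfolding D_def by blast
  define s where "s = environment x c (\<lambda>_. x)"
  \<comment> \<open>The schema varies index 0, which is the scratch register. Variable 0, at index
    2, is therefore redirected there, and the scratch register reads index 1, that is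
    \<open>c 0\<close>.\<close>
  define f :: "nat \<Rightarrow> nat" where "f i = (if i = 2 then 0 else if i = 0 then 1 else i)" for i
  have "P y \<longleftrightarrow> sat V (s(0 := y)) (fm_rename p f)" if "y \<in> E x" for y
  proof -
    have "(\<lambda>n. (s(0 := y)) (f n)) = environment (c 0) c (case_nat y (\<lambda>_. x))"
      by (rule ext) (auto simp: s_def f_def environment_def elim!: evenE split: nat.splits)
    moreover have "c 0 \<in> C" using c by (simp add: parameters_def)
    ultimately show ?thesis
      using p[of "case_nat y (\<lambda>_. x)" "c 0"] that assms(2)
      by (auto simp: sat_fm_rename assignment_def elts_in split: nat.splits simp del: fun_upd_apply)
  qed
  then have "{y \<in> E x. P y} = {y \<in> E x. sat V (s(0 := y)) (fm_rename p f)}" by blast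
  then show ?thesis
    using separation_schema[OF assms(2), of s] c assms(2)
    by (auto simp: s_def environment_def parameters_def)
qed

lemma replacement:
  assumes t: "DT K (\<lambda>s. t (s 0))" and x: "x \<in> C" shows "coded (t ` E x)"
proof -
  have tC: "t u \<in> C" if "u \<in> C" for u
    using DT_in[OF t, of "\<lambda>_. u"] that by (simp add: assignment_def)
  have "D K (\<lambda>s. s 0 = t (s 1))" using t by (simp add: DT_def)
  then obtain p c where c: "parameters K c"
    and p: "\<And>s j. assignment s \<Longrightarrow> j \<in> C \<Longrightarrow> s 0 = t (s 1) \<longleftrightarrow> sat V (environment j c s) p"
    unfolding D_def by blast
  \<comment> \<open>The schema puts the argument at index 0 and the value at index 1, so the
    environment moves up by two. In \<open>p\<close> the value is variable 0 at index 2 and the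
    argument is variable 1 at index 4, which explains the two exceptions in
    \<open>f\<close>.\<close>
  define s where "s i = environment x c (\<lambda>_. x) (i - 2)" for i
  define f :: "nat \<Rightarrow> nat" where "f i = (if i = 2 then 1 else if i = 4 then 0 else i + 2)" for i
  have eq: "v = t u \<longleftrightarrow> sat V (s(0 := u, 1 := v)) (fm_rename p f)" if "u \<in> C" "v \<in> C" for u v
  proof -
    have "(\<lambda>n. (s(0 := u, 1 := v)) (f n)) = environment x c (case_nat v (case_nat u (\<lambda>_. x)))"
    proof
      fix i :: nat
      consider "i = 0" | "i = 2" | "i = 4" | k where "i = 2 * k + 6" | "odd i"
      proof (cases "odd i")
        case False
        then obtain k where k: "i = 2 * k" by (auto elim!: evenE)
        have "k = 0 \<or> k = 1 \<or> k = 2 \<or> (\<exists>l. k = l + 3)" by presburger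
        then consider "k = 0" | "k = 1" | "k = 2" | l where "k = l + 3" by blast
        then show thesis using that k by cases auto
      qed (use that in auto)
      then show "(s(0 := u, 1 := v)) (f i) = environment x c (case_nat v (case_nat u (\<lambda>_. x))) i"
        by cases (auto simp: s_def f_def environment_def)
    qed
    then show ?thesis
      using p[of "case_nat v (case_nat u (\<lambda>_. x))" x] that x
      by (auto simp: sat_fm_rename assignment_def split: nat.splits simp del: fun_upd_apply)
  qed
  have "range s \<subseteq> C" using c x by (auto simp: s_def environment_def parameters_def)
  moreover have "\<forall>u\<in>E x. \<exists>!v. v \<in> C \<and> sat V (s(0 := u, 1 := v)) (fm_rename p f)"
    using eq tC elts_in by (metis (no_types, lifting))
  ultimately have "coded {v \<in> C. \<exists>u\<in>E x. sat V (s(0 := u, 1 := v)) (fm_rename p f)}"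
    using ZFA x unfolding ZFA_def coded_def by blast
  moreover have "{v \<in> C. \<exists>u\<in>E x. sat V (s(0 := u, 1 := v)) (fm_rename p f)} = t ` E x"
    using tC by (auto simp: eq[symmetric] elts_in[of _ x] simp del: fun_upd_apply One_nat_def)
  ultimately show ?thesis by simp
qed

lemma coded_image: "DT K (\<lambda>s. t (s 0)) \<Longrightarrow> coded S \<Longrightarrow> coded (t ` S)"
  using replacement[of K t "Set S"] by (simp add: elts_the_set the_set_in)

lemma coded_elts: "x \<in> C \<Longrightarrow> coded (E x)"
  using separation[OF D_True, of x] by simp

lemma coded_Collect:
  assumes "coded S" "\<And>y. P y \<Longrightarrow> y \<in> S" "D K (\<lambda>s. P (s 0))" shows "coded {y. P y}"
proof -
  have "{y. P y} = {y \<in> E (Set S). P y}" using assms(1,2) by (auto simp: elts_the_set)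
  then show ?thesis using separation[OF assms(3) the_set_in[OF assms(1)]] by simp
qed

lemma coded_Int: "coded S \<Longrightarrow> coded T \<Longrightarrow> coded (S \<inter> T)"
proof -
  assume S: "coded S" and T: "coded T"
  have "D {Set T} (\<lambda>s. s 0 \<in> E (Set T))"
    by (intro D_elts DT_var DT_param) (simp_all add: T the_set_in)
  from separation[OF this the_set_in[OF S]] show ?thesis using S T by (simp add: elts_the_set Int_def)
qed

lemma coded_pair: "x \<in> C \<Longrightarrow> y \<in> C \<Longrightarrow> coded {x, y}"
  using ZFA unfolding ZFA_def coded_def by blast

lemma coded_singleton: "x \<in> C \<Longrightarrow> coded {x}"
  using coded_pair[of x x] by simp

lemma coded_Union: "x \<in> C \<Longrightarrow> coded (\<Union>y\<in>E x. E y)"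
  using ZFA unfolding ZFA_def coded_def by blast

lemma coded_Pow: "x \<in> C \<Longrightarrow> coded {y. is_set V y \<and> E y \<subseteq> E x}"
  using ZFA unfolding ZFA_def coded_def by blast

lemma coded_UN: "DT K (\<lambda>s. t (s 0)) \<Longrightarrow> coded S \<Longrightarrow> coded (\<Union>x\<in>S. E (t x))"
  using coded_Union[OF the_set_in[OF coded_image[of K t S]]]
  by (simp add: elts_the_set coded_image)

lemma coded_Un: "coded S \<Longrightarrow> coded T \<Longrightarrow> coded (S \<union> T)"
  using coded_Union[OF the_set_in[OF coded_pair[of "Set S" "Set T"]]]
  by (simp add: elts_the_set coded_pair the_set_in)

lemma coded_insert: "x \<in> C \<Longrightarrow> coded S \<Longrightarrow> coded (insert x S)"
  using coded_Un[of "{x}" S] coded_singleton[of x] by simp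

lemma foundation: "coded S \<Longrightarrow> S \<noteq> {} \<Longrightarrow> \<exists>y\<in>S. E y \<inter> S = {}"
proof -
  assume S: "coded S" "S \<noteq> {}"
  have "\<forall>x\<in>C. E x \<noteq> {} \<longrightarrow> (\<exists>y\<in>E x. E y \<inter> E x = {})"
    using ZFA unfolding ZFA_def by blast
  from this[rule_format, OF the_set_in[OF S(1)]] show ?thesis using S by (simp add: elts_the_set)
qed

lemma not_mem_self: "x \<notin> E x"
proof
  assume "x \<in> E x"
  then show False using foundation[of "{x}"] coded_singleton[of x] elts_in[of x x] by auto
qed

text \<open>By extensionality, being equal to \<open>Set S\<close> means coding \<open>S\<close>,
  and \<open>D_codes\<close> makes this definable as soon as membership in \<open>S\<close>
  is.\<close>

lemma DT_the_set:
  assumes "\<And>s. assignment s \<Longrightarrow> coded {y. Q s y}" "D K (\<lambda>s. Q (\<lambda>n. s (Suc n)) (s 0))"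
  shows "DT K (\<lambda>s. Set {y. Q s y})"
proof (rule DT_I)
  have "D K (\<lambda>s. Q (\<lambda>n. s (Suc (Suc n))) (s 0))"
    using D_rename[OF assms(2), of "case_nat 0 (\<lambda>n. Suc (Suc n))"] by simp
  then show "D K (\<lambda>s. codes V (s 0) {y. Q (\<lambda>n. s (Suc n)) y})"
    by (intro D_codes DT_var) (use assms(1) coded_in assignment_Suc in blast)+
qed (use assms(1) the_set_in codes_iff in auto)

lemma assignment_const: "assignment (\<lambda>_. x) \<longleftrightarrow> x \<in> C"
  by (simp add: assignment_def)

lemma assignment_case_nat_iff: "assignment (case_nat x s) \<longleftrightarrow> x \<in> C \<and> assignment s"
  unfolding assignment_def by (auto split: nat.splits)

definition upair :: "'v \<Rightarrow> 'v \<Rightarrow> 'v" where "upair x y = Set {x, y}"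

lemma elts_upair [simp]: "x \<in> C \<Longrightarrow> y \<in> C \<Longrightarrow> E (upair x y) = {x, y}"
  by (simp add: upair_def elts_the_set coded_pair)

lemma is_set_upair [simp]: "x \<in> C \<Longrightarrow> y \<in> C \<Longrightarrow> is_set V (upair x y)"
  by (simp add: upair_def is_set_the_set coded_pair)

lemma upair_in [simp]: "x \<in> C \<Longrightarrow> y \<in> C \<Longrightarrow> upair x y \<in> C"
  by (simp add: is_set_in)

lemma DT_upair: assumes "DT K t" "DT K u" shows "DT K (\<lambda>s. upair (t s) (u s))"
proof (rule DT_subst2[OF assms, of "{}"])
  have e: "{z. z = x \<or> z = y} = {x, y}" for x y :: 'v by auto
  have "DT {} (\<lambda>s. Set {y. y = s 0 \<or> y = s 1})"
  proof (rule DT_the_set)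
    show "coded {y. y = s 0 \<or> y = s 1}" if "assignment s" for s
      using coded_pair[of "s 0" "s 1"] that by (simp add: assignment_in e)
  qed (intro D_intros)
  then show "DT {} (\<lambda>s. upair (s 0) (s 1))" by (simp add: upair_def e)
qed simp

definition opair :: "'v \<Rightarrow> 'v \<Rightarrow> 'v" where "opair x y = upair (upair x x) (upair x y)"

lemma opair_in [simp]: "x \<in> C \<Longrightarrow> y \<in> C \<Longrightarrow> opair x y \<in> C"
  by (simp add: opair_def)

lemma elts_opair [simp]: "x \<in> C \<Longrightarrow> y \<in> C \<Longrightarrow> E (opair x y) = {upair x x, upair x y}"
  by (simp add: opair_def)

lemma is_set_opair [simp]: "x \<in> C \<Longrightarrow> y \<in> C \<Longrightarrow> is_set V (opair x y)"
  by (simp add: opair_def)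

lemma DT_opair: "DT K t \<Longrightarrow> DT K u \<Longrightarrow> DT K (\<lambda>s. opair (t s) (u s))"
  unfolding opair_def by (intro DT_upair)

lemma upair_eq: "x \<in> C \<Longrightarrow> y \<in> C \<Longrightarrow> a \<in> C \<Longrightarrow> b \<in> C \<Longrightarrow>
    upair x y = upair a b \<longleftrightarrow> (x = a \<and> y = b) \<or> (x = b \<and> y = a)"
  unfolding doubleton_eq_iff[symmetric] by (metis elts_upair upair_def)

lemma opair_eq [simp]: "x \<in> C \<Longrightarrow> y \<in> C \<Longrightarrow> a \<in> C \<Longrightarrow> b \<in> C \<Longrightarrow>
    opair x y = opair a b \<longleftrightarrow> x = a \<and> y = b"
  unfolding opair_def by (auto simp: upair_eq)

lemma is_pair_iff: "is_pair V p x y \<longleftrightarrow> x \<in> C \<and> y \<in> C \<and> p = opair x y"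
proof
  assume "is_pair V p x y"
  then obtain a b where ab: "codes V a {x}" "codes V b {x, y}" "codes V p {a, b}"
    unfolding is_pair_def by blast
  then have xy: "x \<in> C" "y \<in> C" using coded_in unfolding coded_def by blast+
  moreover have "a = upair x x" "b = upair x y"
    using ab the_set_eq by (auto simp: upair_def)
  ultimately show "x \<in> C \<and> y \<in> C \<and> p = opair x y"
    using ab the_set_eq by (auto simp: opair_def upair_def)
next
  assume "x \<in> C \<and> y \<in> C \<and> p = opair x y"
  then show "is_pair V p x y" unfolding is_pair_def
    by (intro exI[of _ "upair x x"] exI[of _ "upair x y"]) (simp add: codes_def)
qed

lemma rel_iff: "rel V f x y \<longleftrightarrow> x \<in> C \<and> y \<in> C \<and> opair x y \<in> E f"
  by (auto simp: rel_def is_pair_iff)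

lemma rel_in: "rel V f x y \<Longrightarrow> x \<in> C \<and> y \<in> C"
  by (simp add: rel_iff)

lemma D_is_pair: "DT K t \<Longrightarrow> DT K u \<Longrightarrow> DT K v \<Longrightarrow> D K (\<lambda>s. is_pair V (t s) (u s) (v s))"
  unfolding is_pair_iff by (intro D_intros DT_opair)

lemma D_rel: "DT K t \<Longrightarrow> DT K u \<Longrightarrow> DT K v \<Longrightarrow> D K (\<lambda>s. rel V (t s) (u s) (v s))"
  unfolding rel_iff by (intro D_intros DT_opair)

text \<open>Replacement in \<open>b\<close> yields a set for each \<open>a\<close>; these form a
  definable family, whose union over \<open>a\<close> exists. With \<open>t = opair\<close> the
  result is the Cartesian product.\<close>

lemma coded_UN2:
  assumes t: "DT K (\<lambda>s. t (s 0) (s 1))" and A: "A \<in> C" and B: "B \<in> C"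
  shows "coded {z. \<exists>a\<in>E A. \<exists>b\<in>E B. z = t a b}"
proof -
  have im: "coded {z. \<exists>b\<in>E B. z = t a b}" if a: "a \<in> C" for a
  proof -
    have "DT (insert a K) (\<lambda>s. t a (s 0))"
      by (rule DT_subst2[OF DT_param DT_var t]) (use a in auto)
    from replacement[OF this B] show ?thesis by (simp add: image_def)
  qed
  have t': "DT (insert B K) (\<lambda>s. t (s n) (s m))" for n m
    by (rule DT_subst2[OF DT_var DT_var t]) auto
  have "DT (insert B K) (\<lambda>s. Set {z. \<exists>b\<in>E B. z = t (s 0) b})"
  proof (rule DT_the_set)
    show "coded {z. \<exists>b\<in>E B. z = t (s 0) b}" if "assignment s" for s
      using im that by (simp add: assignment_in)
  qed (intro D_intros DT_param t', simp_all add: B)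
  from coded_UN[OF this coded_elts[OF A]]
  have "coded (\<Union>a\<in>E A. {z. \<exists>b\<in>E B. z = t a b})"
    using im elts_in by (simp add: elts_the_set cong: SUP_cong)
  moreover have "(\<Union>a\<in>E A. {z. \<exists>b\<in>E B. z = t a b}) = {z. \<exists>a\<in>E A. \<exists>b\<in>E B. z = t a b}" by blast
  ultimately show ?thesis by simp
qed

text \<open>Two unions strip the two layers of braces of a Kuratowski pair. The bound allows
  separation for domains, ranges and composites of an arbitrary object.\<close>

lemma coded_rel_fields:
  assumes f: "f \<in> C" shows "\<exists>u\<in>C. \<forall>x y. rel V f x y \<longrightarrow> x \<in> E u \<and> y \<in> E u"
proof -
  have 1: "coded (\<Union>y\<in>E f. E y)" using coded_Union[OF f] .
  have 2: "coded (\<Union>y\<in>E (Set (\<Union>y\<in>E f. E y)). E y)" using coded_Union[OF the_set_in[OF 1]] .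
  have "x \<in> E (Set (\<Union>y\<in>E (Set (\<Union>y\<in>E f. E y)). E y)) \<and>
      y \<in> E (Set (\<Union>y\<in>E (Set (\<Union>y\<in>E f. E y)). E y))" if "rel V f x y" for x y
  proof -
    have xy: "x \<in> C" "y \<in> C" and f: "opair x y \<in> E f" using that by (auto simp: rel_iff)
    then have "upair x y \<in> (\<Union>y\<in>E f. E y)" by (intro UN_I[OF f]) simp
    then have "upair x y \<in> E (Set (\<Union>y\<in>E f. E y))" by (simp only: elts_the_set[OF 1])
    then show ?thesis unfolding elts_the_set[OF 2] using xy by (auto intro!: bexI[of _ "upair x y"])
  qed
  then show ?thesis using the_set_in[OF 2] by blast
qed

section \<open>Functions\<close>

text \<open>A total form of \<open>app\<close>: where \<open>app\<close> would be an unspecified HOL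
  value, possibly outside the carrier, the default \<open>emptyset\<close> keeps the term
  definable.\<close>

definition ap :: "'v \<Rightarrow> 'v \<Rightarrow> 'v" where
  "ap f x = (if \<exists>!y. rel V f x y then THE y. rel V f x y else emptyset)"

lemma ap_in [simp]: "ap f x \<in> C"
proof (cases "\<exists>!y. rel V f x y")
  case True
  from rel_in[OF theI'[OF this]] show ?thesis using True by (simp add: ap_def)
qed (simp add: ap_def)

lemma ap_eq: "\<exists>!y. rel V f x y \<Longrightarrow> y = ap f x \<longleftrightarrow> rel V f x y"
  unfolding ap_def using theI'[of "rel V f x"] by auto

lemma DT_ap: assumes "DT K t" "DT K u" shows "DT K (\<lambda>s. ap (t s) (u s))"
proof (rule DT_subst2[OF assms, of "{}"])
  let ?Q = "\<lambda>s y. if \<exists>!y. rel V (s 0) (s 1) y then rel V (s 0) (s 1) y else (\<forall>z\<in>C. \<not> mem V z y) \<and> \<not> atom V y"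
  have e: "y = emptyset \<longleftrightarrow> (\<forall>z\<in>C. \<not> mem V z y) \<and> \<not> atom V y" if "y \<in> C" for y
    using codes_emptyset codes_unique[of emptyset "{}" y] that
    by (auto simp: codes_def is_set_def elts_def)
  show "DT {} (\<lambda>s. ap (s 0) (s 1))"
  proof (rule DT_I[where Q = ?Q])
    show "y = ap (s 0) (s 1) \<longleftrightarrow> ?Q s y" if "y \<in> C" for s y
      using ap_eq[of "s 0" "s 1" y] e[OF that] by (auto simp: ap_def)
    show "D {} (\<lambda>s. ?Q (\<lambda>n. s (Suc n)) (s 0))"
      by (intro D_if D_ex1_unbounded D_rel D_intros) (simp add: rel_iff)
  qed simp
qed simp

lemma app_eq_ap: "\<exists>!y. rel V f x y \<Longrightarrow> app V f x = ap f x"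
  by (simp add: app_def ap_def)

definition lam :: "'v \<Rightarrow> ('v \<Rightarrow> 'v) \<Rightarrow> 'v" where
  "lam X t = Set ((\<lambda>x. opair x (t x)) ` E X)"

lemma function_rel: "is_function V f X Y \<Longrightarrow> rel V f x y \<Longrightarrow> x \<in> E X \<and> y \<in> E Y"
  unfolding is_function_def is_relation_def by (force simp: rel_iff is_pair_iff elts_in)

lemma function_rel_iff:
  assumes f: "is_function V f X Y" shows "rel V f x y \<longleftrightarrow> x \<in> E X \<and> y = ap f x"
proof (cases "x \<in> E X")
  case True
  then have "\<exists>!y. rel V f x y" using f by (simp add: is_function_def)
  then show ?thesis using ap_eq True by blast
qed (use function_rel[OF f] in blast)

lemma function_ap: "is_function V f X Y \<Longrightarrow> x \<in> E X \<Longrightarrow> ap f x \<in> E Y"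
  using function_rel_iff function_rel by blast

lemma function_app: "is_function V f X Y \<Longrightarrow> x \<in> E X \<Longrightarrow> app V f x = ap f x"
  using app_eq_ap unfolding is_function_def by blast

lemma function_elts: "is_function V f X Y \<Longrightarrow> E f = (\<lambda>x. opair x (ap f x)) ` E X"
proof -
  assume f: "is_function V f X Y"
  have "p \<in> (\<lambda>x. opair x (ap f x)) ` E X" if "p \<in> E f" for p
  proof -
    have "\<exists>x\<in>E X. \<exists>y\<in>E Y. is_pair V p x y"
      using f that by (simp add: is_function_def is_relation_def)
    then obtain x y where "x \<in> E X" "y \<in> E Y" "p = opair x y" by (auto simp: is_pair_iff)
    then show ?thesis using function_rel_iff[OF f, of x y] that by (auto simp: rel_iff elts_in)
  qed
  moreover have "opair x (ap f x) \<in> E f" if "x \<in> E X" for x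
    using function_rel_iff[OF f, of x "ap f x"] that by (auto simp: rel_iff)
  ultimately show ?thesis by blast
qed

lemma function_ext:
  assumes "is_function V f X Y" "is_function V g X Z" "\<And>x. x \<in> E X \<Longrightarrow> ap f x = ap g x"
  shows "f = g"
proof (rule is_set_ext)
  show "E f = E g" using assms by (simp add: function_elts)
qed (use assms in \<open>simp_all add: is_function_def is_relation_def\<close>)

context
  fixes K t X
  assumes t: "DT K (\<lambda>s. t (s 0))" and X: "X \<in> C"
begin

lemma term_in: "x \<in> C \<Longrightarrow> t x \<in> C"
  using DT_in[OF t, of "\<lambda>_. x"] by (simp add: assignment_const)

lemma coded_lam: "coded ((\<lambda>x. opair x (t x)) ` E X)"
  by (rule replacement[OF DT_opair[OF DT_var t] X])

lemma rel_lam: "rel V (lam X t) x y \<longleftrightarrow> x \<in> E X \<and> y = t x"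
  using elts_in by (auto simp: rel_iff lam_def elts_the_set[OF coded_lam] term_in)

lemma ap_lam: "x \<in> E X \<Longrightarrow> ap (lam X t) x = t x"
  using ap_eq[of "lam X t" x "t x"] by (simp add: rel_lam)

lemma function_lam:
  assumes "\<And>x. x \<in> E X \<Longrightarrow> t x \<in> E Y" shows "is_function V (lam X t) X Y"
  unfolding is_function_def is_relation_def rel_lam
  using assms elts_in
  by (auto simp: lam_def elts_the_set[OF coded_lam] is_set_the_set[OF coded_lam] is_pair_iff)

end

section \<open>Natural numbers\<close>

lemma DT_emptyset: "DT K (\<lambda>s. emptyset)"
proof -
  have "DT K (\<lambda>s. Set {y. False})" by (rule DT_the_set) (simp_all add: coded_empty D_False)
  then show ?thesis by (simp add: the_set_empty)
qed

lemma elts_succ [simp]: "n \<in> C \<Longrightarrow> E (succ V n) = insert n (E n)"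
  by (simp add: succ_def elts_the_set coded_insert coded_elts)

lemma is_set_succ [simp]: "n \<in> C \<Longrightarrow> is_set V (succ V n)"
  by (simp add: succ_def is_set_the_set coded_insert coded_elts)

lemma succ_in [simp]: "n \<in> C \<Longrightarrow> succ V n \<in> C"
  by (simp add: is_set_in)

lemma codes_succ: "n \<in> C \<Longrightarrow> codes V m (insert n (E n)) \<longleftrightarrow> m = succ V n"
  by (simp add: codes_iff coded_insert coded_elts succ_def)

lemma DT_succ: assumes "DT K t" shows "DT K (\<lambda>s. succ V (t s))"
proof (rule DT_subst1[OF assms, of "{}"])
  have e: "{y. y = n \<or> y \<in> E n} = insert n (E n)" for n by auto
  have "DT {} (\<lambda>s. Set {y. y = s 0 \<or> y \<in> E (s 0)})"
  proof (rule DT_the_set)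
    show "coded {y. y = s 0 \<or> y \<in> E (s 0)}" if "assignment s" for s
      using that by (simp add: e coded_insert coded_elts assignment_in)
  qed (intro D_intros)
  then show "DT {} (\<lambda>s. succ V (s 0))" by (simp add: e succ_def)
qed simp

lemma is_inductive_iff:
  "is_inductive V w \<longleftrightarrow> is_set V w \<and> emptyset \<in> E w \<and> (\<forall>x\<in>E w. succ V x \<in> E w)"
  unfolding is_inductive_def using codes_iff[OF coded_empty] the_set_empty
  by (auto simp: codes_succ elts_in)

lemma D_is_inductive: assumes t: "DT K t" shows "D K (\<lambda>s. is_inductive V (t s))"
  unfolding is_inductive_iff by (intro D_intros t DT_emptyset DT_succ DT_shift)

text \<open>The intersection of all inductive sets is separated from any one of them.\<close>

lemma is_omega_exists: "\<exists>w. is_omega V w"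
proof -
  obtain w where w: "is_inductive V w" using inductive_exists by blast
  define S where "S = {n \<in> E w. \<forall>v. is_inductive V v \<longrightarrow> n \<in> E v}"
  have S: "coded S" unfolding S_def
    by (rule separation[of "{}"])
      (intro D_all_unbounded D_intros D_is_inductive, use w in \<open>auto simp: is_inductive_def is_set_def\<close>)
  have "emptyset \<in> S" "\<forall>x\<in>S. succ V x \<in> S"
    unfolding S_def using w is_inductive_iff by blast+
  then have "is_inductive V (Set S)"
    by (simp add: is_inductive_iff elts_the_set[OF S] is_set_the_set[OF S])
  moreover have "E (Set S) \<subseteq> E v" if "is_inductive V v" for v
    unfolding elts_the_set[OF S] using that unfolding S_def by blast
  ultimately show ?thesis unfolding is_omega_def by blast
qed

lemma is_omega_iff: "is_omega V w \<longleftrightarrow> w = omega V"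
proof -
  have u: "v = w" if "is_omega V v" "is_omega V w" for v w
    by (rule is_set_ext) (use that in \<open>auto simp: is_omega_def is_inductive_def\<close>)
  obtain v where v: "is_omega V v" using is_omega_exists by blast
  then have "omega V = v" unfolding omega_def using u by blast
  then show ?thesis using u v by blast
qed

abbreviation \<omega> :: 'v where "\<omega> \<equiv> omega V"

lemma omega_inductive: "is_inductive V \<omega>"
  using is_omega_iff[of \<omega>] by (simp add: is_omega_def)

lemma omega_subset: "is_inductive V v \<Longrightarrow> E \<omega> \<subseteq> E v"
  using is_omega_iff[of \<omega>] by (simp add: is_omega_def)

lemma is_set_omega [simp]: "is_set V \<omega>"
  and zero_in_omega [simp]: "emptyset \<in> E \<omega>"
  and succ_in_omega [simp]: "n \<in> E \<omega> \<Longrightarrow> succ V n \<in> E \<omega>"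
  using omega_inductive by (simp_all add: is_inductive_iff)

lemma omega_in [simp]: "\<omega> \<in> C"
  by (simp add: is_set_in)

lemma D_is_omega: assumes t: "DT K t" shows "D K (\<lambda>s. is_omega V (t s))"
proof -
  have "D K (\<lambda>s. is_inductive V (t s) \<and>
      (\<forall>v. is_inductive V v \<longrightarrow> (\<forall>x\<in>C. x \<in> E (t s) \<longrightarrow> x \<in> E v)))"
    by (intro D_all_unbounded D_intros D_is_inductive t DT_shift)
      (auto simp: is_inductive_def is_set_def)
  then show ?thesis
    by (rule D_cong[rotated]) (use elts_in in \<open>auto simp: is_omega_def subset_iff\<close>)
qed

lemma DT_omega: "DT K (\<lambda>s. \<omega>)"
  by (rule DT_I[of _ "\<lambda>s. is_omega V"]) (simp_all add: is_omega_iff D_is_omega[OF DT_var, unfolded is_omega_iff])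

text \<open>The numbers satisfying \<open>P\<close> form an inductive set, which exists only because
  \<open>P\<close> is definable.\<close>

lemma omega_induct:
  assumes n: "n \<in> E \<omega>" and P: "D K (\<lambda>s. P (s 0))" and 0: "P emptyset"
    and S: "\<And>n. n \<in> E \<omega> \<Longrightarrow> P n \<Longrightarrow> P (succ V n)"
  shows "P n"
proof -
  have c: "coded {n \<in> E \<omega>. P n}" using separation[OF P omega_in] .
  have "is_inductive V (Set {n \<in> E \<omega>. P n})"
    unfolding is_inductive_iff using 0 S by (auto simp: elts_the_set[OF c] is_set_the_set[OF c])
  from omega_subset[OF this] show ?thesis using n by (auto simp: elts_the_set[OF c])
qed

lemma omega_elts_subset: "n \<in> E \<omega> \<Longrightarrow> E n \<subseteq> E \<omega>"
proof -
  assume n: "n \<in> E \<omega>"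
  have "\<forall>m\<in>E n. m \<in> E \<omega>"
    by (rule omega_induct[OF n, of "{}"]) (auto intro!: D_ball D_elts DT_var DT_omega simp: elts_in)
  then show ?thesis by blast
qed

lemma omega_mem: "m \<in> E n \<Longrightarrow> n \<in> E \<omega> \<Longrightarrow> m \<in> E \<omega>"
  using omega_elts_subset by blast

lemma nat_transitive: "n \<in> E \<omega> \<Longrightarrow> m \<in> E n \<Longrightarrow> E m \<subseteq> E n"
proof -
  assume n: "n \<in> E \<omega>" and m: "m \<in> E n"
  have "\<forall>m\<in>E n. \<forall>k\<in>E m. k \<in> E n"
    by (rule omega_induct[OF n, of "{}"]) (auto intro!: D_ball D_elts DT_var simp: elts_in)
  then show ?thesis using m by blast
qed

lemma nat_cases: "n \<in> E \<omega> \<Longrightarrow> n = emptyset \<or> (\<exists>m\<in>E \<omega>. n = succ V m)"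
  by (rule omega_induct[of n "{}"]) (auto intro!: D_disj D_bex D_eq DT_var DT_omega DT_succ DT_emptyset)

lemma nat_is_set: "n \<in> E \<omega> \<Longrightarrow> is_set V n"
  using nat_cases[of n] codes_emptyset by (auto simp: codes_def elts_in)

lemma zero_mem_succ: "n \<in> E \<omega> \<Longrightarrow> emptyset \<in> E (succ V n)"
  by (rule omega_induct[of n "{}"]) (auto intro!: D_elts DT_var DT_succ DT_emptyset simp: elts_in)

lemma succ_mem_succ: "n \<in> E \<omega> \<Longrightarrow> m \<in> E n \<Longrightarrow> succ V m \<in> E (succ V n)"
proof -
  assume n: "n \<in> E \<omega>" and m: "m \<in> E n"
  have "\<forall>m\<in>E n. succ V m \<in> E (succ V n)"
    by (rule omega_induct[OF n, of "{}"]) (auto intro!: D_ball D_elts DT_succ DT_var simp: elts_in)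
  then show ?thesis using m by blast
qed

lemma nat_trichotomy: "m \<in> E \<omega> \<Longrightarrow> n \<in> E \<omega> \<Longrightarrow> m \<in> E n \<or> m = n \<or> n \<in> E m"
proof -
  assume m: "m \<in> E \<omega>" and n: "n \<in> E \<omega>"
  show ?thesis
  proof (rule omega_induct[OF m, of "{n}"])
    show "D {n} (\<lambda>s. s 0 \<in> E n \<or> s 0 = n \<or> n \<in> E (s 0))"
      by (intro D_intros DT_param) (use n elts_in in auto)
    show "emptyset \<in> E n \<or> emptyset = n \<or> n \<in> E emptyset"
      using nat_cases[OF n] zero_mem_succ by auto
    show "succ V m \<in> E n \<or> succ V m = n \<or> n \<in> E (succ V m)"
      if m: "m \<in> E \<omega>" and IH: "m \<in> E n \<or> m = n \<or> n \<in> E m" for m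
      using IH
    proof (elim disjE)
      assume mn: "m \<in> E n"
      then obtain k where k: "k \<in> E \<omega>" "n = succ V k" using nat_cases[OF n] by auto
      then have "m = k \<or> m \<in> E k" using mn by (auto simp: elts_in)
      then show ?thesis using succ_mem_succ[OF k(1), of m] k by auto
    qed (use m in \<open>auto simp: elts_in\<close>)
  qed
qed

section \<open>Recursion on membership\<close>

definition image_on :: "'v \<Rightarrow> 'v \<Rightarrow> 'v" where
  "image_on f x = Set {v. \<exists>u\<in>E x. rel V f u v}"

lemma coded_image_on:
  assumes f: "f \<in> C" and x: "x \<in> C" shows "coded {v. \<exists>u\<in>E x. rel V f u v}"
proof -
  obtain a where a: "a \<in> C" "\<And>x y. rel V f x y \<Longrightarrow> y \<in> E a" using coded_rel_fields[OF f] by blast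
  show ?thesis
    by (rule coded_Collect[OF coded_elts[OF a(1)], of _ "{f, x}"])
      (use a f x in \<open>auto intro!: D_bex D_rel DT_var DT_param\<close>)
qed

lemma DT_image_on: assumes "DT K t" "DT K u" shows "DT K (\<lambda>s. image_on (t s) (u s))"
proof (rule DT_subst2[OF assms, of "{}"])
  show "DT {} (\<lambda>s. image_on (s 0) (s 1))" unfolding image_on_def
  proof (rule DT_the_set)
    show "coded {v. \<exists>u\<in>E (s 1). rel V (s 0) u v}" if "assignment s" for s
      by (rule coded_image_on) (simp_all add: assignment_in that)
  qed (intro D_intros D_rel)
qed simp

context
  fixes \<Gamma> :: "'v \<Rightarrow> 'v \<Rightarrow> 'v \<Rightarrow> 'v" and K :: "'v set"
  assumes \<Gamma>: "DT K (\<lambda>s. \<Gamma> (s 0) (s 1) (s 2))"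
begin

text \<open>The scheme is recursion on membership: \<open>\<Gamma> p x z\<close> gives the value at
  \<open>x\<close> from a parameter \<open>p\<close> and the set \<open>z\<close> of the values at
  the elements of \<open>x\<close>.\<close>

definition approx :: "'v \<Rightarrow> 'v \<Rightarrow> bool" where
  "approx p f \<longleftrightarrow> is_set V f \<and> (\<forall>r\<in>E f. \<exists>x y. is_pair V r x y) \<and>
     (\<forall>x y z. rel V f x y \<and> rel V f x z \<longrightarrow> y = z) \<and>
     (\<forall>x y. rel V f x y \<longrightarrow> (\<forall>u\<in>E x. \<exists>v. rel V f u v) \<and> y = \<Gamma> p x (image_on f x))"

definition rec :: "'v \<Rightarrow> 'v \<Rightarrow> 'v" where
  "rec p x = (if \<exists>f y. approx p f \<and> rel V f x y then THE y. \<exists>f. approx p f \<and> rel V f x y else emptyset)"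

abbreviation good :: "'v \<Rightarrow> 'v \<Rightarrow> bool" where
  "good p x \<equiv> \<exists>f y. approx p f \<and> rel V f x y"

lemma \<Gamma>_in: "p \<in> C \<Longrightarrow> x \<in> C \<Longrightarrow> z \<in> C \<Longrightarrow> \<Gamma> p x z \<in> C"
  using DT_in[OF \<Gamma>, of "case_nat p (case_nat x (\<lambda>_. z))"]
  by (simp add: assignment_case_nat_iff assignment_const numeral_2_eq_2)

lemma DT_\<Gamma>: "DT L t \<Longrightarrow> DT L u \<Longrightarrow> DT L v \<Longrightarrow> K \<subseteq> L \<Longrightarrow> DT L (\<lambda>s. \<Gamma> (t s) (u s) (v s))"
  by (rule DT_subst3[OF _ _ _ \<Gamma>]) simp_all

lemma approx_in: "approx p f \<Longrightarrow> f \<in> C"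
  by (simp add: approx_def is_set_def)

lemma D_approx:
  assumes "DT L t" "DT L u" "K \<subseteq> L" shows "D L (\<lambda>s. approx (t s) (u s))"
proof (rule D_subst2[OF assms(1,2) _ assms(3)])
  show "D K (\<lambda>s. approx (s 0) (s 1))" unfolding approx_def
    by (intro D_all_unbounded D_ex_unbounded D_intros D_rel D_is_pair DT_\<Gamma> DT_image_on)
      (auto simp: rel_iff is_pair_iff)
qed

text \<open>Foundation applies to the set of places where \<open>f\<close> and \<open>g\<close>
  disagree: at a minimal one the values on the elements agree, hence so does the result of
  \<open>\<Gamma>\<close>.\<close>

lemma approx_coherent:
  assumes f: "approx p f" and g: "approx p g" and "rel V f x v" "rel V g x w"
  shows "v = w"
proof (rule ccontr)
  let ?P = "\<lambda>u. \<exists>v w. rel V f u v \<and> rel V g u w \<and> v \<noteq> w"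
  assume "v \<noteq> w"
  then have x: "?P x" using assms by blast
  obtain a where a: "a \<in> C" "\<And>x y. rel V f x y \<Longrightarrow> x \<in> E a"
    using coded_rel_fields[OF approx_in[OF f]] by blast
  have "D {f, g} (\<lambda>s. ?P (s 0))"
    by (intro D_ex_unbounded D_intros D_rel DT_param) (auto simp: rel_iff approx_in[OF f] approx_in[OF g])
  then have "coded {u. ?P u}"
    by (rule coded_Collect[OF coded_elts[OF a(1)], rotated]) (use a in blast)
  from foundation[OF this] x obtain u where u: "?P u" and min: "\<And>y. y \<in> E u \<Longrightarrow> \<not> ?P y" by blast
  then obtain v w where vw: "rel V f u v" "rel V g u w" "v \<noteq> w" by blast
  have "\<exists>v. rel V f y v" "\<exists>v. rel V g y v" if "y \<in> E u" for y
    using f g vw that unfolding approx_def by blast+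
  then have "(\<exists>y\<in>E u. rel V f y z) = (\<exists>y\<in>E u. rel V g y z)" for z
    using min by metis
  then have "image_on f u = image_on g u" by (simp add: image_on_def)
  then show False using f g vw unfolding approx_def by metis
qed

lemma approx_rec: assumes "approx p f" "rel V f x y" shows "y = rec p x"
proof -
  have "(THE y. \<exists>f. approx p f \<and> rel V f x y) = y"
    by (rule the_equality) (use assms approx_coherent in blast)+
  then show ?thesis unfolding rec_def using assms by auto
qed

lemma rec_in [simp]: "rec p x \<in> C"
proof (cases "good p x")
  case True then show ?thesis using approx_rec rel_in by metis
qed (auto simp: rec_def)

lemma DT_rec:
  assumes "DT L t" "DT L u" "K \<subseteq> L" shows "DT L (\<lambda>s. rec (t s) (u s))"
proof (rule DT_subst2[OF assms(1,2) _ assms(3)])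
  show "DT K (\<lambda>s. rec (s 0) (s 1))"
  proof (rule DT_I)
    let ?Q = "\<lambda>s y. (\<exists>f\<in>C. approx (s 0) f \<and> rel V f (s 1) y) \<or>
      \<not> (\<exists>f\<in>C. \<exists>y\<in>C. approx (s 0) f \<and> rel V f (s 1) y) \<and> y = emptyset"
    show "D K (\<lambda>s. ?Q (\<lambda>n. s (Suc n)) (s 0))"
      by (intro D_intros D_approx D_rel DT_emptyset subset_refl)
    show "y = rec (s 0) (s 1) \<longleftrightarrow> ?Q s y" if "assignment s" "y \<in> C" for s y
    proof (cases "good (s 0) (s 1)")
      case True
      then obtain f z where fz: "approx (s 0) f" "rel V f (s 1) z" by blast
      then have "z = rec (s 0) (s 1)" "f \<in> C" "z \<in> C" using approx_rec approx_in rel_in by blast+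
      then show ?thesis using fz approx_rec by blast
    next
      case False
      then show ?thesis by (auto simp: rec_def)
    qed
  qed simp
qed

lemma coded_rec_image: "p \<in> C \<Longrightarrow> x \<in> C \<Longrightarrow> coded (rec p ` E x)"
  by (rule replacement[of "insert p K"]) (auto intro!: DT_rec DT_param DT_var)

lemma good_unfold:
  assumes "good p x"
  shows "rec p x = \<Gamma> p x (Set (rec p ` E x))" and "y \<in> E x \<Longrightarrow> good p y"
proof -
  obtain f y where f: "approx p f" and y: "rel V f x y" using assms by blast
  then have dom: "\<exists>v. rel V f u v" if "u \<in> E x" for u using that unfolding approx_def by blast
  then show "good p y" if "y \<in> E x" for y using f that by blast
  have "rel V f u v \<longleftrightarrow> v = rec p u" if "u \<in> E x" for u v
    using dom[OF that] approx_rec[OF f] by blast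
  then have "{v. \<exists>u\<in>E x. rel V f u v} = rec p ` E x" by auto
  then have "image_on f x = Set (rec p ` E x)" by (simp add: image_on_def)
  moreover have "y = \<Gamma> p x (image_on f x)" using f y unfolding approx_def by blast
  ultimately show "rec p x = \<Gamma> p x (Set (rec p ` E x))"
    using approx_rec[OF f y] by simp
qed

text \<open>Stated for a transitive set given in advance, because transitive supersets are
  themselves constructed by recursion, along \<omega>, which is transitive.\<close>

lemma transitive_good:
  assumes p: "p \<in> C" and d: "coded d" and trans: "\<And>u. u \<in> d \<Longrightarrow> E u \<subseteq> d" and x: "x \<in> d"
  shows "good p x"
proof (rule ccontr)
  assume nx: "\<not> good p x"
  have good: "D (insert p K) (\<lambda>s. good p (s n))" for n
    by (intro D_ex_unbounded D_intros D_rel D_approx DT_param) (auto simp: p rel_iff approx_in)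
  have "coded {u \<in> E (Set d). \<not> good p u}"
    by (rule separation[OF D_not[OF good] the_set_in[OF d]])
  then have "coded {u \<in> d. \<not> good p u}" by (simp add: elts_the_set d)
  from foundation[OF this] nx x obtain u where u: "u \<in> d" "\<not> good p u"
    and min: "\<And>y. y \<in> E u \<Longrightarrow> y \<in> d \<Longrightarrow> good p y" by blast
  have "coded {u \<in> E (Set d). good p u}"
    by (rule separation[OF good the_set_in[OF d]])
  then have cd: "coded (insert u {u \<in> d. good p u})"
    using coded_insert coded_in[OF d u(1)] by (simp add: elts_the_set d)
  \<comment> \<open>By minimality of \<open>u\<close> this set is closed under elements, so it can
    be the domain of an approximation that reaches \<open>u\<close>.\<close>
  define d' where "d' = Set (insert u {u \<in> d. good p u})"
  have d': "E d' = insert u {u \<in> d. good p u}" "d' \<in> C"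
    using cd by (simp_all add: d'_def elts_the_set the_set_in)
  \<comment> \<open>\<open>rec p\<close> itself cannot be tabulated: at \<open>u\<close> it only has
    its default value. One application of \<open>\<Gamma>\<close> gives the right value there and
    agrees with \<open>rec p\<close> at good places.\<close>
  define t where "t y = \<Gamma> p y (Set {v. \<exists>z\<in>E y. v = rec p z})" for y
  have e: "{v. \<exists>z\<in>E y. v = rec p z} = rec p ` E y" for y by auto
  have "DT (insert p K) (\<lambda>s. Set {v. \<exists>z\<in>E (s 0). v = rec p z})"
  proof (rule DT_the_set)
    show "coded {v. \<exists>z\<in>E (s 0). v = rec p z}" if "assignment s" for s
      using coded_rec_image[OF p] that by (simp add: e assignment_in)
  qed (intro D_intros DT_param DT_rec, auto simp: p)
  then have t: "DT (insert p K) (\<lambda>s. t (s 0))" unfolding t_def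
    by (intro DT_\<Gamma> DT_param DT_var) (auto simp: p)
  have t_good: "t y = rec p y" if "good p y" for y
    using good_unfold(1)[OF that] by (simp add: t_def e)
  have cl: "z \<in> E d' \<and> good p z" if "y \<in> E d'" "z \<in> E y" for y z
  proof -
    have y: "y = u \<or> y \<in> d \<and> good p y" using that(1) unfolding d'(1) by blast
    then have z: "z \<in> d" using trans[of y] u(1) that(2) by auto
    have "good p z"
    proof (cases "y = u")
      case True then show ?thesis using min z that(2) by blast
    next
      case False then show ?thesis using y good_unfold(2)[OF _ that(2)] by blast
    qed
    then show ?thesis using z unfolding d'(1) by blast
  qed
  have rel: "rel V (lam d' t) y z \<longleftrightarrow> y \<in> E d' \<and> z = t y" for y z
    by (rule rel_lam[OF t d'(2)])
  have "image_on (lam d' t) y = Set (rec p ` E y)" if "y \<in> E d'" for y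
  proof -
    have "{v. \<exists>u\<in>E y. rel V (lam d' t) u v} = rec p ` E y"
      using cl[OF that] t_good by (auto simp: rel)
    then show ?thesis by (simp add: image_on_def)
  qed
  then have im: "t y = \<Gamma> p y (image_on (lam d' t) y)" if "y \<in> E d'" for y
    using that by (simp add: t_def e)
  have "is_function V (lam d' t) d' (Set (t ` E d'))"
    by (rule function_lam[OF t d'(2)]) (simp add: elts_the_set replacement[OF t d'(2)])
  then have "is_set V (lam d' t)" "\<forall>r\<in>E (lam d' t). \<exists>x y. is_pair V r x y"
    unfolding is_function_def is_relation_def by blast+
  then have "approx p (lam d' t)"
    unfolding approx_def rel using cl im by blast
  then show False using u rel[of u "t u"] d' by blast
qed

end

section \<open>Transitive supersets and induction on membership\<close>

definition closure_step :: "'v \<Rightarrow> 'v \<Rightarrow> 'v \<Rightarrow> 'v" where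
  "closure_step p n z = Set {v. v \<in> E p \<or> (\<exists>w\<in>E z. \<exists>u\<in>E w. v \<in> E u)}"

lemma coded_UN_UN: assumes z: "z \<in> C" shows "coded {v. \<exists>w\<in>E z. \<exists>u\<in>E w. v \<in> E u}"
proof -
  have "coded (\<Union>u\<in>(\<Union>w\<in>E z. E w). E u)"
    using coded_Union[OF the_set_in[OF coded_Union[OF z]]] by (simp only: elts_the_set[OF coded_Union[OF z]])
  moreover have "(\<Union>u\<in>(\<Union>w\<in>E z. E w). E u) = {v. \<exists>w\<in>E z. \<exists>u\<in>E w. v \<in> E u}" by auto
  ultimately show ?thesis by simp
qed

lemma coded_closure_step:
  "p \<in> C \<Longrightarrow> z \<in> C \<Longrightarrow> coded {v. v \<in> E p \<or> (\<exists>w\<in>E z. \<exists>u\<in>E w. v \<in> E u)}"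
  using coded_Un[OF coded_elts coded_UN_UN] by (simp add: Un_def)

lemma elts_closure_step: "p \<in> C \<Longrightarrow> z \<in> C \<Longrightarrow>
    E (closure_step p n z) = {v. v \<in> E p \<or> (\<exists>w\<in>E z. \<exists>u\<in>E w. v \<in> E u)}"
  by (simp add: closure_step_def elts_the_set coded_closure_step)

lemma DT_closure_step: "DT {} (\<lambda>s. closure_step (s 0) (s 1) (s 2))"
  unfolding closure_step_def
  by (rule DT_the_set) (simp add: coded_closure_step assignment_in, intro D_intros)

text \<open>The recursion value at a number \<open>n\<close> consists of the elements of
  \<open>x\<close> and the elements of elements of the values at smaller numbers. The union of all
  these values over \<omega>, together with \<open>x\<close>, is transitive.\<close>

lemma transitive_superset:
  assumes x: "x \<in> C"
  obtains t where "t \<in> C" "x \<in> E t" "\<And>u. u \<in> E t \<Longrightarrow> E u \<subseteq> E t"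
proof -
  let ?r = "rec closure_step x"
  note DT_rec' = DT_rec[OF DT_closure_step]
  have unfold: "?r n = closure_step x n (Set (?r ` E n))" if "n \<in> E \<omega>" for n
    by (rule good_unfold(1)[OF DT_closure_step],
        rule transitive_good[OF DT_closure_step x coded_elts[OF omega_in] omega_elts_subset that])
  have r: "E (?r n) = {v. v \<in> E x \<or> (\<exists>m\<in>E n. \<exists>u\<in>E (?r m). v \<in> E u)}" if "n \<in> E \<omega>" for n
    using coded_rec_image[OF DT_closure_step x, of n]
    by (simp add: unfold[OF that] elts_closure_step x the_set_in elts_in[OF that] elts_the_set)
  have c: "coded (\<Union>n\<in>E \<omega>. E (?r n))"
    by (rule coded_UN[of "{x}"]) (auto intro!: DT_rec' DT_param DT_var coded_elts simp: x)
  define t where "t = Set (insert x (\<Union>n\<in>E \<omega>. E (?r n)))"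
  have t: "t \<in> C" "E t = insert x (\<Union>n\<in>E \<omega>. E (?r n))"
    unfolding t_def using elts_the_set the_set_in coded_insert[OF x c] by auto
  have "E u \<subseteq> E t" if u: "u \<in> E t" for u
  proof (cases "u = x")
    case True
    then show ?thesis using r[OF zero_in_omega] zero_in_omega unfolding t(2) by blast
  next
    case False
    then obtain n where n: "n \<in> E \<omega>" "u \<in> E (?r n)" using u unfolding t(2) by blast
    then have "E u \<subseteq> E (?r (succ V n))" unfolding r[OF succ_in_omega[OF n(1)]]
      by (auto simp: elts_in)
    then show ?thesis using n succ_in_omega unfolding t(2) by blast
  qed
  then show thesis using that t by blast
qed

text \<open>A transitive set containing \<open>x\<close> makes the counterexamples inside it a set,
  and an \<in>-minimal one contradicts \<open>step\<close>.\<close>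

lemma mem_induct:
  assumes x: "x \<in> C" and P: "D K (\<lambda>s. P (s 0))"
    and step: "\<And>x. x \<in> C \<Longrightarrow> (\<And>y. y \<in> E x \<Longrightarrow> P y) \<Longrightarrow> P x"
  shows "P x"
proof (rule ccontr)
  assume nP: "\<not> P x"
  obtain t where t: "t \<in> C" "x \<in> E t" "\<And>u. u \<in> E t \<Longrightarrow> E u \<subseteq> E t"
    by (rule transitive_superset[OF x]) blast
  have "coded {u \<in> E t. \<not> P u}" by (rule separation[OF D_not[OF P] t(1)])
  from foundation[OF this] nP t obtain u where "u \<in> E t" "\<not> P u" "\<And>y. y \<in> E u \<Longrightarrow> P y" by blast
  then show False using step elts_in by blast
qed

lemma rec_good:
  assumes \<Gamma>: "DT K (\<lambda>s. \<Gamma> (s 0) (s 1) (s 2))" and p: "p \<in> C" and x: "x \<in> C"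
  shows "\<exists>f y. approx \<Gamma> p f \<and> rel V f x y"
proof -
  obtain t where t: "t \<in> C" "x \<in> E t" "\<And>u. u \<in> E t \<Longrightarrow> E u \<subseteq> E t"
    by (rule transitive_superset[OF x]) blast
  show ?thesis by (rule transitive_good[OF \<Gamma> p coded_elts[OF t(1)] t(3,2)])
qed

lemma rec_unfold:
  assumes \<Gamma>: "DT K (\<lambda>s. \<Gamma> (s 0) (s 1) (s 2))" and "p \<in> C" "x \<in> C"
  shows "rec \<Gamma> p x = \<Gamma> p x (Set (rec \<Gamma> p ` E x))"
  by (rule good_unfold(1)[OF \<Gamma> rec_good[OF assms]])

section \<open>The cumulative hierarchy and collection\<close>

text \<open>The level of \<open>x\<close> consists of the atoms and of the subsets of the levels of
  elements of \<open>x\<close>. Indexing the hierarchy by arbitrary objects in place of ordinals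
  avoids a theory of ordinals.\<close>

definition level_step :: "'v \<Rightarrow> 'v \<Rightarrow> 'v \<Rightarrow> 'v" where
  "level_step p x z =
    Set {v. v \<in> {a \<in> C. atom V a} \<or> (\<exists>w\<in>E z. is_set V v \<and> (\<forall>u\<in>E v. u \<in> E w))}"

lemma coded_atoms: "coded {a \<in> C. atom V a}"
  using ZFA unfolding ZFA_def coded_def by blast

lemma coded_level_step:
  assumes z: "z \<in> C"
  shows "coded {v. v \<in> {a \<in> C. atom V a} \<or> (\<exists>w\<in>E z. is_set V v \<and> (\<forall>u\<in>E v. u \<in> E w))}"
proof -
  have pow: "coded {v. is_set V v \<and> (\<forall>u\<in>E v. u \<in> E w)}" if "w \<in> C" for w
    using coded_Pow[OF that] by (simp add: subset_eq)
  have "DT {} (\<lambda>s. Set {v. is_set V v \<and> (\<forall>u\<in>E v. u \<in> E (s 0))})"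
    by (rule DT_the_set) (simp add: pow assignment_in, intro D_intros)
  from coded_UN[OF this coded_elts[OF z]]
  have "coded (\<Union>w\<in>E z. {v. is_set V v \<and> (\<forall>u\<in>E v. u \<in> E w)})"
    using elts_in by (simp add: elts_the_set pow cong: SUP_cong)
  from coded_Un[OF coded_atoms this] show ?thesis
    by (rule back_subst[of coded]) auto
qed

lemma DT_level_step: "DT {} (\<lambda>s. level_step (s 0) (s 1) (s 2))"
  unfolding level_step_def
  by (rule DT_the_set) (use coded_level_step assignment_in in \<open>simp, simp\<close>, intro D_intros)

definition level :: "'v \<Rightarrow> 'v" where "level x = rec level_step emptyset x"

lemma level_in [simp]: "level x \<in> C"
  unfolding level_def by (rule rec_in[OF DT_level_step])

lemma DT_level: "DT K t \<Longrightarrow> DT K (\<lambda>s. level (t s))"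
  unfolding level_def by (intro DT_rec[OF DT_level_step] DT_emptyset) simp_all

lemma level_unfold:
  assumes "x \<in> C"
  shows "level x = Set {v. v \<in> {a \<in> C. atom V a} \<or> (\<exists>y\<in>E x. is_set V v \<and> E v \<subseteq> E (level y))}"
    and "coded {v. v \<in> {a \<in> C. atom V a} \<or> (\<exists>y\<in>E x. is_set V v \<and> E v \<subseteq> E (level y))}"
proof -
  have c: "coded (level ` E x)"
    unfolding level_def by (rule coded_rec_image[OF DT_level_step]) (simp_all add: assms)
  have e: "{v. v \<in> {a \<in> C. atom V a} \<or> (\<exists>w\<in>E (Set (level ` E x)). is_set V v \<and> (\<forall>u\<in>E v. u \<in> E w))}
    = {v. v \<in> {a \<in> C. atom V a} \<or> (\<exists>y\<in>E x. is_set V v \<and> E v \<subseteq> E (level y))}"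
    by (auto simp: elts_the_set[OF c])
  have "level x = level_step emptyset x (Set (level ` E x))"
    using rec_unfold[OF DT_level_step emptyset_in assms] unfolding level_def .
  then show "level x = Set {v. v \<in> {a \<in> C. atom V a} \<or> (\<exists>y\<in>E x. is_set V v \<and> E v \<subseteq> E (level y))}"
    unfolding level_step_def e .
  show "coded {v. v \<in> {a \<in> C. atom V a} \<or> (\<exists>y\<in>E x. is_set V v \<and> E v \<subseteq> E (level y))}"
    using coded_level_step[OF the_set_in[OF c]] unfolding e .
qed

lemma elts_level: "x \<in> C \<Longrightarrow>
    v \<in> E (level x) \<longleftrightarrow> v \<in> C \<and> atom V v \<or> (\<exists>y\<in>E x. is_set V v \<and> E v \<subseteq> E (level y))"
  using level_unfold[of x] by (simp add: elts_the_set)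

lemma is_set_level [simp]: "x \<in> C \<Longrightarrow> is_set V (level x)"
  using level_unfold[of x] by (simp add: is_set_the_set)

lemma D_subset:
  assumes "DT K t" "DT K u" shows "D K (\<lambda>s. E (t s) \<subseteq> E (u s))"
  unfolding subset_eq by (intro D_intros assms DT_shift)

lemma elts_subset_level: "x \<in> C \<Longrightarrow> E x \<subseteq> E (level x)"
proof (rule mem_induct[of _ "{}"], assumption)
  fix x assume x: "x \<in> C" and IH: "\<And>y. y \<in> E x \<Longrightarrow> E y \<subseteq> E (level y)"
  show "E x \<subseteq> E (level x)"
    using IH elts_in[of _ x] unfolding subset_eq elts_level[OF x] is_set_def by blast
qed (intro D_subset DT_level DT_var)

lemma level_transitive: "x \<in> C \<Longrightarrow> \<forall>v\<in>E (level x). E v \<subseteq> E (level x)"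
proof (rule mem_induct[of _ "{}" "\<lambda>x. \<forall>v\<in>E (level x). E v \<subseteq> E (level x)"], assumption)
  fix x assume x: "x \<in> C" and IH: "\<And>y. y \<in> E x \<Longrightarrow> \<forall>v\<in>E (level y). E v \<subseteq> E (level y)"
  show "\<forall>v\<in>E (level x). E v \<subseteq> E (level x)"
  proof (intro ballI subsetI)
    fix v u assume v: "v \<in> E (level x)" and u: "u \<in> E v"
    then obtain y where y: "y \<in> E x" "E v \<subseteq> E (level y)"
      using atom_elts[of v] by (auto simp: elts_level[OF x])
    then have "u \<in> E (level y)" using u by blast
    then have "E u \<subseteq> E (level y)" using IH y by blast
    then show "u \<in> E (level x)"
      using y elts_in[OF u] unfolding elts_level[OF x] is_set_def by blast
  qed
qed (intro D_subset D_ball DT_level DT_var)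

lemma not_level_subset:
  assumes x: "x \<in> C" and y: "y \<in> C" and n: "\<not> E (level x) \<subseteq> E (level y)"
  obtains u z where "u \<notin> E (level y)" "is_set V u" "z \<in> E x" "E u \<subseteq> E (level z)"
proof -
  obtain u where u: "u \<in> E (level x)" "u \<notin> E (level y)" using n by blast
  then have "\<exists>z\<in>E x. is_set V u \<and> E u \<subseteq> E (level z)"
    unfolding elts_level[OF x] elts_level[OF y] by blast
  then show thesis using that u by blast
qed

text \<open>Replaces the linear order of ranks. Let \<open>u\<close> witness that the level of
  \<open>x\<close> is not contained in that of \<open>y\<close>, where \<open>u\<close> is a subset
  of \<open>level z\<close> with \<open>z\<close> in \<open>x\<close>. If \<open>level y\<close> is
  contained in \<open>level z\<close>, it belongs to \<open>level x\<close>. Otherwise a second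
  witness gives some \<open>w\<close> in \<open>y\<close> whose level contains
  \<open>level z\<close>, and \<open>u\<close> would lie in \<open>level y\<close> after
  all.\<close>

lemma level_comparable:
  "x \<in> C \<Longrightarrow> \<forall>y\<in>C. E (level x) \<subseteq> E (level y) \<or> level y \<in> E (level x)"
proof (rule mem_induct[of _ "{}" "\<lambda>x. \<forall>y\<in>C. E (level x) \<subseteq> E (level y) \<or> level y \<in> E (level x)"], assumption)
  fix x assume x: "x \<in> C"
    and IH: "\<And>z. z \<in> E x \<Longrightarrow> \<forall>y\<in>C. E (level z) \<subseteq> E (level y) \<or> level y \<in> E (level z)"
  show "\<forall>y\<in>C. E (level x) \<subseteq> E (level y) \<or> level y \<in> E (level x)"
  proof (intro ballI, subst disj_commute, rule disjCI)
    fix y assume y: "y \<in> C" and "\<not> E (level x) \<subseteq> E (level y)"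
    then obtain u z where u: "u \<notin> E (level y)" "is_set V u" "z \<in> E x" "E u \<subseteq> E (level z)"
      using not_level_subset[OF x y] by blast
    show "level y \<in> E (level x)"
    proof (cases "E (level y) \<subseteq> E (level z)")
      case True
      then show ?thesis using u y unfolding elts_level[OF x] by auto
    next
      case False
      then obtain v w where v: "v \<notin> E (level z)" "is_set V v" "w \<in> E y" "E v \<subseteq> E (level w)"
        using not_level_subset[OF y elts_in[OF u(3)]] by blast
      have "level w \<notin> E (level z)"
      proof
        assume "level w \<in> E (level z)"
        then obtain t where "t \<in> E z" "E (level w) \<subseteq> E (level t)"
          using elts_level[OF elts_in[OF u(3)]] is_set_level[OF elts_in[OF v(3)]]
          by (auto simp: is_set_def)
        then have "v \<in> E (level z)" using v unfolding elts_level[OF elts_in[OF u(3)]] by blast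
        then show False using v(1) by blast
      qed
      then have "E (level z) \<subseteq> E (level w)" using IH[OF u(3)] elts_in[OF v(3)] by blast
      then have "u \<in> E (level y)" using u v unfolding elts_level[OF y] by blast
      then show ?thesis using u(1) by blast
    qed
  qed
qed (intro D_subset D_intros DT_level DT_var)

lemma least_level:
  assumes P: "D K (\<lambda>s. P (s 0))" and x: "x \<in> C" "P x"
  obtains z where "z \<in> C" "P z" "\<And>y. y \<in> C \<Longrightarrow> P y \<Longrightarrow> E (level z) \<subseteq> E (level y)"
proof (cases "\<forall>y\<in>C. P y \<longrightarrow> E (level x) \<subseteq> E (level y)")
  case True then show thesis using that x by blast
next
  case False
  let ?S = "{v \<in> E (level x). \<exists>y\<in>C. P y \<and> v = level y}"
  have P': "D K (\<lambda>s. P (s n))" for n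
    using D_rename[OF P, of "\<lambda>_. n"] by simp
  have S: "coded ?S"
    by (rule separation[of K]) (simp_all, intro D_intros P' DT_level)
  have "?S \<noteq> {}" using False level_comparable[OF x(1)] by blast
  from foundation[OF S this] obtain z where z: "z \<in> C" "P z" "level z \<in> E (level x)"
    and min: "E (level z) \<inter> ?S = {}" by blast
  have "E (level z) \<subseteq> E (level y)" if y: "y \<in> C" "P y" for y
  proof (rule ccontr)
    assume "\<not> E (level z) \<subseteq> E (level y)"
    then have "level y \<in> E (level z)" using level_comparable[OF z(1)] y by blast
    moreover from this have "level y \<in> E (level x)" using level_transitive[OF x(1)] z(3) by blast
    ultimately show False using min y by blast
  qed
  then show thesis using that z by blast
qed

text \<open>Scott's trick: for each \<open>a\<close> only witnesses of least level matter, and the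
  subsets of their level form a set. Power sets contain sets only, so the witnesses are required to
  be sets.\<close>

theorem collection:
  assumes P: "D K (\<lambda>s. P (s 0) (s 1))" and K: "K \<subseteq> C" and A: "A \<in> C"
    and ex: "\<And>a. a \<in> E A \<Longrightarrow> \<exists>x. is_set V x \<and> P a x"
  obtains B where "B \<in> C" "\<And>a. a \<in> E A \<Longrightarrow> \<exists>x\<in>E B. P a x"
proof -
  let ?Q = "\<lambda>a x. is_set V x \<and> P a x"
  let ?R = "\<lambda>a v. is_set V v \<and> (\<exists>x\<in>C. ?Q a x \<and> (\<forall>y\<in>C. ?Q a y \<longrightarrow> E (level x) \<subseteq> E (level y)) \<and>
    E v \<subseteq> E (level x))"
  define t where "t a = Set {v. ?R a v}" for a
  have P': "D (L \<union> K) (\<lambda>s. P (u s) (v s))" if "DT (L \<union> K) u" "DT (L \<union> K) v" for u v L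
    by (rule D_subst2[OF that P]) simp
  have cR: "coded {v. ?R a v}" if a: "a \<in> C" for a
  proof (cases "\<exists>x. ?Q a x")
    case True
    then obtain x where x: "?Q a x" by blast
    have "x \<in> C" using x is_set_in by blast
    \<comment> \<open>Any witness \<open>x\<close> gives a bound, since a witness of least level has
      its level inside that of \<open>x\<close>.\<close>
    have "coded {v. is_set V v \<and> E v \<subseteq> E (level x)}" by (rule coded_Pow) simp
    then show ?thesis
    proof (rule coded_Collect[of _ _ "{a} \<union> K"])
      show "D ({a} \<union> K) (\<lambda>s. ?R a (s 0))"
        by (intro D_intros P' D_subset DT_level DT_param) (use a in auto)
    qed (use x \<open>x \<in> C\<close> in blast)
  next
    case False
    then have "{v. ?R a v} = {}" by blast
    then show ?thesis by (simp only: coded_empty)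
  qed
  have "DT ({} \<union> K) (\<lambda>s. t (s 0))" unfolding t_def
  proof (rule DT_the_set)
    show "coded {v. ?R (s 0) v}" if "assignment s" for s
      by (rule cR) (simp add: assignment_in that)
  qed (intro D_intros P' D_subset DT_level)
  from coded_UN[OF this coded_elts[OF A]] have c: "coded (\<Union>a\<in>E A. E (t a))" .
  show thesis
  proof (rule that[OF the_set_in[OF c]])
    fix a assume a: "a \<in> E A"
    then have aC: "a \<in> C" by (rule elts_in)
    obtain x where x: "?Q a x" using ex[OF a] by blast
    have "D ({a} \<union> K) (\<lambda>s. ?Q a (s 0))"
      by (intro D_intros P' DT_param) (use aC in auto)
    from least_level[OF this _ x] x is_set_in obtain z
      where z: "z \<in> C" "?Q a z" "\<And>y. y \<in> C \<Longrightarrow> ?Q a y \<Longrightarrow> E (level z) \<subseteq> E (level y)" by metis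
    have "?R a z" using z elts_subset_level[OF z(1)] by blast
    then have "z \<in> E (t a)" unfolding t_def elts_the_set[OF cR[OF aC]] by simp
    then show "\<exists>x\<in>E (Set (\<Union>a\<in>E A. E (t a))). P a x"
      unfolding elts_the_set[OF c] using a z by blast
  qed
qed

section \<open>Invariance under automorphisms\<close>

context
  fixes f :: "'v \<Rightarrow> 'v"
  assumes f: "automorphism f"
begin

lemma automorphism_mem: "x \<in> C \<Longrightarrow> y \<in> C \<Longrightarrow> f x \<in> E (f y) \<longleftrightarrow> x \<in> E y"
  using f automorphism_in[OF f] by (simp add: automorphism_def elts_def)

lemma automorphism_elts: "x \<in> C \<Longrightarrow> E (f x) = f ` E x"
proof -
  assume x: "x \<in> C"
  have "y \<in> f ` E x" if y: "y \<in> E (f x)" for y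
  proof -
    have "y \<in> f ` C" using f elts_in[OF y] by (simp add: automorphism_def bij_betw_def)
    then show ?thesis using automorphism_mem x y by blast
  qed
  moreover have "f y \<in> E (f x)" if "y \<in> E x" for y
    using automorphism_mem x that elts_in[OF that] by blast
  ultimately show ?thesis by blast
qed

lemma automorphism_is_set: "x \<in> C \<Longrightarrow> is_set V (f x) \<longleftrightarrow> is_set V x"
  using f automorphism_in[OF f] by (simp add: is_set_def automorphism_def)

lemma automorphism_emptyset: "f emptyset = emptyset"
  using codes_emptyset automorphism_elts[of emptyset] automorphism_is_set[of emptyset]
  by (intro codes_unique[of _ "{}"]) (auto simp: codes_def)

lemma D_invariant:
  assumes K: "\<And>k. k \<in> K \<Longrightarrow> f k = k" and P: "D K P" and s: "assignment s"
  shows "P (\<lambda>n. f (s n)) \<longleftrightarrow> P s"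
  by (rule D_automorphism[OF f K automorphism_emptyset _ P s])
    (use codes_unique codes_emptyset in blast)+

lemma DT_invariant:
  assumes K: "\<And>k. k \<in> K \<Longrightarrow> f k = k" and t: "DT K t" and s: "assignment s"
  shows "f (t s) = t (\<lambda>n. f (s n))"
proof -
  have "D K (\<lambda>s. s 0 = t (\<lambda>n. s (Suc n)))" using t by (simp add: DT_def)
  from D_invariant[OF K this, of "case_nat (t s) s"] show ?thesis
    using s DT_in[OF t s] by (simp add: assignment_case_nat_iff)
qed

lemma D_invariant1:
  assumes "\<And>k. k \<in> K \<Longrightarrow> f k = k" "D K (\<lambda>s. P (s 0))" "x \<in> C"
  shows "P (f x) \<longleftrightarrow> P x"
  using D_invariant[OF assms(1,2), of "\<lambda>_. x"] assms(3) by (simp add: assignment_const)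

lemma DT_invariant1:
  assumes "\<And>k. k \<in> K \<Longrightarrow> f k = k" "DT K (\<lambda>s. t (s 0))" "x \<in> C"
  shows "f (t x) = t (f x)"
  using DT_invariant[OF assms(1,2), of "\<lambda>_. x"] assms(3) by (simp add: assignment_const)

lemma DT_invariant2:
  assumes "\<And>k. k \<in> K \<Longrightarrow> f k = k" "DT K (\<lambda>s. t (s 0) (s 1))" "x \<in> C" "y \<in> C"
  shows "f (t x y) = t (f x) (f y)"
  using DT_invariant[OF assms(1,2), of "case_nat x (\<lambda>_. y)"] assms(3-)
  by (simp add: assignment_case_nat_iff assignment_const)

lemma automorphism_opair: "x \<in> C \<Longrightarrow> y \<in> C \<Longrightarrow> f (opair x y) = opair (f x) (f y)"
  by (rule DT_invariant2[of "{}" opair]) (auto intro: DT_opair DT_var)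

lemma automorphism_succ: "x \<in> C \<Longrightarrow> f (succ V x) = succ V (f x)"
  by (rule DT_invariant1[of "{}"]) (auto intro: DT_succ DT_var)

lemma automorphism_omega: "f \<omega> = \<omega>"
  using DT_invariant1[OF _ DT_omega[of "{}"], of emptyset] by simp

lemma automorphism_ap: "h \<in> C \<Longrightarrow> x \<in> C \<Longrightarrow> f (ap h x) = ap (f h) (f x)"
  by (rule DT_invariant2[of "{}" ap]) (auto intro: DT_ap DT_var)

end

section \<open>Permutations of the atoms\<close>

lemma elts_atoms: "E (atoms V) = {a \<in> C. atom V a}"
  by (simp add: atoms_def elts_the_set coded_atoms)

lemma atoms_in [simp]: "atoms V \<in> C"
  by (simp add: atoms_def the_set_in coded_atoms)

lemma DT_if:
  assumes "D K P" "DT K t" "DT K u" shows "DT K (\<lambda>s. if P s then t s else u s)"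
proof (rule DT_I)
  have "D K (\<lambda>s. P (\<lambda>n. s (Suc n)))" by (rule D_rename[OF assms(1)])
  then show "D K (\<lambda>s. if P (\<lambda>n. s (Suc n)) then s 0 = t (\<lambda>n. s (Suc n)) else s 0 = u (\<lambda>n. s (Suc n)))"
    by (intro D_intros DT_shift assms)
qed (use assms in \<open>auto simp: DT_in\<close>)

definition action_step :: "'v \<Rightarrow> 'v \<Rightarrow> 'v \<Rightarrow> 'v" where
  "action_step p x z = (if atom V x then ap p x else z)"

lemma DT_action_step: "DT {} (\<lambda>s. action_step (s 0) (s 1) (s 2))"
  unfolding action_step_def by (intro DT_if D_intros DT_ap)

text \<open>Agrees with \<open>act\<close> for permutations, and is total.\<close>

definition ac :: "'v \<Rightarrow> 'v \<Rightarrow> 'v" where "ac p x = rec action_step p x"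

lemma ac_in [simp]: "ac p x \<in> C"
  unfolding ac_def by (rule rec_in[OF DT_action_step])

lemma DT_ac: "DT K t \<Longrightarrow> DT K u \<Longrightarrow> DT K (\<lambda>s. ac (t s) (u s))"
  unfolding ac_def by (intro DT_rec[OF DT_action_step]) simp_all

lemma ac_atom: "p \<in> C \<Longrightarrow> x \<in> C \<Longrightarrow> atom V x \<Longrightarrow> ac p x = ap p x"
  unfolding ac_def by (subst rec_unfold[OF DT_action_step]) (simp_all add: action_step_def)

lemma ac_set:
  assumes "p \<in> C" "is_set V x" shows "ac p x = Set (ac p ` E x)" and "coded (ac p ` E x)"
proof -
  show "ac p x = Set (ac p ` E x)"
    unfolding ac_def using assms
    by (subst rec_unfold[OF DT_action_step]) (simp_all add: action_step_def is_set_def)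
  show "coded (ac p ` E x)"
    unfolding ac_def by (rule coded_rec_image[OF DT_action_step]) (simp_all add: assms is_set_in)
qed

lemma elts_ac_set: "p \<in> C \<Longrightarrow> is_set V x \<Longrightarrow> E (ac p x) = ac p ` E x"
  by (simp add: ac_set elts_the_set)

lemma is_set_ac: "p \<in> C \<Longrightarrow> is_set V x \<Longrightarrow> is_set V (ac p x)"
  by (simp add: ac_set is_set_the_set)

lemma is_perm_function: "is_perm V p \<Longrightarrow> is_function V p (atoms V) (atoms V)"
  by (simp add: is_perm_def)

lemma function_in: "is_function V f X Y \<Longrightarrow> f \<in> C"
  by (simp add: is_function_def is_relation_def is_set_def)

lemma is_perm_in: "is_perm V p \<Longrightarrow> p \<in> C"
  using is_perm_function function_in by blast

lemma is_perm_ap: "is_perm V p \<Longrightarrow> a \<in> C \<Longrightarrow> atom V a \<Longrightarrow> ap p a \<in> C \<and> atom V (ap p a)"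
  using function_ap[OF is_perm_function, of p a] by (simp add: elts_atoms)

lemma is_perm_rel: "is_perm V p \<Longrightarrow> rel V p x y \<longleftrightarrow> x \<in> C \<and> atom V x \<and> y = ap p x"
  using function_rel_iff[OF is_perm_function, of p x y] by (simp add: elts_atoms)

text \<open>The two recursions differ in form only: an atom has no elements, which makes the closure
  condition vacuous there, and on atoms \<open>p\<close> is a total function, so
  \<open>rel V p x y\<close> means \<open>y = ap p x\<close>.\<close>

lemma action_approx_iff:
  assumes p: "is_perm V p" shows "action_approx V p f \<longleftrightarrow> approx action_step p f"
proof -
  have "(if atom V x then rel V p x y
         else (\<forall>u\<in>E x. \<exists>v. rel V f u v) \<and> codes V y {v. \<exists>u\<in>E x. rel V f u v})
    \<longleftrightarrow> (\<forall>u\<in>E x. \<exists>v. rel V f u v) \<and> y = action_step p x (image_on f x)"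
    if "is_set V f" "rel V f x y" for x y
  proof -
    have x: "x \<in> C" and f: "f \<in> C" using that by (auto simp: is_set_def rel_iff)
    show ?thesis
      using codes_iff[OF coded_image_on[OF f x], of y] atom_elts[OF x] is_perm_rel[OF p, of x y] x
      by (auto simp: action_step_def image_on_def)
  qed
  note key = this
  have cong: "(\<forall>x y. rel V f x y \<longrightarrow> L x y) = (\<forall>x y. rel V f x y \<longrightarrow> R x y)"
    if "\<And>x y. rel V f x y \<Longrightarrow> L x y = R x y" for L R
    using that by blast
  show ?thesis
  proof (cases "is_set V f")
    case True
    show ?thesis
      unfolding action_approx_def approx_def[OF DT_action_step]
      by (intro conj_cong refl cong key[OF True])
  qed (simp add: action_approx_def approx_def[OF DT_action_step])
qed

lemma act_eq: assumes p: "is_perm V p" and x: "x \<in> C" shows "act V p x = ac p x"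
proof -
  have "\<exists>f y. approx action_step p f \<and> rel V f x y"
    by (rule rec_good[OF DT_action_step is_perm_in[OF p] x])
  then show ?thesis
    unfolding act_def ac_def rec_def[OF DT_action_step] by (simp add: action_approx_iff[OF p])
qed

lemma perm_ext:
  assumes "is_perm V p" "is_perm V q" "\<And>a. a \<in> C \<Longrightarrow> atom V a \<Longrightarrow> ac p a = ac q a"
  shows "p = q"
proof (rule function_ext[OF is_perm_function[OF assms(1)] is_perm_function[OF assms(2)]])
  fix a assume "a \<in> E (atoms V)"
  then have "a \<in> C" "atom V a" by (simp_all add: elts_atoms)
  then show "ap p a = ap q a"
    using assms(3)[of a] ac_atom[OF is_perm_in[OF assms(1)]] ac_atom[OF is_perm_in[OF assms(2)]] by simp
qed

lemma rel_perm_id: "rel V (perm_id V) x y \<longleftrightarrow> x \<in> C \<and> atom V x \<and> y = x"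
proof -
  have "perm_id V = lam (atoms V) (\<lambda>x. x)"
    unfolding perm_id_def lam_def by (rule arg_cong[of _ _ Set]) (auto simp: is_pair_iff elts_in)
  then show ?thesis using rel_lam[OF DT_var[of "{}" 0], of "atoms V" x y] by (simp add: elts_atoms)
qed

lemma coded_perm_comp:
  assumes p: "p \<in> C" and q: "q \<in> C"
  shows "coded {r. \<exists>x y z. rel V q x y \<and> rel V p y z \<and> is_pair V r x z}"
proof -
  obtain a where a: "a \<in> C" "\<And>x y. rel V q x y \<Longrightarrow> x \<in> E a" using coded_rel_fields[OF q] by blast
  obtain b where b: "b \<in> C" "\<And>x y. rel V p x y \<Longrightarrow> y \<in> E b" using coded_rel_fields[OF p] by blast
  have "coded {r. \<exists>x\<in>E a. \<exists>z\<in>E b. r = opair x z}"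
    by (rule coded_UN2[of "{}" opair]) (auto intro: DT_opair DT_var a b)
  then show ?thesis
  proof (rule coded_Collect[of _ _ "{p, q}"])
    show "D {p, q} (\<lambda>s. \<exists>x y z. rel V q x y \<and> rel V p y z \<and> is_pair V (s 0) x z)"
      by (intro D_ex_unbounded D_intros D_rel D_is_pair DT_param) (auto simp: p q rel_iff)
  qed (use a b in \<open>unfold is_pair_iff, blast\<close>)
qed

lemma rel_perm_comp:
  assumes p: "p \<in> C" and q: "q \<in> C"
  shows "rel V (perm_comp V p q) x z \<longleftrightarrow> (\<exists>y. rel V q x y \<and> rel V p y z)"
proof -
  have "rel V (perm_comp V p q) x z \<longleftrightarrow> x \<in> C \<and> z \<in> C \<and>
      (\<exists>x' y z'. rel V q x' y \<and> rel V p y z' \<and> is_pair V (opair x z) x' z')"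
    by (subst rel_iff) (simp only: perm_comp_def elts_the_set[OF coded_perm_comp[OF p q]] mem_Collect_eq)
  also have "\<dots> \<longleftrightarrow> (\<exists>y. rel V q x y \<and> rel V p y z)"
    unfolding is_pair_iff using rel_in[of q x] rel_in[of p _ z] by (metis opair_eq)
  finally show ?thesis .
qed

lemma coded_perm_inv:
  assumes p: "p \<in> C" shows "coded {r. \<exists>x y. rel V p x y \<and> is_pair V r y x}"
proof -
  obtain a where a: "a \<in> C" "\<And>x y. rel V p x y \<Longrightarrow> x \<in> E a \<and> y \<in> E a"
    using coded_rel_fields[OF p] by blast
  have "coded {r. \<exists>x\<in>E a. \<exists>z\<in>E a. r = opair x z}"
    by (rule coded_UN2[of "{}" opair]) (auto intro: DT_opair DT_var a)
  then show ?thesis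
  proof (rule coded_Collect[of _ _ "{p}"])
    show "D {p} (\<lambda>s. \<exists>x y. rel V p x y \<and> is_pair V (s 0) y x)"
      by (intro D_ex_unbounded D_intros D_rel D_is_pair DT_param) (auto simp: p rel_iff)
  qed (use a in \<open>unfold is_pair_iff, blast\<close>)
qed

lemma rel_perm_inv:
  assumes p: "p \<in> C" shows "rel V (perm_inv V p) y x \<longleftrightarrow> rel V p x y"
proof -
  have "rel V (perm_inv V p) y x \<longleftrightarrow> y \<in> C \<and> x \<in> C \<and>
      (\<exists>x' y'. rel V p x' y' \<and> is_pair V (opair y x) y' x')"
    by (subst rel_iff) (simp only: perm_inv_def elts_the_set[OF coded_perm_inv[OF p]] mem_Collect_eq)
  also have "\<dots> \<longleftrightarrow> rel V p x y"
    unfolding is_pair_iff using rel_in[of p x y] by (metis opair_eq)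
  finally show ?thesis .
qed

lemma DT_perm_comp: assumes "DT K t" "DT K u" shows "DT K (\<lambda>s. perm_comp V (t s) (u s))"
proof (rule DT_subst2[OF assms, of "{}"])
  show "DT {} (\<lambda>s. perm_comp V (s 0) (s 1))" unfolding perm_comp_def
  proof (rule DT_the_set)
    show "coded {r. \<exists>x y z. rel V (s 1) x y \<and> rel V (s 0) y z \<and> is_pair V r x z}" if "assignment s" for s
      by (rule coded_perm_comp) (simp_all add: assignment_in that)
  qed (intro D_ex_unbounded D_intros D_rel D_is_pair, auto simp: rel_iff)
qed simp

lemma DT_perm_inv: assumes "DT K t" shows "DT K (\<lambda>s. perm_inv V (t s))"
proof (rule DT_subst1[OF assms, of "{}"])
  show "DT {} (\<lambda>s. perm_inv V (s 0))" unfolding perm_inv_def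
  proof (rule DT_the_set)
    show "coded {r. \<exists>x y. rel V (s 0) x y \<and> is_pair V r y x}" if "assignment s" for s
      by (rule coded_perm_inv) (simp add: assignment_in that)
  qed (intro D_ex_unbounded D_intros D_rel D_is_pair, auto simp: rel_iff)
qed simp

lemma ac_perm_atom: "is_perm V p \<Longrightarrow> a \<in> C \<Longrightarrow> atom V a \<Longrightarrow> rel V p a (ac p a)"
  by (simp add: is_perm_rel ac_atom is_perm_in)

lemma atom_ac: "is_perm V p \<Longrightarrow> x \<in> C \<Longrightarrow> atom V (ac p x) \<longleftrightarrow> atom V x"
  using is_set_ac[OF is_perm_in, of p x] is_perm_ap[of p x] ac_atom[OF is_perm_in, of p x]
  by (auto simp: is_set_def)

text \<open>Uniqueness of the extension of a permutation to the universe, by induction on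
  membership; \<open>t\<close> must be definable for that induction to be available.\<close>

lemma ac_eqI:
  assumes t: "DT K (\<lambda>s. t (s 0))" and p: "p \<in> C" and x: "x \<in> C"
    and a: "\<And>a. a \<in> C \<Longrightarrow> atom V a \<Longrightarrow> ac p a = t a"
    and s: "\<And>x. is_set V x \<Longrightarrow> is_set V (t x) \<and> E (t x) = t ` E x"
  shows "ac p x = t x"
proof (rule mem_induct[OF x, of "insert p K"])
  show "D (insert p K) (\<lambda>s. ac p (s 0) = t (s 0))"
    by (intro D_eq DT_ac DT_param DT_var DT_mono[OF t]) (auto simp: p)
  fix x assume x: "x \<in> C" and IH: "\<And>y. y \<in> E x \<Longrightarrow> ac p y = t y"
  show "ac p x = t x"
  proof (cases "atom V x")
    case True then show ?thesis using a x by blast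
  next
    case False
    then have "is_set V x" using x by (simp add: is_set_def)
    then show ?thesis using s[of x] IH
      by (intro is_set_ext) (simp_all add: is_set_ac elts_ac_set p)
  qed
qed

lemma ac_id:
  assumes "is_perm V (perm_id V)" "x \<in> C" shows "ac (perm_id V) x = x"
proof (rule ac_eqI[OF DT_var[of "{}"] is_perm_in[OF assms(1)] assms(2)])
  show "ac (perm_id V) a = a" if "a \<in> C" "atom V a" for a
    using ac_perm_atom[OF assms(1) that] by (simp add: rel_perm_id)
qed simp

lemma ac_comp:
  assumes p: "is_perm V p" and q: "is_perm V q" and pq: "is_perm V (perm_comp V p q)" and x: "x \<in> C"
  shows "ac (perm_comp V p q) x = ac p (ac q x)"
proof (rule ac_eqI[OF _ is_perm_in[OF pq] x])
  show "DT {p, q} (\<lambda>s. ac p (ac q (s 0)))"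
    by (intro DT_ac DT_param DT_var) (auto simp: is_perm_in p q)
  show "ac (perm_comp V p q) a = ac p (ac q a)" if a: "a \<in> C" "atom V a" for a
    using ac_perm_atom[OF pq a] ac_perm_atom[OF q a] ac_perm_atom[OF p, of "ac q a"] a
    by (auto simp: rel_perm_comp is_perm_in p q is_perm_rel atom_ac)
  show "is_set V (ac p (ac q x)) \<and> E (ac p (ac q x)) = (\<lambda>x. ac p (ac q x)) ` E x"
    if "is_set V x" for x
    using that by (simp add: is_set_ac elts_ac_set p q is_perm_in image_image)
qed

lemma ac_inv:
  assumes p: "is_perm V p" and q: "is_perm V (perm_inv V p)" and x: "x \<in> C"
  shows "ac p (ac (perm_inv V p) x) = x" "ac (perm_inv V p) (ac p x) = x"
proof -
  have pC: "p \<in> C" "perm_inv V p \<in> C" using is_perm_in p q by blast+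
  have D: "D {p, perm_inv V p} (\<lambda>s. ac p (ac (perm_inv V p) (s 0)) = s 0)"
    "D {p, perm_inv V p} (\<lambda>s. ac (perm_inv V p) (ac p (s 0)) = s 0)"
    by (intro D_eq DT_ac DT_param DT_var; simp add: pC)+
  have set: "is_set V y \<and> E y = E x \<Longrightarrow> is_set V x \<Longrightarrow> y = x" for x y
    using is_set_ext by blast
  show "ac p (ac (perm_inv V p) x) = x"
  proof (rule mem_induct[OF x D(1)])
    fix x assume x: "x \<in> C" and IH: "\<And>y. y \<in> E x \<Longrightarrow> ac p (ac (perm_inv V p) y) = y"
    show "ac p (ac (perm_inv V p) x) = x"
    proof (cases "atom V x")
      case True
      then show ?thesis using ac_perm_atom[OF q x True]
        by (simp add: rel_perm_inv pC is_perm_rel p ac_atom)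
    next
      case False
      then have "is_set V x" using x by (simp add: is_set_def)
      then show ?thesis using IH
        by (intro set) (simp_all add: is_set_ac elts_ac_set pC image_image)
    qed
  qed
  show "ac (perm_inv V p) (ac p x) = x"
  proof (rule mem_induct[OF x D(2)])
    fix x assume x: "x \<in> C" and IH: "\<And>y. y \<in> E x \<Longrightarrow> ac (perm_inv V p) (ac p y) = y"
    show "ac (perm_inv V p) (ac p x) = x"
    proof (cases "atom V x")
      case True
      then have "rel V (perm_inv V p) (ac p x) x"
        using ac_perm_atom[OF p x True] by (simp add: rel_perm_inv pC)
      then show ?thesis by (simp add: is_perm_rel q ac_atom pC)
    next
      case False
      then have "is_set V x" using x by (simp add: is_set_def)
      then show ?thesis using IH
        by (intro set) (simp_all add: is_set_ac elts_ac_set pC image_image)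
    qed
  qed
qed

text \<open>Every permutation preserves membership. Applied to the inverse, this shows that
  membership is reflected too, and the inverse also witnesses bijectivity.\<close>

lemma automorphism_ac:
  assumes p: "is_perm V p" and q: "is_perm V (perm_inv V p)" shows "automorphism (ac p)"
proof -
  have pC: "p \<in> C" "perm_inv V p \<in> C" using is_perm_in p q by blast+
  have mem: "mem V (ac r x) (ac r y)" if "is_perm V r" "x \<in> C" "y \<in> C" "mem V x y" for r x y
  proof -
    have x: "x \<in> E y" using that by (simp add: elts_def)
    then have "is_set V y" using atom_elts[OF that(3)] that(3) by (auto simp: is_set_def)
    then have "ac r x \<in> E (ac r y)" using x elts_ac_set[OF is_perm_in[OF that(1)]] by blast
    then show ?thesis by (simp add: elts_def)
  qed
  show ?thesis unfolding automorphism_def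
  proof (intro conjI ballI)
    show "bij_betw (ac p) C C"
      by (rule bij_betw_byWitness[of _ "ac (perm_inv V p)"]) (auto simp: ac_inv[OF p q])
    show "mem V (ac p x) (ac p y) \<longleftrightarrow> mem V x y" if "x \<in> C" "y \<in> C" for x y
      using mem[OF p that] mem[OF q ac_in ac_in, of p x p y] that by (auto simp: ac_inv[OF p q])
  qed (auto simp: atom_ac p)
qed

end

section \<open>Permutation groups\<close>

locale zfa_group = zfa V for V :: "'v universe" +
  fixes G :: 'v
  assumes G: "perm_group V G"
begin

lemma G_in [simp]: "G \<in> C"
  using G by (simp add: perm_group_def is_set_def)

lemma is_set_G: "is_set V G"
  using G by (simp add: perm_group_def)

lemma G_perm: "p \<in> E G \<Longrightarrow> is_perm V p"
  using G by (simp add: perm_group_def)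

lemma id_in_G [simp]: "perm_id V \<in> E G"
  using G by (simp add: perm_group_def)

lemma comp_in_G [simp]: "p \<in> E G \<Longrightarrow> q \<in> E G \<Longrightarrow> perm_comp V p q \<in> E G"
  using G by (simp add: perm_group_def)

lemma inv_in_G [simp]: "p \<in> E G \<Longrightarrow> perm_inv V p \<in> E G"
  using G by (simp add: perm_group_def)

lemma ac_id_G [simp]: "x \<in> C \<Longrightarrow> ac (perm_id V) x = x"
  by (rule ac_id[OF G_perm[OF id_in_G]])

lemma ac_comp_G [simp]: "p \<in> E G \<Longrightarrow> q \<in> E G \<Longrightarrow> x \<in> C \<Longrightarrow> ac (perm_comp V p q) x = ac p (ac q x)"
  by (rule ac_comp) (auto intro: G_perm)

lemma ac_inv_G [simp]:
  assumes "p \<in> E G" "x \<in> C"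
  shows "ac p (ac (perm_inv V p) x) = x" "ac (perm_inv V p) (ac p x) = x"
  using ac_inv[of p x] G_perm assms by auto

lemma automorphism_G: "p \<in> E G \<Longrightarrow> automorphism (ac p)"
  by (rule automorphism_ac) (auto intro: G_perm)

lemma elts_ac: "p \<in> E G \<Longrightarrow> x \<in> C \<Longrightarrow> E (ac p x) = ac p ` E x"
  by (rule automorphism_elts[OF automorphism_G])

lemma ac_opair: "p \<in> E G \<Longrightarrow> x \<in> C \<Longrightarrow> y \<in> C \<Longrightarrow> ac p (opair x y) = opair (ac p x) (ac p y)"
  by (rule automorphism_opair[OF automorphism_G])

lemma ac_upair: "p \<in> E G \<Longrightarrow> x \<in> C \<Longrightarrow> y \<in> C \<Longrightarrow> ac p (upair x y) = upair (ac p x) (ac p y)"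
  by (rule DT_invariant2[OF automorphism_G, of p "{}"]) (auto intro: DT_upair DT_var)

lemma G_ext:
  assumes "p \<in> E G" "q \<in> E G" "\<And>a. a \<in> C \<Longrightarrow> ac p a = ac q a" shows "p = q"
  by (rule perm_ext[OF G_perm[OF assms(1)] G_perm[OF assms(2)]]) (use assms in blast)

lemma elts_perm: "is_perm V h \<Longrightarrow> E h = (\<lambda>a. opair a (ac h a)) ` E (atoms V)"
  unfolding function_elts[OF is_perm_function]
  by (rule image_cong) (auto simp: elts_atoms ac_atom is_perm_in)

text \<open>Applying \<open>p\<close> to the pairs (a, h a) gives the pairs (p a, p (h a)), which
  form the graph of the conjugate. Conjugation of permutations and subgroups thus becomes the action
  itself, to which all invariance facts apply.\<close>

lemma ac_perm:
  assumes p: "p \<in> E G" and h: "h \<in> E G"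
  shows "ac p h = perm_comp V (perm_comp V p h) (perm_inv V p)" (is "_ = ?r")
proof (rule is_set_ext)
  have r: "?r \<in> E G" using p h by simp
  show "is_set V (ac p h)" "is_set V ?r"
    using is_perm_function[OF G_perm[OF h]] is_perm_function[OF G_perm[OF r]] p
    by (auto simp: is_function_def is_relation_def intro!: is_set_ac elts_in)
  have atoms: "ac p ` E (atoms V) = E (atoms V)"
  proof -
    have "ac q ` E (atoms V) \<subseteq> E (atoms V)" if "q \<in> E G" for q
      using that by (auto simp: elts_atoms atom_ac G_perm)
    from image_mono[OF this[OF inv_in_G[OF p]], of "ac p"] this[OF p] show ?thesis
      using p elts_in by (force simp: image_image)
  qed
  have "E (ac p h) = (\<lambda>a. opair (ac p a) (ac p (ac h a))) ` E (atoms V)"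
    unfolding elts_ac[OF p elts_in[OF h]] elts_perm[OF G_perm[OF h]] image_image
    by (rule image_cong) (auto simp: ac_opair p elts_in)
  \<comment> \<open>The graph is reindexed by the image of the atom under \<open>p\<close>.\<close>
  also have "\<dots> = (\<lambda>a. opair a (ac ?r a)) ` (ac p ` E (atoms V))"
    unfolding image_image by (rule image_cong) (simp_all add: p h elts_in)
  finally show "E (ac p h) = E ?r"
    unfolding elts_perm[OF G_perm[OF r]] atoms .
qed

lemma ac_perm_in_G [simp]: "p \<in> E G \<Longrightarrow> h \<in> E G \<Longrightarrow> ac p h \<in> E G"
  by (simp add: ac_perm)

lemma ac_ac_perm: "p \<in> E G \<Longrightarrow> h \<in> E G \<Longrightarrow> x \<in> C \<Longrightarrow> ac (ac p h) x = ac p (ac h (ac (perm_inv V p) x))"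
  by (simp add: ac_perm)

lemma conjugate_eq:
  assumes p: "p \<in> E G" and H: "is_set V H" "E H \<subseteq> E G" shows "conjugate V p H = ac p H"
proof -
  have "(\<lambda>h. perm_comp V (perm_comp V p h) (perm_inv V p)) ` E H = ac p ` E H"
    by (rule image_cong) (use ac_perm[OF p] H(2) in auto)
  then show ?thesis by (simp add: conjugate_def ac_set(1)[OF elts_in[OF p] H(1)])
qed

lemma ac_G: assumes p: "p \<in> E G" shows "ac p G = G"
proof (rule is_set_ext)
  have "h \<in> ac p ` E G" if "h \<in> E G" for h
    by (rule image_eqI[of _ _ "ac (perm_inv V p) h"]) (simp_all add: p that elts_in[OF that])
  then show "E (ac p G) = E G" using p by (auto simp: elts_ac)
qed (use is_set_ac elts_in p is_set_G in auto)

lemma ac_perm_comp: "p \<in> E G \<Longrightarrow> g \<in> C \<Longrightarrow> h \<in> C \<Longrightarrow>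
    ac p (perm_comp V g h) = perm_comp V (ac p g) (ac p h)"
  by (rule DT_invariant2[OF automorphism_G, of p "{}"]) (auto intro: DT_perm_comp DT_var)

lemma ac_perm_inv: "p \<in> E G \<Longrightarrow> g \<in> C \<Longrightarrow> ac p (perm_inv V g) = perm_inv V (ac p g)"
  by (rule DT_invariant1[OF automorphism_G, of p "{}"]) (auto intro: DT_perm_inv DT_var)

lemma ac_perm_id: "p \<in> E G \<Longrightarrow> ac p (perm_id V) = perm_id V"
  by (rule G_ext) (simp_all add: ac_ac_perm)

section \<open>Subgroups and stabilizers\<close>

lemma subgroup_iff: "perm_subgroup V H G \<longleftrightarrow> is_set V H \<and> E H \<subseteq> E G \<and> perm_id V \<in> E H \<and>
    (\<forall>p\<in>E H. \<forall>q\<in>E H. perm_comp V p q \<in> E H) \<and> (\<forall>p\<in>E H. perm_inv V p \<in> E H)"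
  using G_perm by (auto simp: perm_subgroup_def perm_group_def)

lemma subgroup_conjugate:
  assumes p: "p \<in> E G" and H: "perm_subgroup V H G" shows "perm_subgroup V (ac p H) G"
proof -
  have H': "is_set V H" "H \<in> C" "E H \<subseteq> E G" using H by (auto simp: subgroup_iff is_set_def)
  have HC: "h \<in> C" if "h \<in> E H" for h using that elts_in by blast
  show ?thesis unfolding subgroup_iff elts_ac[OF p H'(2)]
  proof (intro conjI ballI)
    show "is_set V (ac p H)" using is_set_ac[OF elts_in[OF p] H'(1)] .
    show "ac p ` E H \<subseteq> E G" using H'(3) p by auto
    show "perm_id V \<in> ac p ` E H"
      by (rule image_eqI[of _ _ "perm_id V"]) (use H p in \<open>auto simp: subgroup_iff ac_perm_id\<close>)
    show "perm_comp V g h \<in> ac p ` E H" if gh': "g \<in> ac p ` E H" "h \<in> ac p ` E H" for g h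
    proof -
      obtain g' h' where gh: "g' \<in> E H" "h' \<in> E H" "g = ac p g'" "h = ac p h'" using gh' by blast
      then have "perm_comp V g h = ac p (perm_comp V g' h')" using ac_perm_comp[OF p HC HC] by simp
      moreover have "perm_comp V g' h' \<in> E H" using H gh unfolding subgroup_iff by blast
      ultimately show ?thesis by blast
    qed
    show "perm_inv V g \<in> ac p ` E H" if g': "g \<in> ac p ` E H" for g
    proof -
      obtain g' where g: "g' \<in> E H" "g = ac p g'" using g' by blast
      then have "perm_inv V g = ac p (perm_inv V g')" using ac_perm_inv[OF p HC] by simp
      moreover have "perm_inv V g' \<in> E H" using H g unfolding subgroup_iff by blast
      ultimately show ?thesis by blast
    qed
  qed
qed

abbreviation Sym :: "'v \<Rightarrow> 'v" where "Sym \<equiv> sym_of V G"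

lemma sym_eq: "x \<in> C \<Longrightarrow> Sym x = Set {p \<in> E G. ac p x = x}"
  unfolding sym_of_def by (rule arg_cong[of _ _ Set]) (auto simp: act_eq G_perm)

lemma coded_sym: "x \<in> C \<Longrightarrow> coded {p \<in> E G. ac p x = x}"
  by (rule separation[of "{x}"]) (auto intro!: D_eq DT_ac DT_var DT_param)

lemma elts_sym: "x \<in> C \<Longrightarrow> E (Sym x) = {p \<in> E G. ac p x = x}"
  by (simp add: sym_eq elts_the_set coded_sym)

lemma is_set_sym: "x \<in> C \<Longrightarrow> is_set V (Sym x)"
  by (simp add: sym_eq is_set_the_set coded_sym)

lemma sym_in: "x \<in> C \<Longrightarrow> Sym x \<in> C"
  by (simp add: is_set_sym is_set_in)

lemma sym_subgroup: "x \<in> C \<Longrightarrow> perm_subgroup V (Sym x) G"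
proof -
  assume x: "x \<in> C"
  have "ac (perm_inv V p) x = x" if "p \<in> E G" "ac p x = x" for p
    using ac_inv_G(2)[OF that(1) x] that(2) by simp
  then show ?thesis using x by (auto simp: subgroup_iff is_set_sym elts_sym)
qed

lemma DT_sym:
  assumes t: "DT K t" and K: "G \<in> K" shows "DT K (\<lambda>s. Sym (t s))"
proof (rule DT_subst1[OF t])
  have "DT {G} (\<lambda>s. Set {p. p \<in> E G \<and> ac p (s 0) = s 0})"
  proof (rule DT_the_set)
    show "coded {p. p \<in> E G \<and> ac p (s 0) = s 0}" if "assignment s" for s
      by (rule coded_sym) (simp add: assignment_in that)
  qed (intro D_intros DT_ac DT_param, simp_all)
  then show "DT {G} (\<lambda>s. Sym (s 0))"
    unfolding DT_def by (auto simp: sym_eq assignment_in elim!: D_cong[rotated])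
qed (use K in simp)

lemma ac_sym: "p \<in> E G \<Longrightarrow> x \<in> C \<Longrightarrow> ac p (Sym x) = Sym (ac p x)"
  by (rule DT_invariant1[OF automorphism_G, of p "{G}"]) (auto simp: ac_G intro: DT_sym DT_var)

lemma ac_nat: "p \<in> E G \<Longrightarrow> n \<in> E \<omega> \<Longrightarrow> ac p n = n"
proof (rule omega_induct[of n "{p}"])
  assume p: "p \<in> E G"
  show "D {p} (\<lambda>s. ac p (s 0) = s 0)"
    by (intro D_eq DT_ac DT_param DT_var) (simp_all add: elts_in[OF p])
  show "ac p emptyset = emptyset" by (rule automorphism_emptyset[OF automorphism_G[OF p]])
  show "ac p (succ V n) = succ V n" if "n \<in> E \<omega>" "ac p n = n" for n
    using automorphism_succ[OF automorphism_G[OF p]] that elts_in by simp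
qed

end

locale zfa_filter = zfa_group V G for V :: "'v universe" and G :: 'v +
  fixes F :: 'v
  assumes F: "normal_filter V G F"
begin

lemma F_in [simp]: "F \<in> C"
  using F by (simp add: normal_filter_def subgroup_filter_def is_set_def)

lemma F_subgroup: "H \<in> E F \<Longrightarrow> perm_subgroup V H G"
  using F by (simp add: normal_filter_def subgroup_filter_def)

lemma F_superset: "H \<in> E F \<Longrightarrow> perm_subgroup V K G \<Longrightarrow> E H \<subseteq> E K \<Longrightarrow> K \<in> E F"
  using F unfolding normal_filter_def subgroup_filter_def by blast

lemma F_Int: "H \<in> E F \<Longrightarrow> K \<in> E F \<Longrightarrow> Set (E H \<inter> E K) \<in> E F"
  using F unfolding normal_filter_def subgroup_filter_def by blast

lemma F_conj: "H \<in> E F \<Longrightarrow> p \<in> E G \<Longrightarrow> ac p H \<in> E F"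
  using F F_subgroup[of H] conjugate_eq[of p H] unfolding normal_filter_def subgroup_iff by metis

lemma G_in_F: "G \<in> E F"
proof -
  obtain H where "H \<in> E F" using F by (auto simp: normal_filter_def subgroup_filter_def)
  then show ?thesis using F_superset[of H G] F_subgroup[of H] G by (auto simp: perm_subgroup_def)
qed

text \<open>This is where normality enters: conjugation by \<open>p\<close> and by its inverse both
  map the filter into itself. Hence \<open>F\<close> may serve as a parameter in invariance
  arguments.\<close>

lemma ac_F: assumes p: "p \<in> E G" shows "ac p F = F"
proof (rule is_set_ext)
  have "H \<in> ac p ` E F" if "H \<in> E F" for H
    by (rule image_eqI[of _ _ "ac (perm_inv V p) H"]) (simp_all add: p that F_conj elts_in[OF that])
  then show "E (ac p F) = E F" using p F_conj by (auto simp: elts_ac)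
qed (use is_set_ac[of p F] elts_in p F in \<open>auto simp: normal_filter_def subgroup_filter_def\<close>)

section \<open>Hereditarily symmetric objects\<close>

abbreviation N :: "'v set" where "N \<equiv> HS V G F"

text \<open>A transitive superset bounds the intersection, so separation applies. The second part,
  with \<open>s 1\<close> in the role of \<open>x\<close>, is the definability needed for
  \<open>D_HS\<close>.\<close>

lemma coded_transitive_closure:
  assumes "x \<in> C"
  shows "coded {y \<in> C. \<forall>t. transitive_set V t \<and> E x \<subseteq> E t \<longrightarrow> y \<in> E t}" (is "coded ?T")
    and "D {} (\<lambda>s. \<forall>t. transitive_set V t \<and> E (s 1) \<subseteq> E t \<longrightarrow> s 0 \<in> E t)"
proof -
  show D: "D {} (\<lambda>s. \<forall>t. transitive_set V t \<and> E (s 1) \<subseteq> E t \<longrightarrow> s 0 \<in> E t)"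
    unfolding transitive_set_def
    by (intro D_all_unbounded D_intros D_subset) (auto simp: is_set_def)
  obtain t where t: "t \<in> C" "x \<in> E t" "\<And>u. u \<in> E t \<Longrightarrow> E u \<subseteq> E t"
    by (rule transitive_superset[OF assms]) blast
  have "is_set V t" using t atom_elts[of t] by (auto simp: is_set_def)
  then have sub: "?T \<subseteq> E t" using t by (auto simp: transitive_set_def)
  show "coded ?T"
    by (rule coded_Collect[OF coded_elts[OF t(1)], of _ "{x}"], use sub in blast,
        intro D_conj D_carrier DT_var D_subst2[OF DT_var DT_param D]) (use assms in auto)
qed

lemma elts_transitive_closure: "x \<in> C \<Longrightarrow>
    y \<in> E (transitive_closure V x) \<longleftrightarrow> y \<in> C \<and> (\<forall>t. transitive_set V t \<and> E x \<subseteq> E t \<longrightarrow> y \<in> E t)"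
  by (simp add: transitive_closure_def elts_the_set coded_transitive_closure)

lemma D_HS: assumes t: "DT K t" and K: "{G, F} \<subseteq> K" shows "D K (\<lambda>s. t s \<in> N)"
proof (rule D_subst1[OF t _ K])
  note D = D_subst2[OF DT_var DT_var coded_transitive_closure(2)[OF emptyset_in], of "{G, F}"]
  have "D {G, F} (\<lambda>s. Sym (s 0) \<in> E F \<and>
      (\<forall>y\<in>C. (\<forall>t. transitive_set V t \<and> E (s 0) \<subseteq> E t \<longrightarrow> y \<in> E t) \<longrightarrow> Sym y \<in> E F))"
    by (intro D_intros D DT_sym DT_param) auto
  then show "D {G, F} (\<lambda>s. s 0 \<in> N)"
    by (rule D_cong[rotated])
      (auto simp: HS_def symmetric_def elts_transitive_closure assignment_in)
qed

lemma HS_in: "x \<in> N \<Longrightarrow> x \<in> C"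
  by (simp add: HS_def)

lemma HS_sym: "x \<in> N \<Longrightarrow> Sym x \<in> E F"
  by (simp add: HS_def symmetric_def)

lemma HS_elts: assumes x: "x \<in> N" and y: "y \<in> E x" shows "y \<in> N"
proof -
  have xC: "x \<in> C" and yC: "y \<in> C" using x y elts_in HS_in by blast+
  have yx: "y \<in> E (transitive_closure V x)"
    using y yC unfolding elts_transitive_closure[OF xC] by blast
  have "E (transitive_closure V y) \<subseteq> E (transitive_closure V x)"
    unfolding subset_iff elts_transitive_closure[OF xC] elts_transitive_closure[OF yC]
    using y by (auto simp: transitive_set_def)
  then show ?thesis using x yx yC unfolding HS_def by blast
qed

text \<open>The members of the transitive closure of \<open>x\<close> that lie in \<open>N\<close>
  form a transitive set containing the elements of \<open>x\<close>, so they exhaust the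
  closure.\<close>

lemma HS_intro:
  assumes x: "x \<in> C" and s: "Sym x \<in> E F" and el: "E x \<subseteq> N" shows "x \<in> N"
proof -
  have T: "coded {y. y \<in> C \<and> (\<forall>t. transitive_set V t \<and> E x \<subseteq> E t \<longrightarrow> y \<in> E t)}"
    using coded_transitive_closure(1)[OF x] .
  define S where "S = {y \<in> E (transitive_closure V x). y \<in> N}"
  have S: "coded S" unfolding S_def
    by (rule separation[of "{G, F}"], intro D_HS DT_var)
      (auto simp: transitive_closure_def T the_set_in)
  have trans: "z \<in> E (transitive_closure V x)" if "y \<in> E (transitive_closure V x)" "z \<in> E y" for y z
    using that elts_in[OF that(2)] unfolding elts_transitive_closure[OF x] transitive_set_def by blast
  have "\<forall>y\<in>S. E y \<subseteq> S" unfolding S_def using trans HS_elts by blast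
  then have "transitive_set V (Set S)"
    unfolding transitive_set_def by (simp add: elts_the_set[OF S] is_set_the_set[OF S])
  moreover have "E x \<subseteq> E (Set S)"
    unfolding elts_the_set[OF S]
    unfolding S_def subset_iff mem_Collect_eq elts_transitive_closure[OF x] using el elts_in by blast
  ultimately have "E (transitive_closure V x) \<subseteq> E (Set S)"
    using elts_transitive_closure[OF x] by blast
  then have "E (transitive_closure V x) \<subseteq> S" by (simp add: elts_the_set[OF S])
  then show ?thesis
    using x s unfolding S_def HS_def symmetric_def by blast
qed

lemma HS_I:
  assumes x: "x \<in> C" and H: "H \<in> E F" "\<And>p. p \<in> E H \<Longrightarrow> ac p x = x" and el: "E x \<subseteq> N"
  shows "x \<in> N"
proof (rule HS_intro[OF x _ el])
  show "Sym x \<in> E F"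
    by (rule F_superset[OF H(1) sym_subgroup[OF x]])
      (use H F_subgroup[OF H(1)] in \<open>auto simp: elts_sym x subgroup_iff\<close>)
qed

text \<open>The class \<open>N\<close> is definable from \<open>G\<close> and \<open>F\<close>, and
  \<open>p\<close> fixes both.\<close>

lemma HS_ac: assumes "p \<in> E G" "x \<in> C" shows "ac p x \<in> N \<longleftrightarrow> x \<in> N"
  by (rule D_invariant1[OF automorphism_G[OF assms(1)] _ D_HS[OF DT_var subset_refl]])
    (auto simp: ac_G ac_F assms)

lemma HS_upair: assumes x: "x \<in> N" and y: "y \<in> N" shows "upair x y \<in> N"
proof (rule HS_I[OF _ F_Int[OF HS_sym[OF x] HS_sym[OF y]]])
  have xy: "x \<in> C" "y \<in> C" using HS_in x y by blast+
  then show "upair x y \<in> C" by simp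
  show "E (upair x y) \<subseteq> N" using x y xy by simp
  have "coded (E (Sym x) \<inter> E (Sym y))" by (intro coded_Int coded_elts sym_in xy)
  then show "ac p (upair x y) = upair x y" if "p \<in> E (Set (E (Sym x) \<inter> E (Sym y)))" for p
    using that xy by (auto simp: elts_the_set elts_sym ac_upair)
qed

lemma HS_opair: "x \<in> N \<Longrightarrow> y \<in> N \<Longrightarrow> opair x y \<in> N"
  unfolding opair_def by (intro HS_upair)

lemma HS_opair_iff: "x \<in> C \<Longrightarrow> y \<in> C \<Longrightarrow> opair x y \<in> N \<longleftrightarrow> x \<in> N \<and> y \<in> N"
  using HS_opair[of x y] HS_elts[of "opair x y" "upair x y"] HS_elts[of "upair x y" x]
    HS_elts[of "upair x y" y] by auto

lemma HS_empty: "emptyset \<in> N"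
  by (rule HS_I[OF _ G_in_F]) (auto simp: ac_nat)

lemma HS_insert: assumes x: "x \<in> N" and y: "y \<in> N" shows "Set (insert x (E y)) \<in> N"
proof (rule HS_I[OF _ HS_sym[OF HS_opair[OF x y]]])
  have xy: "x \<in> C" "y \<in> C" using HS_in x y by blast+
  then have c: "coded (insert x (E y))" by (intro coded_insert coded_elts)
  then show "Set (insert x (E y)) \<in> C" by (rule the_set_in)
  show "E (Set (insert x (E y))) \<subseteq> N" using c x y HS_elts by (auto simp: elts_the_set)
  show "ac p (Set (insert x (E y))) = Set (insert x (E y))" if "p \<in> E (Sym (opair x y))" for p
  proof (rule is_set_ext)
    have p: "p \<in> E G" "ac p x = x" "ac p y = y"
      using that xy by (auto simp: elts_sym ac_opair)
    show "E (ac p (Set (insert x (E y)))) = E (Set (insert x (E y)))"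
      using elts_ac[OF p(1) xy(2)] p c by (simp add: elts_ac the_set_in elts_the_set)
    show "is_set V (ac p (Set (insert x (E y))))" "is_set V (Set (insert x (E y)))"
      using c is_set_ac elts_in[OF p(1)] by (simp_all add: is_set_the_set)
  qed
qed

lemma HS_nat: "n \<in> E \<omega> \<Longrightarrow> n \<in> N"
proof (rule omega_induct[of n "{G, F}" "\<lambda>n. n \<in> N"])
  show "succ V n \<in> N" if "n \<in> N" for n
    using HS_insert[OF that that] by (simp add: succ_def)
qed (auto intro: D_HS DT_var HS_empty)

lemma HS_omega: "\<omega> \<in> N"
  by (rule HS_I[OF _ G_in_F]) (auto simp: automorphism_omega automorphism_G HS_nat)

section \<open>The essential subfilter\<close>

text \<open>The subgroups containing some stabilizer already form a filter, without finite
  intersections being added: the stabilizer of \<open>opair x y\<close> lies in those of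
  \<open>x\<close> and \<open>y\<close>.\<close>

lemma elts_essential:
  "H \<in> E (essential_subfilter V G F) \<longleftrightarrow> perm_subgroup V H G \<and> (\<exists>x\<in>N. E (Sym x) \<subseteq> E H)"
proof -
  let ?S = "{H \<in> E F. \<exists>x\<in>N. E (Sym x) \<subseteq> E H}"
  have "D {G, F} (\<lambda>s. \<exists>x. x \<in> N \<and> E (Sym x) \<subseteq> E (s 0))"
    by (intro D_ex_unbounded D_conj D_HS D_subset DT_sym DT_var) (auto simp: HS_in)
  from separation[OF this F_in] have S: "coded ?S" by (simp add: Bex_def)
  have S_iff: "H \<in> ?S \<longleftrightarrow> perm_subgroup V H G \<and> (\<exists>x\<in>N. E (Sym x) \<subseteq> E H)" for H
    using F_subgroup F_superset HS_sym by blast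
  have filter: "subgroup_filter V G (Set ?S)"
    unfolding subgroup_filter_def elts_the_set[OF S]
  proof (intro conjI ballI allI impI)
    show "is_set V (Set ?S)" using S by (rule is_set_the_set)
    have "G \<in> ?S" using G_in_F HS_empty by (auto simp: elts_sym intro!: bexI[of _ emptyset])
    then show "?S \<noteq> {}" by blast
    show "perm_subgroup V H G" if "H \<in> ?S" for H using that F_subgroup by blast
    show "K \<in> ?S" if "H \<in> ?S" "perm_subgroup V K G \<and> E H \<subseteq> E K" for H K
      using that unfolding S_iff by blast
    show "Set (E H \<inter> E K) \<in> ?S" if H: "H \<in> ?S" and K: "K \<in> ?S" for H K
    proof -
      obtain x y where xy: "x \<in> N" "y \<in> N" "E (Sym x) \<subseteq> E H" "E (Sym y) \<subseteq> E K" using H K by blast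
      have "coded (E H \<inter> E K)" using H K elts_in by (intro coded_Int coded_elts) blast+
      moreover have "E (Sym (opair x y)) \<subseteq> E (Sym x) \<inter> E (Sym y)"
        using HS_in[OF xy(1)] HS_in[OF xy(2)] by (auto simp: elts_sym ac_opair)
      ultimately have "E (Sym (opair x y)) \<subseteq> E (Set (E H \<inter> E K))"
        using xy by (auto simp: elts_the_set)
      then show ?thesis using F_Int H K HS_opair[OF xy(1,2)] by blast
    qed
  qed
  have sub: "\<forall>x\<in>N. Sym x \<in> E (Set ?S)" unfolding elts_the_set[OF S] using HS_sym by blast
  have "{H \<in> C. \<forall>D. subgroup_filter V G D \<and> (\<forall>x\<in>N. Sym x \<in> E D) \<longrightarrow> H \<in> E D} = ?S" (is "?L = _")
  proof
    show "?L \<subseteq> ?S" using filter sub elts_the_set[OF S] by blast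
    show "?S \<subseteq> ?L"
    proof
      fix H assume H: "H \<in> ?S"
      then obtain x where x: "x \<in> N" "E (Sym x) \<subseteq> E H" "perm_subgroup V H G" unfolding S_iff by blast
      have "H \<in> E D" if "subgroup_filter V G D" "\<forall>x\<in>N. Sym x \<in> E D" for D
        using that x unfolding subgroup_filter_def by blast
      moreover have "H \<in> C" using H elts_in by blast
      ultimately show "H \<in> ?L" by blast
    qed
  qed
  then have "E (essential_subfilter V G F) = ?S"
    by (simp only: essential_subfilter_def elts_the_set[OF S])
  then show ?thesis using S_iff by blast
qed

end

context zfa
begin

section \<open>Sequences of finite or infinite length\<close>

lemma is_pair_opair: "x \<in> C \<Longrightarrow> y \<in> C \<Longrightarrow> is_pair V (opair x y) x y"
  by (simp add: is_pair_iff)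

text \<open>A function with domain \<open>E m\<close> and no prescribed codomain. Nodes of a tree
  have a natural number as \<open>m\<close>, branches have \<omega>.\<close>

definition seq :: "'v \<Rightarrow> 'v \<Rightarrow> bool" where
  "seq m t \<longleftrightarrow> is_set V t \<and> (\<forall>r\<in>E t. \<exists>i\<in>E m. \<exists>y. is_pair V r i y) \<and> (\<forall>i\<in>E m. \<exists>!y. rel V t i y)"

lemma D_seq: assumes "DT K t" "DT K u" shows "D K (\<lambda>s. seq (t s) (u s))"
  unfolding seq_def
  by (intro D_ex_unbounded D_ex1_unbounded D_intros D_is_pair D_rel DT_shift assms)
    (auto simp: is_pair_iff rel_iff)

lemma seq_in: "seq m t \<Longrightarrow> t \<in> C"
  by (simp add: seq_def is_set_def)

lemma function_seq: "is_function V f X Y \<Longrightarrow> seq X f"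
  unfolding is_function_def is_relation_def seq_def by blast

lemma seq_rel_iff: assumes t: "seq m t" shows "rel V t i y \<longleftrightarrow> i \<in> E m \<and> y = ap t i"
proof -
  have "i \<in> E m" if r: "rel V t i y"
  proof -
    have "opair i y \<in> E t" and iy: "i \<in> C" "y \<in> C" using r by (auto simp: rel_iff)
    then obtain j z where j: "j \<in> E m" "is_pair V (opair i y) j z" using t unfolding seq_def by blast
    then show ?thesis using iy by (auto simp: is_pair_iff)
  qed
  moreover have "rel V t i y \<longleftrightarrow> y = ap t i" if "i \<in> E m"
    using t that ap_eq[of t i y] unfolding seq_def by blast
  ultimately show ?thesis by blast
qed

lemma seq_elts: assumes t: "seq m t" shows "E t = (\<lambda>i. opair i (ap t i)) ` E m"
proof -
  have "r \<in> (\<lambda>i. opair i (ap t i)) ` E m" if r: "r \<in> E t" for r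
  proof -
    obtain i y where i: "i \<in> E m" "is_pair V r i y" using t r unfolding seq_def by blast
    then have "rel V t i y" using r by (simp add: rel_iff is_pair_iff)
    then show ?thesis using i seq_rel_iff[OF t] by (auto simp: is_pair_iff)
  qed
  moreover have "opair i (ap t i) \<in> E t" if "i \<in> E m" for i
    using seq_rel_iff[OF t, of i "ap t i"] that by (simp add: rel_iff)
  ultimately show ?thesis by blast
qed

lemma seq_is_set: "seq m t \<Longrightarrow> is_set V t"
  by (simp add: seq_def)

lemma seq_ext: "seq m t \<Longrightarrow> seq m t' \<Longrightarrow> (\<And>i. i \<in> E m \<Longrightarrow> ap t i = ap t' i) \<Longrightarrow> t = t'"
  by (rule is_set_ext) (simp_all add: seq_is_set seq_elts)

lemma seq_length: "seq m t \<Longrightarrow> seq n t \<Longrightarrow> E m = E n"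
  using seq_rel_iff by blast

lemma seq_length_nat: "seq m t \<Longrightarrow> seq n t \<Longrightarrow> m \<in> E \<omega> \<Longrightarrow> n \<in> E \<omega> \<Longrightarrow> m = n"
  using seq_length[of m t n] nat_is_set[of m] nat_is_set[of n] is_set_ext[of m n] by simp

lemma seqI:
  assumes "is_set V t" "E t = (\<lambda>i. opair i (f i)) ` E m" "\<And>i. i \<in> E m \<Longrightarrow> f i \<in> C"
  shows "seq m t" and "i \<in> E m \<Longrightarrow> ap t i = f i"
proof -
  have r: "rel V t i y \<longleftrightarrow> i \<in> E m \<and> y = f i" for i y
    using assms(2,3) elts_in by (auto simp: rel_iff)
  show "seq m t" unfolding seq_def r
    using assms by (auto intro!: bexI exI is_pair_opair simp: elts_in)
  then show "ap t i = f i" if "i \<in> E m" using r[of i "ap t i"] seq_rel_iff[of m t i "ap t i"] that by simp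
qed

definition restr :: "'v \<Rightarrow> 'v \<Rightarrow> 'v" where
  "restr t n = Set {r. r \<in> E t \<and> (\<exists>i\<in>E n. \<exists>y. is_pair V r i y)}"

lemma coded_restr: "t \<in> C \<Longrightarrow> n \<in> C \<Longrightarrow> coded {r. r \<in> E t \<and> (\<exists>i\<in>E n. \<exists>y. is_pair V r i y)}"
  by (rule separation[of "{n}"], intro D_ex_unbounded D_bex D_is_pair DT_var DT_param)
    (auto simp: is_pair_iff)

lemma DT_restr: assumes "DT K t" "DT K u" shows "DT K (\<lambda>s. restr (t s) (u s))"
proof (rule DT_subst2[OF assms, of "{}"])
  show "DT {} (\<lambda>s. restr (s 0) (s 1))" unfolding restr_def
  proof (rule DT_the_set)
    show "coded {r. r \<in> E (s 0) \<and> (\<exists>i\<in>E (s 1). \<exists>y. is_pair V r i y)}" if "assignment s" for s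
      by (rule coded_restr) (simp_all add: assignment_in that)
  qed (intro D_ex_unbounded D_intros D_is_pair, simp add: is_pair_iff)
qed simp

lemma elts_restr: "t \<in> C \<Longrightarrow> n \<in> C \<Longrightarrow> E (restr t n) = {r \<in> E t. \<exists>i\<in>E n. \<exists>y. is_pair V r i y}"
  by (simp add: restr_def elts_the_set coded_restr)

lemma restr_in: "t \<in> C \<Longrightarrow> n \<in> C \<Longrightarrow> restr t n \<in> C"
  by (simp add: restr_def the_set_in coded_restr)

lemma is_set_restr: "t \<in> C \<Longrightarrow> n \<in> C \<Longrightarrow> is_set V (restr t n)"
  by (simp add: restr_def is_set_the_set coded_restr)

lemma elts_restr_seq:
  assumes t: "seq m t" and n: "n \<in> C" "E n \<subseteq> E m" shows "E (restr t n) = (\<lambda>i. opair i (ap t i)) ` E n"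
proof
  show "(\<lambda>i. opair i (ap t i)) ` E n \<subseteq> E (restr t n)"
    using n(2) elts_in[of _ n] unfolding elts_restr[OF seq_in[OF t] n(1)] seq_elts[OF t]
    by (auto intro!: bexI exI is_pair_opair)
  show "E (restr t n) \<subseteq> (\<lambda>i. opair i (ap t i)) ` E n"
    using elts_in unfolding elts_restr[OF seq_in[OF t] n(1)] seq_elts[OF t] by (auto simp: is_pair_iff)
qed

lemma seq_restr:
  assumes t: "seq m t" and n: "n \<in> C" "E n \<subseteq> E m"
  shows "seq n (restr t n)" and "i \<in> E n \<Longrightarrow> ap (restr t n) i = ap t i"
  using seqI[OF is_set_restr[OF seq_in[OF t] n(1)] elts_restr_seq[OF t n] ap_in] by simp_all

lemma restr_mono: "t \<in> C \<Longrightarrow> n \<in> C \<Longrightarrow> m \<in> C \<Longrightarrow> E n \<subseteq> E m \<Longrightarrow> E (restr t n) \<subseteq> E (restr t m)"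
  unfolding elts_restr by blast

lemma restr_restr: "t \<in> C \<Longrightarrow> n \<in> C \<Longrightarrow> m \<in> C \<Longrightarrow> E n \<subseteq> E m \<Longrightarrow> restr (restr t m) n = restr t n"
  by (rule is_set_ext) (simp_all add: is_set_restr restr_in elts_restr, blast)

lemma restr_zero: "t \<in> C \<Longrightarrow> restr t emptyset = emptyset"
  using codes_emptyset by (intro is_set_ext) (simp_all add: is_set_restr elts_restr codes_def)

lemma restr_succ:
  assumes x: "seq \<omega> x" and n: "n \<in> E \<omega>"
  shows "restr x (succ V n) = Set (insert (opair n (ap x n)) (E (restr x n)))"
proof -
  have nC: "n \<in> C" using n elts_in by blast
  have c: "coded (insert (opair n (ap x n)) (E (restr x n)))"
    by (intro coded_insert coded_elts restr_in seq_in[OF x]) (simp_all add: nC)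
  have "E (succ V n) \<subseteq> E \<omega>" "E n \<subseteq> E \<omega>"
    using omega_elts_subset[OF succ_in_omega[OF n]] omega_elts_subset[OF n] .
  then have "E (restr x (succ V n)) = insert (opair n (ap x n)) (E (restr x n))"
    using elts_restr_seq[OF x] nC by simp
  then show ?thesis using c
    by (intro is_set_ext) (simp_all add: is_set_restr seq_in[OF x] nC is_set_the_set elts_the_set)
qed

lemma seq_insert:
  assumes t: "seq m t" and m: "m \<in> C" and y: "y \<in> C"
  shows "seq (succ V m) (Set (insert (opair m y) (E t)))"
    and "coded (insert (opair m y) (E t))"
proof -
  show c: "coded (insert (opair m y) (E t))"
    by (intro coded_insert coded_elts seq_in[OF t]) (simp_all add: m y)
  have e: "E (Set (insert (opair m y) (E t))) = insert (opair m y) (E t)" by (rule elts_the_set[OF c])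
  have "E (Set (insert (opair m y) (E t)))
      = (\<lambda>i. opair i (if i = m then y else ap t i)) ` E (succ V m)"
    using not_mem_self[of m] unfolding e by (auto simp: seq_elts[OF t] m)
  from seqI(1)[OF is_set_the_set[OF c] this] show "seq (succ V m) (Set (insert (opair m y) (E t)))"
    using y by simp
qed

definition ran_union :: "'v \<Rightarrow> 'v" where
  "ran_union s = Set {r. \<exists>n y. rel V s n y \<and> r \<in> E y}"

lemma coded_ran_union: assumes s: "s \<in> C" shows "coded {r. \<exists>n y. rel V s n y \<and> r \<in> E y}"
proof -
  obtain a where a: "a \<in> C" "\<And>x y. rel V s x y \<Longrightarrow> y \<in> E a" using coded_rel_fields[OF s] by blast
  have "D {s} (\<lambda>e. \<exists>n y. rel V s n y \<and> e 0 \<in> E y)"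
    by (intro D_ex_unbounded D_intros D_rel DT_param) (auto simp: s rel_iff)
  then show ?thesis by (rule coded_Collect[OF coded_Union[OF a(1)], rotated]) (use a(2) in blast)
qed

lemma DT_ran_union: assumes "DT K t" shows "DT K (\<lambda>s. ran_union (t s))"
proof (rule DT_subst1[OF assms, of "{}"])
  show "DT {} (\<lambda>s. ran_union (s 0))" unfolding ran_union_def
  proof (rule DT_the_set)
    show "coded {r. \<exists>n y. rel V (s 0) n y \<and> r \<in> E y}" if "assignment s" for s
      by (rule coded_ran_union) (simp add: assignment_in that)
  qed (intro D_ex_unbounded D_intros D_rel, auto simp: rel_iff)
qed simp

section \<open>The relation of one-step extension on a tree of finite sequences\<close>

definition extends :: "'v \<Rightarrow> 'v \<Rightarrow> bool" where
  "extends t t' \<longleftrightarrow> (\<exists>m\<in>E \<omega>. seq m t \<and> seq (succ V m) t' \<and> E t \<subseteq> E t')"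

definition extension :: "'v \<Rightarrow> 'v" where
  "extension T = Set {r. \<exists>t\<in>E T. \<exists>t'\<in>E T. r = opair t t' \<and> extends t t'}"

lemma D_extends: assumes "DT K t" "DT K u" shows "D K (\<lambda>s. extends (t s) (u s))"
  unfolding extends_def by (intro D_intros D_seq D_subset DT_omega DT_succ DT_shift assms)

lemma coded_extension:
  assumes T: "T \<in> C" shows "coded {r. \<exists>t\<in>E T. \<exists>t'\<in>E T. r = opair t t' \<and> extends t t'}"
proof -
  have "coded {r. \<exists>t\<in>E T. \<exists>t'\<in>E T. r = opair t t'}"
    by (rule coded_UN2[of "{}" opair]) (auto intro: DT_opair DT_var T)
  then show ?thesis
  proof (rule coded_Collect[of _ _ "{T}"])
    show "D {T} (\<lambda>s. \<exists>t\<in>E T. \<exists>t'\<in>E T. s 0 = opair t t' \<and> extends t t')"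
      by (intro D_intros DT_opair D_extends DT_param) (simp_all add: T)
  qed blast
qed

lemma DT_extension: assumes "DT K t" shows "DT K (\<lambda>s. extension (t s))"
proof (rule DT_subst1[OF assms, of "{}"])
  show "DT {} (\<lambda>s. extension (s 0))" unfolding extension_def
  proof (rule DT_the_set)
    show "coded {r. \<exists>t\<in>E (s 0). \<exists>t'\<in>E (s 0). r = opair t t' \<and> extends t t'}" if "assignment s" for s
      by (rule coded_extension) (simp add: assignment_in that)
  qed (intro D_intros D_extends DT_opair)
qed simp

lemma elts_extension: "T \<in> C \<Longrightarrow>
    E (extension T) = {r. \<exists>t\<in>E T. \<exists>t'\<in>E T. r = opair t t' \<and> extends t t'}"
  by (simp add: extension_def elts_the_set coded_extension)

lemma rel_extension: "T \<in> C \<Longrightarrow> rel V (extension T) t t' \<longleftrightarrow> t \<in> E T \<and> t' \<in> E T \<and> extends t t'"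
  by (auto simp: rel_iff elts_extension elts_in)

section \<open>Transitive submodels\<close>

context
  fixes N :: "'v set"
  assumes N_sub: "N \<subseteq> C" and N_closed: "\<forall>x\<in>N. E x \<subseteq> N" and N_omega: "\<omega> \<in> N"
begin

lemma N_trans: "x \<in> N \<Longrightarrow> y \<in> E x \<Longrightarrow> y \<in> N"
  using N_closed by blast

abbreviation M :: "'v universe" where "M \<equiv> V\<lparr>carrier := N\<rparr>"

lemma elts_M: "x \<in> N \<Longrightarrow> elts M x = E x"
  using N_sub N_trans by (auto simp: elts_def)

lemma is_set_M: "is_set M x \<longleftrightarrow> x \<in> N \<and> is_set V x"
  using N_sub by (auto simp: is_set_def)

lemma codes_M: "codes M x S \<longleftrightarrow> x \<in> N \<and> codes V x S"
  using elts_M by (auto simp: codes_def is_set_M)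

lemma is_pair_M: "p \<in> N \<Longrightarrow> is_pair M p x y \<longleftrightarrow> is_pair V p x y"
proof -
  assume p: "p \<in> N"
  have "a \<in> N \<and> b \<in> N" if "codes V p {a, b}" for a b
    using N_trans[OF p] that by (auto simp: codes_def)
  then show ?thesis unfolding is_pair_def codes_M using p by blast
qed

lemma rel_M: "f \<in> N \<Longrightarrow> rel M f x y \<longleftrightarrow> rel V f x y"
  unfolding rel_def using is_pair_M N_trans by (auto simp: elts_M)

lemma is_relation_M: "f \<in> N \<Longrightarrow> X \<in> N \<Longrightarrow> Y \<in> N \<Longrightarrow> is_relation M f X Y \<longleftrightarrow> is_relation V f X Y"
  unfolding is_relation_def using is_pair_M N_trans by (auto simp: elts_M is_set_M)

lemma is_function_M:
  assumes "X \<in> N" "Y \<in> N" shows "is_function M f X Y \<longleftrightarrow> f \<in> N \<and> is_function V f X Y"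
proof (cases "f \<in> N")
  case True
  have "rel M f = rel V f" by (intro ext rel_M True)
  then show ?thesis using True assms by (simp add: is_function_def is_relation_M elts_M)
next
  case False
  then show ?thesis by (simp add: is_function_def is_relation_def is_set_M)
qed

lemma is_inductive_M: "is_inductive M w \<longleftrightarrow> w \<in> N \<and> is_inductive V w"
proof (cases "w \<in> N")
  case True
  then show ?thesis unfolding is_inductive_def elts_M[OF True] using N_trans[OF True]
    by (simp add: is_set_M codes_M elts_M)
qed (simp add: is_inductive_def is_set_M)

lemma is_omega_M: "is_omega M w \<longleftrightarrow> w = \<omega>"
proof
  assume w: "is_omega M w"
  then have w': "w \<in> N" "is_inductive V w" by (simp_all add: is_omega_def is_inductive_M)
  have "elts M w \<subseteq> elts M \<omega>"
    using w N_omega omega_inductive unfolding is_omega_def is_inductive_M by blast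
  then have "E w \<subseteq> E \<omega>" using elts_M[OF w'(1)] elts_M[OF N_omega] by simp
  then show "w = \<omega>" using omega_subset[OF w'(2)] w'(2)
    by (intro is_set_ext) (auto simp: is_inductive_def)
next
  assume "w = \<omega>"
  then show "is_omega M w"
    using N_omega omega_inductive omega_subset by (auto simp: is_omega_def is_inductive_M elts_M)
qed

text \<open>Pairs, functions and \<omega> are absolute for a transitive class containing \<omega>,
  so only the range of the outer quantifiers changes. The case \<open>N = C\<close> reformulates
  dependent choice in \<open>V\<close> itself.\<close>

lemma DC_M: "DC M \<longleftrightarrow> (\<forall>X\<in>N. \<forall>R\<in>N. is_set V X \<and> E X \<noteq> {} \<and> is_relation V R X X \<and>
      (\<forall>x\<in>E X. \<exists>y\<in>E X. rel V R x y) \<longrightarrow>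
    (\<exists>s\<in>N. is_function V s \<omega> X \<and> (\<forall>n\<in>E \<omega>. rel V R (ap s n) (ap s (succ V n)))))"
proof -
  have step: "(\<forall>n\<in>elts M \<omega>. \<forall>m\<in>elts M \<omega>. codes M m (insert n (elts M n)) \<longrightarrow>
      (\<forall>x y. rel M s n x \<and> rel M s m y \<longrightarrow> rel M R x y)) \<longleftrightarrow>
    (\<forall>n\<in>E \<omega>. rel V R (ap s n) (ap s (succ V n)))"
    if "s \<in> N" "R \<in> N" "is_function V s \<omega> X" for s R X
  proof -
    have "codes M m (insert n (elts M n)) \<longleftrightarrow> m = succ V n" if "n \<in> E \<omega>" "m \<in> E \<omega>" for n m
      using that N_trans[OF N_omega] codes_succ[of n m] elts_in[of n \<omega>] by (simp add: codes_M elts_M)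
    then show ?thesis
      using that by (auto simp: elts_M[OF N_omega] rel_M function_rel_iff)
  qed
  have concl: "(\<exists>w s. is_omega M w \<and> is_function M s w X \<and>
       (\<forall>n\<in>elts M w. \<forall>m\<in>elts M w. codes M m (insert n (elts M n)) \<longrightarrow>
         (\<forall>x y. rel M s n x \<and> rel M s m y \<longrightarrow> rel M R x y))) \<longleftrightarrow>
    (\<exists>s\<in>N. is_function V s \<omega> X \<and> (\<forall>n\<in>E \<omega>. rel V R (ap s n) (ap s (succ V n))))"
    if "X \<in> N" "R \<in> N" for X R
    unfolding is_omega_M simp_thms Bex_def is_function_M[OF N_omega that(1)]
  proof (rule trans[OF ex_comm], rule ex_cong1)
    fix s
    show "(\<exists>w. w = \<omega> \<and> is_function M s w X \<and>
         (\<forall>n\<in>elts M w. \<forall>m\<in>elts M w. codes M m (insert n (elts M n)) \<longrightarrow>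
           (\<forall>x y. rel M s n x \<and> rel M s m y \<longrightarrow> rel M R x y))) \<longleftrightarrow>
      s \<in> N \<and> is_function V s \<omega> X \<and> (\<forall>n\<in>E \<omega>. rel V R (ap s n) (ap s (succ V n)))"
    proof (cases "s \<in> N \<and> is_function V s \<omega> X")
      case True
      then show ?thesis
        unfolding simp_thms is_function_M[OF N_omega that(1)] step[OF conjunct1[OF True] that(2) conjunct2[OF True]]
        by blast
    next
      case False
      then show ?thesis
        unfolding simp_thms is_function_M[OF N_omega that(1)] by blast
    qed
  qed
  have hyp: "is_set M X \<and> elts M X \<noteq> {} \<and> is_relation M R X X \<and>
      (\<forall>x\<in>elts M X. \<exists>y\<in>elts M X. rel M R x y) \<longleftrightarrow>
    X \<in> N \<and> R \<in> N \<and> is_set V X \<and> E X \<noteq> {} \<and> is_relation V R X X \<and>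
      (\<forall>x\<in>E X. \<exists>y\<in>E X. rel V R x y)" for X R
    by (cases "X \<in> N"; cases "R \<in> N")
      (simp_all add: is_set_M elts_M is_relation_M rel_M, simp_all add: is_relation_def is_set_M)
  show ?thesis unfolding DC_def hyp using concl by blast
qed

text \<open>
  A branch through a tree of finite sequences needs no control over where the chain supplied by
  dependent choice starts, since its union has all the shorter restrictions as well.
\<close>

theorem tree_branch:
  assumes DC: "DC M" and T: "T \<in> N" "is_set V T" "E T \<noteq> {}" and R: "extension T \<in> N"
    and union: "\<And>s. s \<in> N \<Longrightarrow> ran_union s \<in> N"
    and fin: "\<And>t. t \<in> E T \<Longrightarrow> \<exists>m\<in>E \<omega>. seq m t"
    and ext: "\<And>t m. t \<in> E T \<Longrightarrow> m \<in> E \<omega> \<Longrightarrow> seq m t \<Longrightarrow>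
      \<exists>t'\<in>E T. seq (succ V m) t' \<and> E t \<subseteq> E t'"
    and res: "\<And>t m n. t \<in> E T \<Longrightarrow> m \<in> E \<omega> \<Longrightarrow> seq m t \<Longrightarrow> n \<in> E m \<Longrightarrow> restr t n \<in> E T"
  obtains u where "u \<in> N" "seq \<omega> u" "\<And>n. n \<in> E \<omega> \<Longrightarrow> restr u n \<in> E T"
proof -
  have TC: "T \<in> C" using T(1) N_sub by blast
  have "is_relation V (extension T) T T"
    unfolding is_relation_def elts_extension[OF TC]
    using coded_extension[OF TC] by (auto simp: extension_def is_set_the_set is_pair_iff elts_in)
  moreover have "\<forall>x\<in>E T. \<exists>y\<in>E T. rel V (extension T) x y"
    unfolding rel_extension[OF TC] extends_def using fin ext by blast
  ultimately obtain s where s: "s \<in> N" "is_function V s \<omega> T"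
    and step: "\<And>n. n \<in> E \<omega> \<Longrightarrow> rel V (extension T) (ap s n) (ap s (succ V n))"
    using DC T R unfolding DC_M by blast
  have sC: "s \<in> C" using s N_sub by blast
  have sT: "ap s k \<in> E T" if "k \<in> E \<omega>" for k using function_ap[OF s(2) that] .
  have st: "seq (succ V m) (ap s (succ V k))" "E (ap s k) \<subseteq> E (ap s (succ V k))"
    if k: "k \<in> E \<omega>" and m: "m \<in> E \<omega>" "seq m (ap s k)" for k m
    using step[OF k] seq_length_nat[OF m(2) _ m(1)] unfolding rel_extension[OF TC] extends_def by blast+
  have mono: "\<forall>k\<in>E l. E (ap s k) \<subseteq> E (ap s l)" if l: "l \<in> E \<omega>" for l
  proof (rule omega_induct[OF l, of "{s}"])
    show "D {s} (\<lambda>e. \<forall>k\<in>E (e 0). E (ap s k) \<subseteq> E (ap s (e 0)))"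
      by (intro D_ball D_subset DT_ap DT_param DT_var) (simp_all add: sC)
    show "\<forall>k\<in>E (succ V l). E (ap s k) \<subseteq> E (ap s (succ V l))"
      if "l \<in> E \<omega>" "\<forall>k\<in>E l. E (ap s k) \<subseteq> E (ap s l)" for l
      using that st(2)[OF that(1)] fin[OF sT[OF that(1)]] elts_in[OF that(1)] by auto
  qed simp
  define u where "u = ran_union s"
  have u: "u \<in> N" "u \<in> C" unfolding u_def using union[OF s(1)] N_sub by auto
  have elts_u: "E u = {r. \<exists>k\<in>E \<omega>. r \<in> E (ap s k)}"
    unfolding u_def ran_union_def elts_the_set[OF coded_ran_union[OF sC]]
    by (auto simp: function_rel_iff[OF s(2)])
  have rel_u: "rel V u i y \<longleftrightarrow> (\<exists>k\<in>E \<omega>. rel V (ap s k) i y)" for i y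
    by (auto simp: rel_iff elts_u)
  have single: "y = z" if y: "rel V u i y" and z: "rel V u i z" for i y z
  proof -
    obtain k l where k: "k \<in> E \<omega>" "rel V (ap s k) i y" and l: "l \<in> E \<omega>" "rel V (ap s l) i z"
      using y z unfolding rel_u by blast
    \<comment> \<open>The later of the stages \<open>k\<close> and \<open>l\<close> contains both
      pairs, by \<open>mono\<close>.\<close>
    have "\<exists>j\<in>E \<omega>. rel V (ap s j) i y \<and> rel V (ap s j) i z"
      using nat_trichotomy[OF k(1) l(1)] mono[OF k(1)] mono[OF l(1)] k l
      unfolding rel_iff subset_iff by blast
    then obtain j where j: "j \<in> E \<omega>" "rel V (ap s j) i y" "rel V (ap s j) i z" by blast
    obtain m where "seq m (ap s j)" using fin[OF sT[OF j(1)]] by blast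
    from seq_rel_iff[OF this] show ?thesis using j(2,3) by simp
  qed
  \<comment> \<open>Each stage is longer by one, so every length is exceeded whatever the length of
    the first stage.\<close>
  have long: "\<exists>k\<in>E \<omega>. \<exists>m\<in>E \<omega>. seq m (ap s k) \<and> n \<in> E m" if n: "n \<in> E \<omega>" for n
  proof (rule omega_induct[OF n, of "{s}"])
    show "D {s} (\<lambda>e. \<exists>k\<in>E \<omega>. \<exists>m\<in>E \<omega>. seq m (ap s k) \<and> e 0 \<in> E m)"
      by (intro D_intros D_seq DT_ap DT_param DT_omega) (simp_all add: sC)
    obtain m where "m \<in> E \<omega>" "seq m (ap s emptyset)" using fin[OF sT[OF zero_in_omega]] by blast
    then show "\<exists>k\<in>E \<omega>. \<exists>m\<in>E \<omega>. seq m (ap s k) \<and> emptyset \<in> E m"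
      using st(1)[OF zero_in_omega] zero_mem_succ succ_in_omega zero_in_omega by meson
    show "\<exists>k\<in>E \<omega>. \<exists>m\<in>E \<omega>. seq m (ap s k) \<and> succ V n \<in> E m"
      if "\<exists>k\<in>E \<omega>. \<exists>m\<in>E \<omega>. seq m (ap s k) \<and> n \<in> E m" for n
      using that st(1) succ_mem_succ succ_in_omega by meson
  qed
  have "seq \<omega> u" unfolding seq_def
  proof (intro conjI ballI)
    show "is_set V u" unfolding u_def ran_union_def
      by (rule is_set_the_set[OF coded_ran_union[OF sC]])
    show "\<exists>i\<in>E \<omega>. \<exists>y. is_pair V r i y" if r: "r \<in> E u" for r
    proof -
      obtain k where k: "k \<in> E \<omega>" "r \<in> E (ap s k)" using r unfolding elts_u by blast
      obtain m where m: "m \<in> E \<omega>" "seq m (ap s k)" using fin[OF sT[OF k(1)]] by blast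
      then obtain i y where "i \<in> E m" "is_pair V r i y" using k unfolding seq_def by blast
      then show ?thesis using omega_mem m by blast
    qed
    show "\<exists>!y. rel V u i y" if i: "i \<in> E \<omega>" for i
    proof -
      obtain k m where "k \<in> E \<omega>" "seq m (ap s k)" "i \<in> E m" using long[OF i] by blast
      then have "rel V u i (ap (ap s k) i)" unfolding rel_u using seq_rel_iff by blast
      then show ?thesis using single by blast
    qed
  qed
  moreover have "restr u n \<in> E T" if n: "n \<in> E \<omega>" for n
  proof -
    obtain k m where k: "k \<in> E \<omega>" and m: "m \<in> E \<omega>" "seq m (ap s k)" "n \<in> E m" using long[OF n] by blast
    have nC: "n \<in> C" and sk: "ap s k \<in> C" using n elts_in by auto
    have nm: "E n \<subseteq> E m" using nat_transitive[OF m(1,3)] .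
    \<comment> \<open>Stage \<open>k\<close> already has a value at every position below
      \<open>n\<close>, and \<open>u\<close> is single-valued, so \<open>u\<close> adds nothing
      there. The restriction is then in the tree by \<open>res\<close>.\<close>
    have "E (restr u n) = E (restr (ap s k) n)"
    proof
      show "E (restr (ap s k) n) \<subseteq> E (restr u n)"
        unfolding elts_restr[OF u(2) nC] elts_restr[OF sk nC] elts_u using k by blast
      show "E (restr u n) \<subseteq> E (restr (ap s k) n)"
      proof
        fix r assume "r \<in> E (restr u n)"
        then obtain i y where r: "r \<in> E u" "i \<in> E n" "is_pair V r i y"
          unfolding elts_restr[OF u(2) nC] by blast
        then have y: "rel V u i y" by (simp add: rel_iff is_pair_iff)
        have "rel V (ap s k) i (ap (ap s k) i)" using seq_rel_iff[OF m(2)] nm r(2) by blast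
        moreover from this have "rel V u i (ap (ap s k) i)" unfolding rel_u using k by blast
        ultimately have "rel V (ap s k) i y" using single[OF y] by simp
        then have "r \<in> E (ap s k)" using r(3) by (simp add: rel_iff is_pair_iff)
        then show "r \<in> E (restr (ap s k) n)" unfolding elts_restr[OF sk nC] using r by blast
      qed
    qed
    then have "restr u n = restr (ap s k) n"
      by (intro is_set_ext) (simp_all add: is_set_restr u nC sk)
    then show ?thesis using res[OF sT[OF k] m] by simp
  qed
  ultimately show thesis using that u(1) by blast
qed

end

text \<open>The tree consists of the finite sequences of correct choices in \<open>B\<close>; a
  branch through it is a choice function.\<close>

theorem countable_choice:
  assumes DC: "DC V" and P: "D K (\<lambda>s. P (s 0) (s 1))" and B: "B \<in> C"
    and ex: "\<And>n. n \<in> E \<omega> \<Longrightarrow> \<exists>y\<in>E B. P n y"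
  obtains f where "is_function V f \<omega> B" "\<And>n. n \<in> E \<omega> \<Longrightarrow> P n (ap f n)"
proof -
  have "coded {r. \<exists>n\<in>E \<omega>. \<exists>y\<in>E B. r = opair n y}"
    by (rule coded_UN2[of "{}" opair]) (auto intro: DT_opair DT_var B)
  then obtain W where W: "W \<in> C" "E W = {r. \<exists>n\<in>E \<omega>. \<exists>y\<in>E B. r = opair n y}"
    using elts_the_set the_set_in by blast
  let ?Q = "\<lambda>t. (\<exists>m\<in>E \<omega>. seq m t) \<and> (\<forall>i\<in>E \<omega>. \<forall>y\<in>C. rel V t i y \<longrightarrow> y \<in> E B \<and> P i y)"
  define Ts where "Ts = {t. is_set V t \<and> E t \<subseteq> E W \<and> ?Q t}"
  have P': "D (insert B K) (\<lambda>s. P (s n) (s m))" for n m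
    by (rule D_subst2[OF DT_var DT_var P]) blast
  have c: "coded Ts" unfolding Ts_def
  proof (rule coded_Collect[OF coded_Pow[OF W(1)], of _ "insert W (insert B K)"])
    show "D (insert W (insert B K)) (\<lambda>s. is_set V (s 0) \<and> E (s 0) \<subseteq> E W \<and> ?Q (s 0))"
      by (intro D_intros D_subset D_seq D_rel DT_omega DT_param D_mono[OF P']) (use W B in auto)
  qed blast
  define T where "T = Set Ts"
  have T: "T \<in> C" "is_set V T" "E T = Ts"
    using c by (simp_all add: T_def the_set_in is_set_the_set elts_the_set)
  \<comment> \<open>Lets \<open>tree_branch\<close> be applied with the whole carrier as the
    transitive class.\<close>
  have V: "V\<lparr>carrier := C\<rparr> = V" by simp
  have TI: "t \<in> Ts" if t: "seq m t" "m \<in> E \<omega>" "\<And>i. i \<in> E m \<Longrightarrow> ap t i \<in> E B \<and> P i (ap t i)" for t m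
    unfolding Ts_def W(2) mem_Collect_eq seq_rel_iff[OF t(1)] seq_elts[OF t(1)]
    using seq_is_set[OF t(1)] t omega_mem by blast
  have TD: "ap t i \<in> E B \<and> P i (ap t i)" if "t \<in> Ts" "seq m t" "m \<in> E \<omega>" "i \<in> E m" for t m i
    using that seq_rel_iff[OF that(2), of i "ap t i"] omega_mem[OF that(4,3)] unfolding Ts_def by simp
  obtain u where u: "seq \<omega> u" "\<And>n. n \<in> E \<omega> \<Longrightarrow> restr u n \<in> E T"
  proof (rule tree_branch[of C T])
    show "E T \<noteq> {}"
    proof -
      have "seq emptyset emptyset" using codes_emptyset by (simp add: seq_def codes_def)
      from TI[OF this] show ?thesis unfolding T(3) by auto
    qed
    show "extension T \<in> C" by (simp add: extension_def the_set_in coded_extension T(1))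
    show "ran_union s \<in> C" if "s \<in> C" for s by (simp add: ran_union_def the_set_in coded_ran_union that)
    show "\<exists>m\<in>E \<omega>. seq m t" if "t \<in> E T" for t using that unfolding T(3) Ts_def by blast
    show "\<exists>t'\<in>E T. seq (succ V m) t' \<and> E t \<subseteq> E t'" if t: "t \<in> E T" "m \<in> E \<omega>" "seq m t" for t m
    proof -
      obtain y where y: "y \<in> E B" "P m y" using ex[OF t(2)] by blast
      have mC: "m \<in> C" and yC: "y \<in> C" using t y elts_in by blast+
      let ?t = "Set (insert (opair m y) (E t))"
      note s = seq_insert[OF t(3) mC yC]
      have "ap ?t i = (if i = m then y else ap t i)" if "i \<in> E (succ V m)" for i
      proof -
        have "opair i (if i = m then y else ap t i) \<in> E ?t"
          unfolding elts_the_set[OF s(2)] using that mC seq_elts[OF t(3)] by auto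
        then have "rel V ?t i (if i = m then y else ap t i)"
          using yC elts_in[OF that] by (simp add: rel_iff)
        then show ?thesis unfolding seq_rel_iff[OF s(1)] by simp
      qed
      then have "?t \<in> Ts"
        using y TD[OF t(1)[unfolded T(3)] t(3,2)] mC by (intro TI[OF s(1)]) (auto simp: t(2))
      then show ?thesis unfolding T(3) using s(1) by (auto simp: elts_the_set[OF s(2)])
    qed
    show "restr t n \<in> E T" if t: "t \<in> E T" "m \<in> E \<omega>" "seq m t" "n \<in> E m" for t m n
    proof -
      have nm: "E n \<subseteq> E m" using nat_transitive[OF t(2,4)] .
      note r = seq_restr[OF t(3) elts_in[OF t(4)] nm]
      show ?thesis unfolding T(3)
        by (rule TI[OF r(1) omega_mem[OF t(4,2)]])
          (use r(2) nm TD[OF t(1)[unfolded T(3)] t(3,2)] in auto)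
    qed
  qed (use DC T V elts_in in auto)
  have uB: "ap u n \<in> E B \<and> P n (ap u n)" if n: "n \<in> E \<omega>" for n
  proof -
    \<comment> \<open>Position \<open>n\<close> is visible only in the restriction of length
      \<open>succ V n\<close>.\<close>
    have sn: "succ V n \<in> E \<omega>" "n \<in> E (succ V n)" using n by (auto simp: elts_in)
    note r = seq_restr[OF u(1) elts_in[OF sn(1)] omega_elts_subset[OF sn(1)]]
    show ?thesis using TD[OF u(2)[OF sn(1), unfolded T(3)] r(1) sn] r(2)[OF sn(2)] by simp
  qed
  have "is_function V u \<omega> B"
    unfolding is_function_def is_relation_def
    using u(1) uB elts_in by (auto simp: seq_def seq_elts[OF u(1)] is_pair_iff)
  then show thesis using that uB by blast
qed

end

section \<open>Shift completeness and dependent choice\<close>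

context zfa
begin

lemma elts_closed: "\<forall>x\<in>C. E x \<subseteq> C"
  using elts_in by blast

end

context zfa_group
begin

text \<open>It suffices that the group maps \<open>x\<close> into itself: the inverse of
  \<open>p\<close> gives the other inclusion.\<close>

lemma fixed_set:
  assumes H: "perm_subgroup V H G" and x: "is_set V x"
    and sub: "\<And>p y. p \<in> E H \<Longrightarrow> y \<in> E x \<Longrightarrow> ac p y \<in> E x" and p: "p \<in> E H"
  shows "ac p x = x"
proof (rule is_set_ext)
  have pG: "p \<in> E G" and inv: "perm_inv V p \<in> E H" using H p by (auto simp: subgroup_iff)
  have "y \<in> ac p ` E x" if "y \<in> E x" for y
    by (rule image_eqI[OF _ sub[OF inv that]]) (simp add: pG elts_in[OF that])
  then show "E (ac p x) = E x" using sub[OF p] by (auto simp: elts_ac pG is_set_in[OF x])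
  show "is_set V (ac p x)" by (rule is_set_ac[OF elts_in[OF p] x])
qed (rule x)

lemma subgroup_INT:
  assumes "I \<noteq> {}" "\<And>i. i \<in> I \<Longrightarrow> perm_subgroup V (H i) G" "coded (\<Inter>i\<in>I. E (H i))"
  shows "perm_subgroup V (Set (\<Inter>i\<in>I. E (H i))) G"
  unfolding subgroup_iff elts_the_set[OF assms(3)]
proof (intro conjI ballI)
  have H: "E (H i) \<subseteq> E G" "perm_id V \<in> E (H i)" "\<forall>p\<in>E (H i). \<forall>q\<in>E (H i). perm_comp V p q \<in> E (H i)"
    "\<forall>p\<in>E (H i). perm_inv V p \<in> E (H i)" if "i \<in> I" for i
    using assms(2)[OF that] by (simp_all add: subgroup_iff)
  show "is_set V (Set (\<Inter>i\<in>I. E (H i)))" by (rule is_set_the_set[OF assms(3)])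
  show "(\<Inter>i\<in>I. E (H i)) \<subseteq> E G" using assms(1) H(1) by blast
  show "perm_id V \<in> (\<Inter>i\<in>I. E (H i))" using H(2) by blast
  show "perm_comp V p q \<in> (\<Inter>i\<in>I. E (H i))"
    if "p \<in> (\<Inter>i\<in>I. E (H i))" "q \<in> (\<Inter>i\<in>I. E (H i))" for p q
    using that H(3) by blast
  show "perm_inv V p \<in> (\<Inter>i\<in>I. E (H i))" if "p \<in> (\<Inter>i\<in>I. E (H i))" for p
    using that H(4) by blast
qed

lemma ac_ap: "p \<in> E G \<Longrightarrow> f \<in> C \<Longrightarrow> x \<in> C \<Longrightarrow> ac p (ap f x) = ap (ac p f) (ac p x)"
  by (rule automorphism_ap[OF automorphism_G])

lemma ac_restr:
  assumes p: "p \<in> E G" and t: "t \<in> C" and n: "n \<in> E \<omega>"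
  shows "ac p (restr t n) = restr (ac p t) n"
proof -
  have "ac p (restr t n) = restr (ac p t) (ac p n)"
    by (rule DT_invariant2[OF automorphism_G[OF p], of "{}"])
      (auto intro: DT_restr DT_var simp: t elts_in[OF n])
  then show ?thesis by (simp add: ac_nat p n)
qed

lemma seq_ac: "p \<in> E G \<Longrightarrow> n \<in> E \<omega> \<Longrightarrow> seq n t \<Longrightarrow> seq n (ac p t)"
proof -
  assume p: "p \<in> E G" and n: "n \<in> E \<omega>" and t: "seq n t"
  have "D {n} (\<lambda>s. seq n (s 0))" by (intro D_seq DT_param DT_var) (use n elts_in in auto)
  from D_invariant1[OF automorphism_G[OF p] _ this seq_in[OF t]] show ?thesis
    using t ac_nat[OF p n] by auto
qed

end

context zfa_filter
begin

lemma N_sub: "N \<subseteq> C"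
  using HS_in by blast

lemma N_closed: "\<forall>x\<in>N. E x \<subseteq> N"
  using HS_elts by blast

text \<open>An operation definable without parameters keeps the support of its argument, so only the
  elements of the value have to be checked.\<close>

lemma HS_term:
  assumes t: "DT {} (\<lambda>s. t (s 0))" and x: "x \<in> N" and el: "E (t x) \<subseteq> N" shows "t x \<in> N"
proof (rule HS_I[OF _ HS_sym[OF x] _ el])
  show "t x \<in> C" using DT_in[OF t, of "\<lambda>_. x"] HS_in[OF x] by (simp add: assignment_const)
  show "ac p (t x) = t x" if "p \<in> E (Sym x)" for p
    using that DT_invariant1[OF automorphism_G _ t HS_in[OF x], of p] by (simp add: elts_sym HS_in[OF x])
qed

text \<open>Initial segments are built by finitely many insertions, in the sense of
  \<open>V\<close>. The infinite sequence has values in \<open>N\<close> but may itself fail to be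
  symmetric.\<close>

lemma HS_restr:
  assumes x: "seq \<omega> x" and xN: "\<And>n. n \<in> E \<omega> \<Longrightarrow> ap x n \<in> N" and n: "n \<in> E \<omega>"
  shows "restr x n \<in> N"
proof (rule omega_induct[OF n, of "{G, F, x}"])
  show "D {G, F, x} (\<lambda>s. restr x (s 0) \<in> N)"
    by (intro D_HS DT_restr DT_param DT_var) (auto simp: seq_in[OF x])
  show "restr x (succ V n) \<in> N" if "n \<in> E \<omega>" "restr x n \<in> N" for n
    unfolding restr_succ[OF x that(1)]
    by (intro HS_insert HS_opair HS_nat xN that)
qed (simp add: restr_zero seq_in[OF x] HS_empty)

lemma essential_in_F: "H \<in> E (essential_subfilter V G F) \<Longrightarrow> H \<in> E F"
  unfolding elts_essential using F_superset HS_sym by blast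

lemma coded_INT_conjugates:
  assumes q: "is_function V q \<omega> G" and h: "is_function V h \<omega> (essential_subfilter V G F)"
  shows "coded (\<Inter>n\<in>E \<omega>. E (ac (ap q n) (ap h n)))"
proof -
  have "D {h, q} (\<lambda>s. \<forall>n\<in>E \<omega>. s 0 \<in> E (ac (ap q n) (ap h n)))"
    by (intro D_intros DT_ac DT_ap DT_omega DT_param) (use q h function_in in auto)
  from separation[OF this, of "ac (ap q emptyset) (ap h emptyset)"] show ?thesis
    by (rule back_subst[of coded]) auto
qed

text \<open>Rewrites the condition with the total operations \<open>ap\<close> and
  \<open>ac\<close>, for which definability and invariance are available.\<close>

lemma shift_complete_iff:
  "shift_complete V G (essential_subfilter V G F) \<longleftrightarrow>
    (\<forall>h. is_function V h \<omega> (essential_subfilter V G F) \<and>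
        (\<forall>n\<in>E \<omega>. \<forall>m\<in>E n. E (ap h n) \<subseteq> E (ap h m)) \<longrightarrow>
      (\<exists>p q. is_function V p \<omega> G \<and> is_function V q \<omega> G \<and> ap q emptyset = perm_id V \<and>
        (\<forall>n\<in>E \<omega>. ap q (succ V n) = perm_comp V (ap p n) (ap q n)) \<and>
        (\<forall>n\<in>E \<omega>. ap p n \<in> E (ac (ap q n) (ap h n))) \<and>
        Set (\<Inter>n\<in>E \<omega>. E (ac (ap q n) (ap h n))) \<in> E (essential_subfilter V G F)))"
proof -
  have conj: "conjugate V (ap q n) (ap h n) = ac (ap q n) (ap h n)"
    if q: "is_function V q \<omega> G" and h: "is_function V h \<omega> (essential_subfilter V G F)"
      and n: "n \<in> E \<omega>" for q h n
    using function_ap[OF h n] function_ap[OF q n]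
    by (simp add: conjugate_eq elts_essential subgroup_iff)
  have dec: "(\<forall>n\<in>E \<omega>. \<forall>m\<in>E n. E (app V h n) \<subseteq> E (app V h m)) \<longleftrightarrow>
      (\<forall>n\<in>E \<omega>. \<forall>m\<in>E n. E (ap h n) \<subseteq> E (ap h m))"
    if h: "is_function V h \<omega> (essential_subfilter V G F)" for h
    by (intro ball_cong refl) (simp add: function_app[OF h] omega_mem)
  have body: "(app V q (zero V) = perm_id V \<and>
        (\<forall>n\<in>E \<omega>. app V q (succ V n) = perm_comp V (app V p n) (app V q n)) \<and>
        (\<forall>n\<in>E \<omega>. app V p n \<in> E (conjugate V (app V q n) (app V h n))) \<and>
        Set (\<Inter>n\<in>E \<omega>. E (conjugate V (app V q n) (app V h n))) \<in> E (essential_subfilter V G F))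
    \<longleftrightarrow> (ap q emptyset = perm_id V \<and>
        (\<forall>n\<in>E \<omega>. ap q (succ V n) = perm_comp V (ap p n) (ap q n)) \<and>
        (\<forall>n\<in>E \<omega>. ap p n \<in> E (ac (ap q n) (ap h n))) \<and>
        Set (\<Inter>n\<in>E \<omega>. E (ac (ap q n) (ap h n))) \<in> E (essential_subfilter V G F))"
    if h: "is_function V h \<omega> (essential_subfilter V G F)" and p: "is_function V p \<omega> G"
      and q: "is_function V q \<omega> G" for h p q
    by (simp add: conj[OF q h] function_app[OF h] function_app[OF q] function_app[OF p] cong: ball_cong INF_cong)
  show ?thesis
    unfolding shift_complete_def
    by (intro all_cong1 imp_cong conj_cong refl dec ex_cong1 body) auto
qed

theorem DC_of_shift_complete:
  assumes DC: "DC V" and SC: "shift_complete V G (essential_subfilter V G F)"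
  shows "DC (V\<lparr>carrier := N\<rparr>)"
  unfolding DC_M[OF N_sub N_closed HS_omega]
proof (intro ballI impI, elim conjE)
  fix X R
  assume X: "X \<in> N" and R: "R \<in> N" and hyp: "is_set V X" "E X \<noteq> {}" "is_relation V R X X"
    "\<forall>x\<in>E X. \<exists>y\<in>E X. rel V R x y"
  have XC: "X \<in> C" and RC: "R \<in> C" using X R HS_in by auto
  have V: "V\<lparr>carrier := C\<rparr> = V" by simp
  obtain s where s: "is_function V s \<omega> X" and sR: "\<And>n. n \<in> E \<omega> \<Longrightarrow> rel V R (ap s n) (ap s (succ V n))"
    using DC_M[OF subset_refl elts_closed omega_in, unfolded V] DC XC RC hyp by blast
  have sC: "s \<in> C" by (rule function_in[OF s])
  have s_seq: "seq \<omega> s" by (rule function_seq[OF s])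
  have sX: "ap s n \<in> E X" "ap s n \<in> N" if "n \<in> E \<omega>" for n
    using function_ap[OF s that] HS_elts[OF X] by auto
  \<comment> \<open>A single object of the model codes \<open>X\<close>, \<open>R\<close> and the
    first \<open>succ V n\<close> terms of the chain, so the intended subgroup is one stabilizer and
    thus in the essential subfilter. Length \<open>succ V n\<close> includes the term at
    \<open>n\<close>.\<close>
  define z where "z n = opair (opair X R) (restr s (succ V n))" for n
  have zN: "z n \<in> N" if "n \<in> E \<omega>" for n
    unfolding z_def by (intro HS_opair X R HS_restr[OF s_seq sX(2)] succ_in_omega that)
  have zC: "z n \<in> C" if "n \<in> C" for n
    using that by (simp add: z_def XC RC restr_in sC)
  have stab: "p \<in> E G \<and> ac p X = X \<and> ac p R = R \<and> ac p (restr s (succ V n)) = restr s (succ V n)"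
    if n: "n \<in> E \<omega>" and p: "p \<in> E (Sym (z n))" for n p
  proof -
    have nC: "n \<in> C" using elts_in[OF n] .
    have "p \<in> E G" "ac p (z n) = z n" using p by (auto simp: elts_sym zC[OF nC])
    then show ?thesis using nC by (simp add: z_def XC RC restr_in sC ac_opair)
  qed
  have stab_s: "ac p (ap s i) = ap s i" if n: "n \<in> E \<omega>" and p: "p \<in> E (Sym (z n))" and i: "i \<in> E (succ V n)" for n p i
  proof -
    have pG: "p \<in> E G" using stab[OF n p] by blast
    have sn: "succ V n \<in> E \<omega>" and snC: "succ V n \<in> C" using n elts_in by auto
    have i': "i \<in> E \<omega>" "i \<in> C" using omega_mem[OF i sn] elts_in by auto
    note r = seq_restr(2)[OF s_seq snC omega_elts_subset[OF sn] i]
    show ?thesis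
      using ac_ap[OF pG restr_in[OF sC snC] i'(2)] stab[OF n p] ac_nat[OF pG i'(1)] r by simp
  qed
  define h where "h = lam \<omega> (\<lambda>n. Sym (z n))"
  have DTz: "DT {G, X, R, s} (\<lambda>e. Sym (z (e 0)))"
    unfolding z_def by (intro DT_sym DT_opair DT_restr DT_succ DT_param DT_var) (simp_all add: XC RC sC)
  have h_ap: "ap h n = Sym (z n)" if "n \<in> E \<omega>" for n
    unfolding h_def by (rule ap_lam[OF DTz omega_in that])
  have h: "is_function V h \<omega> (essential_subfilter V G F)"
    unfolding h_def
    by (rule function_lam[OF DTz omega_in]) (use zN zC sym_subgroup elts_in in \<open>auto simp: elts_essential\<close>)
  have decr: "E (ap h n) \<subseteq> E (ap h m)" if n: "n \<in> E \<omega>" and m: "m \<in> E n" for n m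
  proof
    have m': "m \<in> E \<omega>" using omega_mem[OF m n] .
    have nC: "n \<in> C" "m \<in> C" and C': "succ V n \<in> C" "succ V m \<in> C" using n m elts_in by auto
    fix p assume "p \<in> E (ap h n)"
    then have p: "p \<in> E (Sym (z n))" by (simp add: h_ap n)
    have pG: "p \<in> E G" using stab[OF n p] by blast
    have sub: "E (succ V m) \<subseteq> E (succ V n)" using nat_transitive[OF n m] m nC by auto
    have "ac p (restr s (succ V m)) = restr s (succ V m)"
      using ac_restr[OF pG restr_in[OF sC C'(1)] succ_in_omega[OF m']] stab[OF n p]
      by (simp add: restr_restr[OF sC C'(2) C'(1) sub])
    then have "ac p (z m) = z m"
      using stab[OF n p] by (simp add: z_def ac_opair pG XC RC restr_in sC C')
    then show "p \<in> E (ap h m)" by (simp add: h_ap m' elts_sym zC nC pG)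
  qed
  obtain p q where p: "is_function V p \<omega> G" and q: "is_function V q \<omega> G" and q0: "ap q emptyset = perm_id V"
    and qS: "\<And>n. n \<in> E \<omega> \<Longrightarrow> ap q (succ V n) = perm_comp V (ap p n) (ap q n)"
    and pK: "\<And>n. n \<in> E \<omega> \<Longrightarrow> ap p n \<in> E (ac (ap q n) (ap h n))"
    and K: "Set (\<Inter>n\<in>E \<omega>. E (ac (ap q n) (ap h n))) \<in> E (essential_subfilter V G F)"
    using SC[unfolded shift_complete_iff, rule_format, of h] h decr by blast
  have qC: "q \<in> C" by (rule function_in[OF q])
  have qG: "ap q n \<in> E G" if "n \<in> E \<omega>" for n using function_ap[OF q that] .
  have conj: "\<exists>g\<in>E (Sym (z n)). k = ac (ap q n) g" if "n \<in> E \<omega>" "k \<in> E (ac (ap q n) (ap h n))" for n k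
  proof -
    have "E (ac (ap q n) (ap h n)) = ac (ap q n) ` E (ap h n)" by (rule elts_ac[OF qG[OF that(1)] ap_in])
    then show ?thesis using that(2) unfolding h_ap[OF that(1)] by blast
  qed
  \<comment> \<open>\<open>k\<close> is the conjugate by \<open>ap q n\<close> of some
    \<open>g\<close> that fixes \<open>ap s n\<close>.\<close>
  have fix_y: "ac k (ac (ap q n) (ap s n)) = ac (ap q n) (ap s n)"
    if n: "n \<in> E \<omega>" and k: "k \<in> E (ac (ap q n) (ap h n))" for n k
  proof -
    obtain g where g: "g \<in> E (Sym (z n))" "k = ac (ap q n) g" using conj[OF n k] by blast
    have "n \<in> E (succ V n)" using elts_in[OF n] by simp
    from stab_s[OF n g(1) this] show ?thesis
      using stab[OF n g(1)] g(2) by (simp add: ac_ac_perm qG[OF n])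
  qed
  \<comment> \<open>\<open>ap p n\<close> is the conjugate by \<open>ap q n\<close> of a
    \<open>g\<close> fixing \<open>X\<close> and \<open>R\<close>, so the property passes from
    \<open>ap q n\<close> to their composite. It keeps the new sequence inside \<open>X\<close> and
    makes it a chain for \<open>R\<close>.\<close>
  have qXR: "ac (ap q n) X = X \<and> ac (ap q n) R = R" if n: "n \<in> E \<omega>" for n
  proof (rule omega_induct[OF n, of "{X, R, q}"])
    show "D {X, R, q} (\<lambda>e. ac (ap q (e 0)) X = X \<and> ac (ap q (e 0)) R = R)"
      by (intro D_intros DT_ac DT_ap DT_param) (simp_all add: XC RC qC)
    show "ac (ap q emptyset) X = X \<and> ac (ap q emptyset) R = R" by (simp add: q0 XC RC)
    fix n assume n: "n \<in> E \<omega>" and IH: "ac (ap q n) X = X \<and> ac (ap q n) R = R"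
    obtain g where g: "g \<in> E (Sym (z n))" "ap p n = ac (ap q n) g" using conj[OF n pK[OF n]] by blast
    have inv: "ac (perm_inv V (ap q n)) X = X" "ac (perm_inv V (ap q n)) R = R"
      using IH ac_inv_G(2)[OF qG[OF n]] XC RC by metis+
    have "ac (ap p n) X = X" "ac (ap p n) R = R"
      using stab[OF n g(1)] IH inv by (simp_all add: g(2) ac_ac_perm qG[OF n] XC RC)
    then show "ac (ap q (succ V n)) X = X \<and> ac (ap q (succ V n)) R = R"
      using IH function_ap[OF p n] by (simp add: qS[OF n] qG[OF n] XC RC)
  qed
  define y where "y = lam \<omega> (\<lambda>n. ac (ap q n) (ap s n))"
  have DTy: "DT {q, s} (\<lambda>e. ac (ap q (e 0)) (ap s (e 0)))"
    by (intro DT_ac DT_ap DT_param DT_var) (simp_all add: qC sC)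
  have y_ap: "ap y n = ac (ap q n) (ap s n)" if "n \<in> E \<omega>" for n
    unfolding y_def by (rule ap_lam[OF DTy omega_in that])
  have y: "is_function V y \<omega> X"
    unfolding y_def
  proof (rule function_lam[OF DTy omega_in])
    fix n assume n: "n \<in> E \<omega>"
    have "ac (ap q n) (ap s n) \<in> E (ac (ap q n) X)" unfolding elts_ac[OF qG[OF n] XC] using sX(1)[OF n] by blast
    then show "ac (ap q n) (ap s n) \<in> E X" using qXR[OF n] by simp
  qed
  have elts_y: "E y = (\<lambda>n. opair n (ac (ap q n) (ap s n))) ` E \<omega>"
    unfolding function_elts[OF y] by (rule image_cong) (simp_all add: y_ap)
  have "y \<in> N"
  proof (rule HS_I[OF function_in[OF y] essential_in_F[OF K]])
    have c: "coded (\<Inter>n\<in>E \<omega>. E (ac (ap q n) (ap h n)))" by (rule coded_INT_conjugates[OF q h])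
    show "ac k y = y" if k: "k \<in> E (Set (\<Inter>n\<in>E \<omega>. E (ac (ap q n) (ap h n))))" for k
    proof (rule fixed_set[OF F_subgroup[OF essential_in_F[OF K]] _ _ k])
      show "is_set V y" using y by (simp add: is_function_def is_relation_def)
      fix k r assume k: "k \<in> E (Set (\<Inter>n\<in>E \<omega>. E (ac (ap q n) (ap h n))))" and r: "r \<in> E y"
      have kG: "k \<in> E G" using k F_subgroup[OF essential_in_F[OF K]] by (auto simp: subgroup_iff)
      obtain n where n: "n \<in> E \<omega>" "r = opair n (ac (ap q n) (ap s n))" using r unfolding elts_y by blast
      have "k \<in> E (ac (ap q n) (ap h n))" using k n(1) unfolding elts_the_set[OF c] by blast
      \<comment> \<open>Every pair in \<open>y\<close> is fixed individually, since an element of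
        the intersection lies in each conjugate.\<close>
      then have "ac k r = r" using fix_y[OF n(1)] elts_in[OF n(1)] by (simp add: n(2) ac_opair kG ac_nat n(1))
      then show "ac k r \<in> E y" using r by simp
    qed
    show "E y \<subseteq> N" unfolding elts_y using HS_opair[OF HS_nat] HS_ac[OF qG ap_in] sX(2) by auto
  qed
  moreover have "rel V R (ap y n) (ap y (succ V n))" if n: "n \<in> E \<omega>" for n
  proof -
    \<comment> \<open>One permutation moves the whole edge: \<open>?g\<close> sends
      \<open>ap s (succ V n)\<close> to \<open>ap y (succ V n)\<close> by definition, and
      \<open>ap s n\<close> to \<open>ap y n\<close> because \<open>ap p n\<close> fixes
      \<open>ap y n\<close>.\<close>
    let ?g = "ap q (succ V n)"
    have sn: "succ V n \<in> E \<omega>" using n by simp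
    have "ac ?g (ap s n) = ac (ap p n) (ac (ap q n) (ap s n))"
      using function_ap[OF p n] by (simp add: qS[OF n] qG[OF n])
    also have "\<dots> = ap y n" by (simp add: fix_y[OF n pK[OF n]] y_ap[OF n])
    finally have e: "ac ?g (ap s n) = ap y n" .
    have "opair (ap s n) (ap s (succ V n)) \<in> E R" using sR[OF n] by (simp add: rel_iff)
    then have "ac ?g (opair (ap s n) (ap s (succ V n))) \<in> E (ac ?g R)"
      unfolding elts_ac[OF qG[OF sn] RC] by blast
    then show ?thesis by (simp add: qXR[OF sn] ac_opair qG[OF sn] e y_ap[OF sn] rel_iff)
  qed
  ultimately show "\<exists>s\<in>N. is_function V s \<omega> X \<and> (\<forall>n\<in>E \<omega>. rel V R (ap s n) (ap s (succ V n)))"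
    using y by blast
qed

theorem shift_complete_of_DC:
  assumes DC: "DC V" and DCM: "DC (V\<lparr>carrier := N\<rparr>)"
  shows "shift_complete V G (essential_subfilter V G F)"
  unfolding shift_complete_iff
proof (intro allI impI, elim conjE)
  fix h assume h: "is_function V h \<omega> (essential_subfilter V G F)"
  have hC: "h \<in> C" by (rule function_in[OF h])
  have h_sub: "perm_subgroup V (ap h n) G" if "n \<in> E \<omega>" for n
    using function_ap[OF h that] unfolding elts_essential by blast
  let ?P = "\<lambda>n x. x \<in> N \<and> E (Sym x) \<subseteq> E (ap h n)"
  have P: "D {G, F, h} (\<lambda>s. ?P (s 0) (s 1))"
    by (intro D_conj D_HS D_subset DT_sym DT_ap DT_var DT_param) (simp_all add: hC)
  have ex: "\<exists>x. is_set V x \<and> ?P n x" if n: "n \<in> E \<omega>" for n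
  proof -
    obtain x where x: "x \<in> N" "E (Sym x) \<subseteq> E (ap h n)"
      using function_ap[OF h n] unfolding elts_essential by blast
    have xC: "x \<in> C" using HS_in[OF x(1)] .
    \<comment> \<open>\<open>collection\<close> wants a set as witness, while \<open>x\<close> may
      be an atom; the singleton of \<open>x\<close> is a set, and whatever fixes it fixes
      \<open>x\<close>.\<close>
    have "E (Sym (upair x x)) \<subseteq> E (Sym x)"
      using xC by (auto simp: elts_sym ac_upair upair_eq)
    then show ?thesis using x HS_upair[OF x(1,1)] xC by (intro exI[of _ "upair x x"]) auto
  qed
  obtain B where B: "B \<in> C" "\<And>n. n \<in> E \<omega> \<Longrightarrow> \<exists>x\<in>E B. ?P n x"
    by (rule collection[OF P _ omega_in ex]) (auto simp: hC)
  obtain x where x: "is_function V x \<omega> B" and xP: "\<And>n. n \<in> E \<omega> \<Longrightarrow> ?P n (ap x n)"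
    using countable_choice[OF DC P B] by blast
  have xC: "x \<in> C" by (rule function_in[OF x])
  have x_seq: "seq \<omega> x" by (rule function_seq[OF x])
  have xN: "ap x n \<in> N" if "n \<in> E \<omega>" for n using xP[OF that] by blast
  \<comment> \<open>Every element of \<open>S\<close> fixes the first term, so all nodes of positive
    length in the tree below start with it.\<close>
  define S where "S = Sym (ap x emptyset)"
  have SC: "S \<in> C" and S_elts: "g \<in> E S \<longleftrightarrow> g \<in> E G \<and> ac g (ap x emptyset) = ap x emptyset" for g
    by (simp_all add: S_def sym_in elts_sym)
  have SF: "S \<in> E F" unfolding S_def by (rule HS_sym[OF xN[OF zero_in_omega]])
  define T where "T = Set {t. \<exists>g\<in>E S. \<exists>n\<in>E \<omega>. t = ac g (restr x n)}"
  have cT: "coded {t. \<exists>g\<in>E S. \<exists>n\<in>E \<omega>. t = ac g (restr x n)}"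
    by (rule coded_UN2[of "{x}"], intro DT_ac DT_restr DT_var DT_param) (simp_all add: xC SC)
  have T: "T \<in> C" "is_set V T" "E T = {t. \<exists>g\<in>E S. \<exists>n\<in>E \<omega>. t = ac g (restr x n)}"
    unfolding T_def using cT by (simp_all add: the_set_in is_set_the_set elts_the_set)
  have restr_N: "restr x n \<in> N" if "n \<in> E \<omega>" for n by (rule HS_restr[OF x_seq xN that])
  have restr_x: "seq n (restr x n)" "\<And>i. i \<in> E n \<Longrightarrow> ap (restr x n) i = ap x i"
    "restr x n \<in> C" if n: "n \<in> E \<omega>" for n
    using seq_restr[OF x_seq elts_in[OF n] omega_elts_subset[OF n]] HS_in[OF restr_N[OF n]] by auto
  have TN: "T \<in> N"
  proof (rule HS_I[OF T(1) SF])
    show "E T \<subseteq> N" unfolding T(3) using HS_ac restr_N restr_x(3) by (auto simp: S_elts)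
    show "ac p T = T" if "p \<in> E S" for p
    proof (rule fixed_set[OF F_subgroup[OF SF] T(2) _ that])
      fix p t assume p: "p \<in> E S" and "t \<in> E T"
      then obtain g n where g: "g \<in> E S" "n \<in> E \<omega>" "t = ac g (restr x n)" unfolding T(3) by blast
      then have "ac p t = ac (perm_comp V p g) (restr x n)"
        using p restr_x(3)[OF g(2)] by (simp add: S_elts)
      moreover have "perm_comp V p g \<in> E S" using p g by (simp add: S_elts)
      ultimately show "ac p t \<in> E T" unfolding T(3) using g(2) by blast
    qed
  qed
  have T_seq: "seq n (ac g (restr x n))" if "g \<in> E S" "n \<in> E \<omega>" for g n
    using seq_ac[OF _ that(2) restr_x(1)[OF that(2)], of g] that by (simp add: S_elts)
  have len: "n = m" if "seq m (ac g (restr x n))" "g \<in> E S" "n \<in> E \<omega>" "m \<in> E \<omega>" for g n m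
    using seq_length_nat[OF T_seq[OF that(2,3)] that(1,3,4)] .
  obtain u where u: "u \<in> N" "seq \<omega> u" "\<And>n. n \<in> E \<omega> \<Longrightarrow> restr u n \<in> E T"
  proof (rule tree_branch[OF N_sub N_closed HS_omega DCM TN T(2)])
    show "E T \<noteq> {}"
      unfolding T(3) using zero_in_omega F_subgroup[OF SF] unfolding subgroup_iff by blast
    show "extension T \<in> N"
    proof (rule HS_term[OF DT_extension[OF DT_var] TN])
      show "E (extension T) \<subseteq> N" unfolding elts_extension[OF T(1)] using HS_elts[OF TN] HS_opair by blast
    qed
    show "ran_union s \<in> N" if s: "s \<in> N" for s
    proof (rule HS_term[OF DT_ran_union[OF DT_var] s])
      have "y \<in> N" if "rel V s n y" for n y
        using HS_elts[OF s, of "opair n y"] HS_opair_iff[of n y] that by (simp add: rel_iff)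
      then show "E (ran_union s) \<subseteq> N"
        unfolding ran_union_def elts_the_set[OF coded_ran_union[OF HS_in[OF s]]] using HS_elts by blast
    qed
    show "\<exists>m\<in>E \<omega>. seq m t" if "t \<in> E T" for t using that T_seq unfolding T(3) by blast
    show "\<exists>t'\<in>E T. seq (succ V m) t' \<and> E t \<subseteq> E t'" if t: "t \<in> E T" "m \<in> E \<omega>" "seq m t" for t m
    proof -
      obtain g n where g: "g \<in> E S" "n \<in> E \<omega>" "t = ac g (restr x n)" using t(1) unfolding T(3) by blast
      have n: "n = m" using len[of m g n] t g by simp
      have gG: "g \<in> E G" and sm: "succ V m \<in> E \<omega>" and mC: "m \<in> C" using g t elts_in by (auto simp: S_elts)
      have "E (restr x m) \<subseteq> E (restr x (succ V m))"
        using restr_mono[OF xC mC succ_in[OF mC]] mC by auto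
      then have "E t \<subseteq> E (ac g (restr x (succ V m)))"
        using g(3) n restr_x(3)[OF sm] restr_x(3)[OF t(2)] by (auto simp: elts_ac gG)
      then show ?thesis using T_seq[OF g(1) sm] g(1) sm unfolding T(3) by blast
    qed
    show "restr t n \<in> E T" if t: "t \<in> E T" "m \<in> E \<omega>" "seq m t" "n \<in> E m" for t m n
    proof -
      obtain g k where g: "g \<in> E S" "k \<in> E \<omega>" "t = ac g (restr x k)" using t(1) unfolding T(3) by blast
      have k: "k = m" using len[of m g k] t g by simp
      have gG: "g \<in> E G" and n: "n \<in> E \<omega>" using g omega_mem[OF t(4,2)] by (auto simp: S_elts)
      have "restr t n = ac g (restr (restr x m) n)"
        using ac_restr[OF gG restr_x(3)[OF t(2)] n] g(3) k by simp
      also have "\<dots> = ac g (restr x n)"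
        using restr_restr[OF xC elts_in[OF n] elts_in[OF t(2)] nat_transitive[OF t(2,4)]] by simp
      finally show ?thesis unfolding T(3) using g(1) n by blast
    qed
  qed (rule that)
  have uC: "u \<in> C" using HS_in[OF u(1)] .
  \<comment> \<open>The second conjunct forces the sequence of chosen permutations to begin with the
    identity, as shift completeness demands.\<close>
  let ?Q = "\<lambda>n g. restr u (succ V n) = ac g (restr x (succ V n)) \<and> (n = emptyset \<longrightarrow> g = perm_id V)"
  have Q: "D {u, x, perm_id V} (\<lambda>s. ?Q (s 0) (s 1))"
    by (intro D_intros DT_restr DT_succ DT_ac DT_emptyset DT_param)
      (simp_all add: uC xC elts_in[OF id_in_G])
  have exQ: "\<exists>g\<in>E S. ?Q n g" if n: "n \<in> E \<omega>" for n
  proof -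
    have sn: "succ V n \<in> E \<omega>" using n by simp
    obtain g m where g: "g \<in> E S" "m \<in> E \<omega>" "restr u (succ V n) = ac g (restr x m)"
      using u(3)[OF sn] unfolding T(3) by blast
    have "seq (succ V n) (restr u (succ V n))"
      by (rule seq_restr(1)[OF u(2) elts_in[OF sn] omega_elts_subset[OF sn]])
    then have m: "m = succ V n" using len[of "succ V n" g m] g sn by simp
    show ?thesis
    proof (cases "n = emptyset")
      case True
      have gG: "g \<in> E G" using g by (simp add: S_elts)
      \<comment> \<open>For \<open>n = emptyset\<close> the sequence has the single term
        \<open>ap x emptyset\<close>, which \<open>g\<close> fixes as an element of
        \<open>S\<close>; hence the identity is an admissible choice.\<close>
      have "ac g (restr x (succ V n)) = restr x (succ V n)"
      proof (rule seq_ext[OF T_seq[OF g(1) sn] restr_x(1)[OF sn]])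
        fix i assume i: "i \<in> E (succ V n)"
        then have i0: "i = emptyset" using True by simp
        show "ap (ac g (restr x (succ V n))) i = ap (restr x (succ V n)) i"
          using ac_ap[OF gG restr_x(3)[OF sn], of i] restr_x(2)[OF sn i] g(1)
          by (simp add: i0 ac_nat gG S_elts)
      qed
      then have "?Q n (perm_id V)" using g(3) m restr_x(3)[OF sn] by simp
      then show ?thesis using F_subgroup[OF SF] unfolding subgroup_iff by blast
    next
      case False
      then show ?thesis using g m by blast
    qed
  qed
  obtain q where q: "is_function V q \<omega> S" and qQ: "\<And>n. n \<in> E \<omega> \<Longrightarrow> ?Q n (ap q n)"
    using countable_choice[OF DC Q SC exQ] by blast
  have qC: "q \<in> C" by (rule function_in[OF q])
  have qG: "ap q n \<in> E G" if "n \<in> E \<omega>" for n using function_ap[OF q that] by (simp add: S_elts)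
  have q': "is_function V q \<omega> G"
    using q unfolding is_function_def is_relation_def by (meson S_elts)
  have qx: "ac (ap q n) (ap x i) = ap u i" if n: "n \<in> E \<omega>" and i: "i \<in> E (succ V n)" for n i
  proof -
    have sn: "succ V n \<in> E \<omega>" using n by simp
    have iw: "i \<in> E \<omega>" using omega_mem[OF i sn] .
    have "ap (restr u (succ V n)) i = ap u i"
      by (rule seq_restr(2)[OF u(2) elts_in[OF sn] omega_elts_subset[OF sn] i])
    moreover have "ap (ac (ap q n) (restr x (succ V n))) i = ac (ap q n) (ap (restr x (succ V n)) i)"
      using ac_ap[OF qG[OF n] restr_x(3)[OF sn] elts_in[OF i]] by (simp add: ac_nat qG[OF n] iw)
    ultimately show ?thesis using qQ[OF n] restr_x(2)[OF sn i] by simp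
  qed
  \<comment> \<open>The composites \<open>q\<close> were chosen first; the recursion for them
    dictates these factors.\<close>
  define p where "p = lam \<omega> (\<lambda>n. perm_comp V (ap q (succ V n)) (perm_inv V (ap q n)))"
  have DTp: "DT {q} (\<lambda>s. perm_comp V (ap q (succ V (s 0))) (perm_inv V (ap q (s 0))))"
    by (intro DT_perm_comp DT_perm_inv DT_ap DT_succ DT_param DT_var) (simp_all add: qC)
  have p_ap: "ap p n = perm_comp V (ap q (succ V n)) (perm_inv V (ap q n))" if "n \<in> E \<omega>" for n
    unfolding p_def by (rule ap_lam[OF DTp omega_in that])
  have p: "is_function V p \<omega> G"
    unfolding p_def by (rule function_lam[OF DTp omega_in]) (simp add: qG)
  have qS: "ap q (succ V n) = perm_comp V (ap p n) (ap q n)" if n: "n \<in> E \<omega>" for n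
    by (rule G_ext) (simp_all add: p_ap qG n)
  have pK: "ap p n \<in> E (ac (ap q n) (ap h n))" if n: "n \<in> E \<omega>" for n
  proof -
    have nC: "n \<in> C" using elts_in[OF n] .
    \<comment> \<open>Both factors are matched to the branch at position \<open>n\<close>, so
      \<open>?g\<close> fixes \<open>ap x n\<close> and lies in \<open>ap h n\<close>; its conjugate
      by \<open>ap q n\<close> is \<open>ap p n\<close>.\<close>
    let ?g = "perm_comp V (perm_inv V (ap q n)) (ap q (succ V n))"
    have gG: "?g \<in> E G" by (simp add: qG n)
    have "ac (ap q n) (ap x n) = ap u n" "ac (ap q (succ V n)) (ap x n) = ap u n"
      using qx[OF n, of n] qx[OF succ_in_omega[OF n], of n] nC by simp_all
    moreover have "ac (perm_inv V (ap q n)) (ac (ap q n) (ap x n)) = ap x n"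
      by (simp add: qG n)
    ultimately have "ac ?g (ap x n) = ap x n"
      by (simp add: qG n)
    then have "?g \<in> E (ap h n)" using xP[OF n] gG by (auto simp: elts_sym)
    moreover have "ap p n = ac (ap q n) ?g"
      by (rule G_ext) (simp_all add: p_ap ac_ac_perm qG n)
    ultimately show ?thesis using elts_ac[OF qG[OF n] ap_in, of h n] by blast
  qed
  have c: "coded (\<Inter>n\<in>E \<omega>. E (ac (ap q n) (ap h n)))" by (rule coded_INT_conjugates[OF q' h])
  have "perm_subgroup V (Set (\<Inter>n\<in>E \<omega>. E (ac (ap q n) (ap h n)))) G"
    by (rule subgroup_INT[OF _ _ c]) (use zero_in_omega subgroup_conjugate qG h_sub in blast)+
  moreover have "E (Sym u) \<subseteq> E (ac (ap q n) (ap h n))" if n: "n \<in> E \<omega>" for n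
  proof -
    have nC: "n \<in> C" using elts_in[OF n] .
    have "E (Sym u) \<subseteq> E (Sym (ap u n))"
    proof
      fix g assume "g \<in> E (Sym u)"
      then have g: "g \<in> E G" "ac g u = u" by (simp_all add: elts_sym uC)
      then have "ac g (ap u n) = ap u n" using ac_ap[OF g(1) uC nC] ac_nat[OF g(1) n] by simp
      then show "g \<in> E (Sym (ap u n))" using g by (simp add: elts_sym)
    qed
    \<comment> \<open>\<open>ap u n\<close> is the image of \<open>ap x n\<close> under
      \<open>ap q n\<close>, and stabilizers are conjugated along with the object.\<close>
    also have "Sym (ap u n) = ac (ap q n) (Sym (ap x n))"
      using qx[OF n, of n] nC by (simp add: ac_sym qG n)
    also have "E \<dots> \<subseteq> E (ac (ap q n) (ap h n))"
      using xP[OF n] by (auto simp: elts_ac qG n sym_in)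
    finally show ?thesis .
  qed
  then have "E (Sym u) \<subseteq> E (Set (\<Inter>n\<in>E \<omega>. E (ac (ap q n) (ap h n))))"
    unfolding elts_the_set[OF c] by blast
  ultimately have "Set (\<Inter>n\<in>E \<omega>. E (ac (ap q n) (ap h n))) \<in> E (essential_subfilter V G F)"
    unfolding elts_essential using u(1) by blast
  moreover have "ap q emptyset = perm_id V" using qQ[OF zero_in_omega] by blast
  ultimately show "\<exists>p q. is_function V p \<omega> G \<and> is_function V q \<omega> G \<and> ap q emptyset = perm_id V \<and>
      (\<forall>n\<in>E \<omega>. ap q (succ V n) = perm_comp V (ap p n) (ap q n)) \<and>
      (\<forall>n\<in>E \<omega>. ap p n \<in> E (ac (ap q n) (ap h n))) \<and>
      Set (\<Inter>n\<in>E \<omega>. E (ac (ap q n) (ap h n))) \<in> E (essential_subfilter V G F)"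
    using p q' qS pK by blast
qed

end

theorem mainTheorem1:
  fixes V :: "'v universe" and G F :: 'v
  assumes "ZFA V" and "DC V"
    and "perm_group V G" and "normal_filter V G F"
  shows "shift_complete V G (essential_subfilter V G F) \<longleftrightarrow> DC (permutation_model V G F)"
proof -
  interpret zfa_filter V G F by unfold_locales (fact assms)+
  show ?thesis
    unfolding permutation_model_def using DC_of_shift_complete shift_complete_of_DC assms(2) by blast
qed

end
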